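(* Let $X$ be a smooth manifold and let $M\to X$ be the bundle of pseudo-Riemannian metrics of a fixed signature. For any $p\geq1$, there are no divergence-free natural tensors $\omega\colon J^2M\to\Lambda^pTX$, except the zero $p$-vector.
   Context: $X$ is a smooth manifold (no orientation is involved); $M\to X$ is the bundle of pseudo-Riemannian metrics of a fixed signature; $J^2M$ is the bundle of 2-jets of sections of $M$. A tensor $\omega\colon J^2M\to\Lambda^pTX\subset\otimes^pTX$ here is a smooth morphism of bundles over the identity of $X$; for a metric $g$, $\omega(g)$ is the field $x\mapsto\omega(j^2_xg)$. It is natural if $\omega(\tau\cdot j^2_xg)=\tau_*\omega(j^2_xg)$ for every diffeomorphism $\tau\colon U\to V$ between open sets of $X$ (orientation-preserving or not) and every metric $g$ (of the fixed signature) near $x\in U$, where $\tau\cdot j^2_xg:=j^2_{\tau(x)}(\tau_*g)$. Divergence: $(\mathrm{div}\,\omega)(g)^{j_1\ldots j_{p-1}}=\nabla_k\omega(g)^{j_1\ldots j_{p-1}k}$, with $\nabla$ the Levi-Civita connection of $g$. $\omega$ is divergence-free if $(\mathrm{div}\,\omega)(g)=0$ for every metric $g$ (of the fixed signature, on any open set). *)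

theory Defs
  imports "HOL-Analysis.Analysis" "HOL-Combinatorics.Permutations"
begin

section \<open>Smooth maps between Euclidean spaces\<close>

text \<open>\<open>ck_on k S f\<close> is only meant for open \<open>S\<close>, and so is \<open>smooth_on\<close>.\<close>

primrec ck_on ::
  "nat \<Rightarrow> 'a::euclidean_space set \<Rightarrow> ('a \<Rightarrow> 'b::real_normed_vector) \<Rightarrow> bool" where
  "ck_on 0 S f \<longleftrightarrow> continuous_on S f"
| "ck_on (Suc k) S f \<longleftrightarrow>
     (\<forall>x\<in>S. f differentiable (at x)) \<and> (\<forall>v. ck_on k S (\<lambda>x. frechet_derivative f (at x) v))"

definition smooth_on :: "'a::euclidean_space set \<Rightarrow> ('a \<Rightarrow> 'b::real_normed_vector) \<Rightarrow> bool" where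
  "smooth_on S f \<longleftrightarrow> (\<forall>k. ck_on k S f)"

text \<open>
  Smoothness on an arbitrary subset: locally the restriction of a smooth map. On a relatively open
  subset of a linear subspace this is the usual smoothness along that subspace.
\<close>

definition smooth_on_subset ::
  "'a::euclidean_space set \<Rightarrow> ('a \<Rightarrow> 'b::real_normed_vector) \<Rightarrow> bool" where
  "smooth_on_subset S f \<longleftrightarrow>
     (\<forall>x\<in>S. \<exists>W F. open W \<and> x \<in> W \<and> smooth_on W F \<and> (\<forall>y\<in>W \<inter> S. F y = f y))"


section \<open>Smooth manifolds\<close>

text \<open>
  The manifold is a whole type \<open>'a\<close> (a Hausdorff second countable space) with an atlas of charts
  \<open>(U, \<phi>)\<close>, not required to be maximal. The values of \<open>\<phi>\<close> outside \<open>U\<close> are irrelevant.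
  The dimension is \<open>CARD('n)\<close>.
\<close>

type_synonym ('a, 'n) chart = "'a set \<times> ('a \<Rightarrow> real ^ 'n)"

definition chart_inv :: "('a, 'n) chart \<Rightarrow> real ^ 'n \<Rightarrow> 'a" where
  "chart_inv c = inv_into (fst c) (snd c)"

definition smooth_atlas ::
  "('a::{t2_space,second_countable_topology}, 'n::finite) chart set \<Rightarrow> bool" where
  "smooth_atlas A \<longleftrightarrow>
     (\<Union>c\<in>A. fst c) = UNIV \<and>
     (\<forall>c\<in>A. open (fst c) \<and> inj_on (snd c) (fst c) \<and> open (snd c ` fst c) \<and>
        homeomorphism (fst c) (snd c ` fst c) (snd c) (chart_inv c)) \<and>
     (\<forall>c\<in>A. \<forall>c'\<in>A. smooth_on (snd c ` (fst c \<inter> fst c')) (\<lambda>y. snd c' (chart_inv c y)))"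

definition charts_at :: "('a, 'n) chart set \<Rightarrow> 'a \<Rightarrow> ('a, 'n) chart set" where
  "charts_at A x = {c \<in> A. x \<in> fst c}"

definition smooth_map ::
  "('a::topological_space, 'n::finite) chart set \<Rightarrow> 'a set \<Rightarrow> ('a \<Rightarrow> 'a) \<Rightarrow> bool" where
  "smooth_map A U \<tau> \<longleftrightarrow> continuous_on U \<tau> \<and>
     (\<forall>c\<in>A. \<forall>c'\<in>A. smooth_on (snd c ` {x \<in> fst c \<inter> U. \<tau> x \<in> fst c'})
                        (\<lambda>y. snd c' (\<tau> (chart_inv c y))))"

definition local_diffeo ::
  "('a::topological_space, 'n::finite) chart set \<Rightarrow> 'a set \<Rightarrow> 'a set \<Rightarrow> ('a \<Rightarrow> 'a) \<Rightarrow> bool" where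
  "local_diffeo A U V \<tau> \<longleftrightarrow> open U \<and> open V \<and>
     (\<exists>\<sigma>. homeomorphism U V \<tau> \<sigma> \<and> smooth_map A U \<tau> \<and> smooth_map A V \<sigma>)"

text \<open>
  The partial derivative \<open>\<partial>\<^sub>k f\<close> at \<open>x\<close> of a function on the manifold, in the chart \<open>c\<close>; and the
  matrix at \<open>x\<close> of the tangent map of \<open>\<tau>\<close> in the charts \<open>c\<close> (around \<open>x\<close>) and \<open>c'\<close> (around \<open>\<tau> x\<close>).
  For \<open>\<tau> = id\<close> the latter is the Jacobian matrix of the change of coordinates from \<open>c\<close> to \<open>c'\<close>.
\<close>

definition pdiff :: "('a, 'n::finite) chart \<Rightarrow> 'n \<Rightarrow> ('a \<Rightarrow> real) \<Rightarrow> 'a \<Rightarrow> real" where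
  "pdiff c k f x = frechet_derivative (\<lambda>y. f (chart_inv c y)) (at (snd c x)) (axis k 1)"

definition tangent_matrix ::
  "('a, 'n::finite) chart \<Rightarrow> ('a, 'n) chart \<Rightarrow> ('a \<Rightarrow> 'a) \<Rightarrow> 'a \<Rightarrow> real ^ 'n ^ 'n" where
  "tangent_matrix c c' \<tau> x = jacobian (\<lambda>y. snd c' (\<tau> (chart_inv c y))) (at (snd c x))"


section \<open>Tensors\<close>

text \<open>
  Tensors at a point \<open>x\<close> are families of components, one for each chart around \<open>x\<close>, obeying the
  tensor transformation law. A contravariant \<open>p\<close>-tensor has components \<open>t c [i\<^sub>1, \<dots>, i\<^sub>p]\<close>; for
  uniqueness they are set to 0 when \<open>c\<close> is not a chart around \<open>x\<close> or the multi-index does not have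
  length \<open>p\<close>.
\<close>

type_synonym ('a, 'n) tensor = "('a, 'n) chart \<Rightarrow> 'n list \<Rightarrow> real"

text \<open>\<open>t' = \<tau>\<^sub>* t\<close>, where \<open>t\<close> is a \<open>p\<close>-tensor at \<open>x\<close> and \<open>t'\<close> one at \<open>\<tau> x\<close>.\<close>

definition tensor_push ::
  "('a, 'n::finite) chart set \<Rightarrow> nat \<Rightarrow> ('a \<Rightarrow> 'a) \<Rightarrow> 'a \<Rightarrow> ('a, 'n) tensor \<Rightarrow> ('a, 'n) tensor \<Rightarrow> bool"
where
  "tensor_push A p \<tau> x t t' \<longleftrightarrow>
     (\<forall>c\<in>charts_at A x. \<forall>c'\<in>charts_at A (\<tau> x). \<forall>J. length J = p \<longrightarrow>
        t' c' J = (\<Sum>I | length I = p.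
                     (\<Prod>m<p. tangent_matrix c c' \<tau> x $ (J ! m) $ (I ! m)) * t c I))"

definition contravariant_tensors ::
  "('a, 'n::finite) chart set \<Rightarrow> nat \<Rightarrow> 'a \<Rightarrow> ('a, 'n) tensor set" where
  "contravariant_tensors A p x =
     {t. (\<forall>c I. c \<notin> charts_at A x \<or> length I \<noteq> p \<longrightarrow> t c I = 0) \<and> tensor_push A p id x t t}"

definition p_vectors :: "('a, 'n::finite) chart set \<Rightarrow> nat \<Rightarrow> 'a \<Rightarrow> ('a, 'n) tensor set" where
  "p_vectors A p x =
     {t \<in> contravariant_tensors A p x.
        \<forall>c I \<pi>. length I = p \<and> \<pi> permutes {..<p} \<longrightarrow>
          t c (permute_list \<pi> I) = of_int (sign \<pi>) * t c I}"


section \<open>Pseudo-Riemannian metrics\<close>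

definition has_signature :: "nat \<Rightarrow> nat \<Rightarrow> real ^ 'n ^ 'n::finite \<Rightarrow> bool" where
  "has_signature r s G \<longleftrightarrow>
     (\<exists>(P :: real ^ 'n ^ 'n) S. invertible P \<and> card S = r \<and> card (- S) = s \<and>
        transpose P ** G ** P = (\<chi> i j. if i \<noteq> j then 0 else if i \<in> S then 1 else - 1))"

text \<open>\<open>g x c\<close> is the matrix \<open>(g\<^sub>i\<^sub>j)\<close> of the metric at \<open>x\<close> in the chart \<open>c\<close>.\<close>

type_synonym ('a, 'n) metric_field = "'a \<Rightarrow> ('a, 'n) chart \<Rightarrow> real ^ 'n ^ 'n"

text \<open>\<open>h = \<tau>\<^sub>* g\<close> over the open set \<open>\<tau> ` U\<close>, that is, \<open>g = \<tau>\<^sup>* h\<close> over \<open>U\<close>.\<close>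

definition metric_push ::
  "('a, 'n::finite) chart set \<Rightarrow> ('a \<Rightarrow> 'a) \<Rightarrow> 'a set \<Rightarrow> ('a, 'n) metric_field \<Rightarrow>
   ('a, 'n) metric_field \<Rightarrow> bool" where
  "metric_push A \<tau> U g h \<longleftrightarrow>
     (\<forall>x\<in>U. \<forall>c\<in>charts_at A x. \<forall>c'\<in>charts_at A (\<tau> x).
        g x c = transpose (tangent_matrix c c' \<tau> x) ** h (\<tau> x) c' ** tangent_matrix c c' \<tau> x)"

definition metrics_on ::
  "('a, 'n::finite) chart set \<Rightarrow> nat \<Rightarrow> nat \<Rightarrow> 'a set \<Rightarrow> ('a, 'n) metric_field set" where
  "metrics_on A r s U =
     {g. (\<forall>x\<in>U. \<forall>c\<in>charts_at A x. transpose (g x c) = g x c \<and> has_signature r s (g x c)) \<and>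
         metric_push A id U g g \<and>
         (\<forall>c\<in>A. smooth_on (snd c ` (fst c \<inter> U)) (\<lambda>y. g (chart_inv c y) c))}"


section \<open>The bundle of 2-jets of metrics\<close>

text \<open>
  A 2-jet at \<open>x\<close> is \<open>x\<close> together with the values at \<open>x\<close> of
  \<open>(g\<^sub>i\<^sub>j, \<partial>\<^sub>k g\<^sub>i\<^sub>j, \<partial>\<^sub>k \<partial>\<^sub>l g\<^sub>i\<^sub>j)\<close> in every chart around \<open>x\<close>; so two metrics near \<open>x\<close> have
  the same 2-jet at \<open>x\<close> iff their derivatives up to order 2 at \<open>x\<close> agree.
\<close>

type_synonym ('a, 'n) jet2 =
  "'a \<times> (('a, 'n) chart \<Rightarrow> (real^'n^'n) \<times> (real^'n^'n^'n) \<times> (real^'n^'n^'n^'n))"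

definition jet2_of ::
  "('a, 'n::finite) chart set \<Rightarrow> ('a, 'n) metric_field \<Rightarrow> 'a \<Rightarrow> ('a, 'n) jet2" where
  "jet2_of A g x =
     (x, restrict (\<lambda>c. (g x c,
                        \<chi> k i j. pdiff c k (\<lambda>z. g z c $ i $ j) x,
                        \<chi> k l i j. pdiff c k (pdiff c l (\<lambda>z. g z c $ i $ j)) x))
           (charts_at A x))"

definition jet2_bundle ::
  "('a::topological_space, 'n::finite) chart set \<Rightarrow> nat \<Rightarrow> nat \<Rightarrow> ('a, 'n) jet2 set" where
  "jet2_bundle A r s =
     {jet2_of A g x | g x U. open U \<and> x \<in> U \<and> g \<in> metrics_on A r s U}"

text \<open>
  The part of the jet bundle over the domain of a chart \<open>c\<close>, and the induced coordinates on it.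
  They are redundant (the arrays of derivatives are symmetric), so that their image is a relatively
  open subset of a linear subspace of the Euclidean space in which they take their values.
\<close>

definition jet2_over ::
  "('a::topological_space, 'n::finite) chart set \<Rightarrow> nat \<Rightarrow> nat \<Rightarrow> ('a, 'n) chart \<Rightarrow> ('a, 'n) jet2 set"
where
  "jet2_over A r s c = {z \<in> jet2_bundle A r s. fst z \<in> fst c}"

definition jet2_coords ::
  "('a, 'n::finite) chart \<Rightarrow> ('a, 'n) jet2 \<Rightarrow>
   (real^'n) \<times> (real^'n^'n) \<times> (real^'n^'n^'n) \<times> (real^'n^'n^'n^'n)" where
  "jet2_coords c z = (snd c (fst z), snd z c)"


section \<open>Natural tensors and divergence\<close>

text \<open>Smooth morphisms of bundles \<open>J\<^sup>2M \<rightarrow> \<Lambda>\<^sup>pTX\<close> over the identity of \<open>X\<close>.\<close>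

definition tensor_morphism ::
  "('a::topological_space, 'n::finite) chart set \<Rightarrow> nat \<Rightarrow> nat \<Rightarrow> nat \<Rightarrow>
   (('a, 'n) jet2 \<Rightarrow> ('a, 'n) tensor) \<Rightarrow> bool" where
  "tensor_morphism A r s p \<omega> \<longleftrightarrow>
     (\<forall>z\<in>jet2_bundle A r s. \<omega> z \<in> p_vectors A p (fst z)) \<and>
     (\<forall>c\<in>A. \<forall>I. length I = p \<longrightarrow>
        smooth_on_subset (jet2_coords c ` jet2_over A r s c)
          (\<lambda>v. \<omega> (inv_into (jet2_over A r s c) (jet2_coords c) v) c I))"

definition natural ::
  "('a::topological_space, 'n::finite) chart set \<Rightarrow> nat \<Rightarrow> nat \<Rightarrow> nat \<Rightarrow>
   (('a, 'n) jet2 \<Rightarrow> ('a, 'n) tensor) \<Rightarrow> bool" where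
  "natural A r s p \<omega> \<longleftrightarrow>
     (\<forall>U V \<tau> W g h x. local_diffeo A U V \<tau> \<and> open W \<and> W \<subseteq> U \<and> x \<in> W \<and>
        g \<in> metrics_on A r s W \<and> h \<in> metrics_on A r s (\<tau> ` W) \<and> metric_push A \<tau> W g h \<longrightarrow>
        tensor_push A p \<tau> x (\<omega> (jet2_of A g x)) (\<omega> (jet2_of A h (\<tau> x))))"

text \<open>The Levi-Civita connection, given by \<open>christoffel c g x i k l = \<Gamma>\<^sup>i\<^sub>k\<^sub>l\<close>.\<close>

definition christoffel ::
  "('a, 'n::finite) chart \<Rightarrow> ('a, 'n) metric_field \<Rightarrow> 'a \<Rightarrow> 'n \<Rightarrow> 'n \<Rightarrow> 'n \<Rightarrow> real" where
  "christoffel c g x i k l =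
     (\<Sum>m\<in>UNIV. matrix_inv (g x c) $ i $ m *
        (pdiff c k (\<lambda>z. g z c $ m $ l) x + pdiff c l (\<lambda>z. g z c $ m $ k) x
         - pdiff c m (\<lambda>z. g z c $ k $ l) x)) / 2"

text \<open>\<open>\<nabla>\<^sub>k T\<^sup>I = \<partial>\<^sub>k T\<^sup>I + \<Sum>\<^sub>m \<Sum>\<^sub>l \<Gamma>\<^bsup>I(m)\<^esup>\<^sub>k\<^sub>l T\<^bsup>I[m := l]\<^esup>\<close>\<close>

definition cov_deriv ::
  "('a, 'n::finite) chart \<Rightarrow> ('a, 'n) metric_field \<Rightarrow> ('a \<Rightarrow> ('a, 'n) tensor) \<Rightarrow> 'a \<Rightarrow> 'n \<Rightarrow>
   'n list \<Rightarrow> real" where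
  "cov_deriv c g T x k I =
     pdiff c k (\<lambda>z. T z c I) x
     + (\<Sum>m<length I. \<Sum>l\<in>UNIV. christoffel c g x (I ! m) k l * T x c (I[m := l]))"

definition divergence ::
  "('a, 'n::finite) chart \<Rightarrow> ('a, 'n) metric_field \<Rightarrow> ('a \<Rightarrow> ('a, 'n) tensor) \<Rightarrow> 'a \<Rightarrow> 'n list \<Rightarrow> real"
where
  "divergence c g T x J = (\<Sum>k\<in>UNIV. cov_deriv c g T x k (J @ [k]))"

definition divergence_free ::
  "('a::topological_space, 'n::finite) chart set \<Rightarrow> nat \<Rightarrow> nat \<Rightarrow> nat \<Rightarrow>
   (('a, 'n) jet2 \<Rightarrow> ('a, 'n) tensor) \<Rightarrow> bool" where
  "divergence_free A r s p \<omega> \<longleftrightarrow>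
     (\<forall>U g x c J. open U \<and> g \<in> metrics_on A r s U \<and> x \<in> U \<and> c \<in> charts_at A x \<and>
        length J = p - 1 \<longrightarrow>
        divergence c g (\<lambda>z. \<omega> (jet2_of A g z)) x J = 0)"

end

theory Submission
  imports Defs "HOL-Library.Multiset"
begin

text \<open>
  In a chart, at a point where the metric is the diagonal matrix \<open>E\<close> with vanishing first
  derivatives, the components of \<open>\<omega>\<close> are functions \<open>f\<^sup>I(u)\<close> of the second derivatives \<open>u\<close> of the
  metric. In \<open>div \<omega> = 0\<close> the third derivatives of the metric occur linearly and are arbitrary, which
  means that \<open>\<Sum>\<^sub>k \<xi>\<^sub>k f\<^bsup>Jk\<^esup>\<close> does not change when \<open>h \<otimes> \<xi> \<otimes> \<xi>\<close> is added to \<open>u\<close>. Naturality under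
  cubic changes of coordinates makes \<open>f\<close> invariant under exchanging the two pairs of indices of \<open>u\<close>,
  and naturality under reflections gives parity conditions.

  Differencing \<open>f\<close> in directions \<open>h\<^sub>i \<otimes> \<xi>\<^sub>i \<otimes> \<xi>\<^sub>i\<close> for a basis \<open>\<xi>\<^sub>1, \<dots>, \<xi>\<^sub>n\<close> gives a vector whose
  contraction with every \<open>\<xi>\<^sub>i\<close> is zero, so it vanishes, and by continuity \<open>f\<close> is a polynomial. Its
  top-degree polarisation \<open>G\<close> satisfies \<open>G\<^bsup>Jk\<^esup>(kb,cd,\<dots>) = -1/2 G\<^bsup>Jb\<^esup>(kk,cd,\<dots>)\<close> and
  \<open>G\<^bsup>Jk\<^esup>(kk,cd,\<dots>) = 0\<close>. If a component \<open>G\<^bsup>Jk\<^esup>\<close> is not zero, then by parity \<open>k\<close> occurs in some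
  argument, so that the first identity produces a nonzero component with one more pair of equal
  indices. Hence \<open>G = 0\<close>, and descending on the degree \<open>f = 0\<close>.
\<close>


section \<open>Iterated differences\<close>

text \<open>A dilation changes the value \<open>E\<close> of the metric to a multiple of
  \<open>E\<close>, so naturality gives no homogeneity in \<open>u\<close> at fixed
  \<open>E\<close>: polynomiality has to come from the divergence condition. To use that condition,
  two metrics are compared that have the same 2-jet and whose third derivatives differ by \<xi>
  \<otimes> \<xi> \<otimes> \<xi> \<otimes> h. The Christoffel terms cancel, and what remains holds
  at every \<open>u\<close> and integrates along a line to the finite law. Reflections are
  essential: on an oriented manifold the n-vector dual to the volume form is parallel and natural
  for orientation-preserving maps. They work because, by skew symmetry, a nonzero component with
  indices Jk has k outside J, so that the reflection of the k-th coordinate changes its sign and k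
  must occur an odd number of times in the arguments. Jets (E, 0, u) suffice, since a linear change
  of coordinates brings the value at the point to \<open>E\<close> and a quadratic one kills the
  first derivatives. The combinatorial part never sees \<open>E\<close>, so all signatures are
  treated alike.\<close>

definition iter_diff :: "'v::ab_group_add list \<Rightarrow> ('v \<Rightarrow> real) \<Rightarrow> 'v \<Rightarrow> real" where
  "iter_diff us g = fold (\<lambda>u g x. g (x + u) - g x) us g"

lemma iter_diff_Nil [simp]: "iter_diff [] g = g"
  by (simp add: iter_diff_def)

lemma iter_diff_Cons_inner: "iter_diff (u # us) g = iter_diff us (\<lambda>x. g (x + u) - g x)"
  by (simp add: iter_diff_def)

lemma iter_diff_append: "iter_diff (us @ vs) g = iter_diff vs (iter_diff us g)"
  by (simp add: iter_diff_def)

lemma iter_diff_perm: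
  assumes "mset us = mset vs"
  shows "iter_diff us g = iter_diff vs g"
proof -
  have "fold (\<lambda>u g x. g (x + u) - g x) us = (fold (\<lambda>u g x. g (x + u) - g x) vs :: ('a \<Rightarrow> real) \<Rightarrow> _)"
    by (rule fold_multiset_equiv[OF _ assms]) (auto simp: fun_eq_iff algebra_simps)
  then show ?thesis by (simp add: iter_diff_def)
qed

lemma iter_diff_Cons: "iter_diff (u # us) g x = iter_diff us g (x + u) - iter_diff us g x"
proof -
  have "iter_diff (u # us) g = iter_diff (us @ [u]) g"
    by (rule iter_diff_perm) simp
  then show ?thesis
    by (simp add: iter_diff_append iter_diff_Cons_inner)
qed

lemma iter_diff_0 [simp]: "iter_diff us (\<lambda>x. 0) = (\<lambda>x. 0)"
  by (induction us) (simp_all add: iter_diff_Cons_inner)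

lemma iter_diff_sum:
  "iter_diff us (\<lambda>x. \<Sum>k\<in>K. a k * f k x) x = (\<Sum>k\<in>K. a k * iter_diff us (f k) x)"
proof (induction us arbitrary: x)
  case (Cons u us)
  show ?case
    by (simp add: iter_diff_Cons Cons.IH sum_subtractf[symmetric] algebra_simps)
qed simp

lemma iter_diff_Cons_cong:
  assumes "\<And>x. g (x + u) = g (x + v)"
  shows "iter_diff (u # us) g = iter_diff (v # us) g"
  by (simp add: iter_diff_Cons_inner assms)

lemma iter_diff_zero_mono:
  assumes "mset vs \<subseteq># mset us" "\<And>x. iter_diff vs g x = 0"
  shows "iter_diff us g x = 0"
proof -
  obtain ws where ws: "mset ws = mset us - mset vs" by (metis ex_mset)
  have "iter_diff us g = iter_diff (vs @ ws) g"
    by (rule iter_diff_perm) (use assms(1) ws in simp)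
  also have "\<dots> = iter_diff ws (\<lambda>x. 0)"
  proof -
    have "iter_diff vs g = (\<lambda>x. 0)" using assms(2) by blast
    then show ?thesis by (simp add: iter_diff_append)
  qed
  finally show ?thesis by simp
qed

lemma iter_diff_add_arg:
  "iter_diff ((a + b) # us) g x = iter_diff (a # us) g x + iter_diff (b # us) g (x + a)"
  by (simp add: iter_diff_Cons algebra_simps)

lemma iter_diff_zero_sum_list:
  assumes "\<And>w x. w \<in> set ws \<Longrightarrow> iter_diff (w # us) g x = 0"
  shows "iter_diff (sum_list ws # us) g x = 0"
  using assms
proof (induction ws arbitrary: x)
  case Nil
  then show ?case by (simp add: iter_diff_Cons)
next
  case (Cons w ws)
  then show ?case by (simp add: iter_diff_add_arg)
qed

text \<open>A difference along \<open>sum_list ws\<close> telescopes into differences along the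
  members of \<open>ws\<close> at shifted base points, and these vanish because \<open>zero\<close>
  holds at every \<open>x\<close>. It is enough that \<open>g\<close> cannot tell \<open>u\<close>
  from the sum.\<close>

lemma iter_diff_zero_gen:
  assumes gen: "\<And>u. \<exists>ws. set ws \<subseteq> S \<and> (\<forall>x. g (x + u) = g (x + sum_list ws))"
    and zero: "\<And>us x. set us \<subseteq> S \<Longrightarrow> length us = m \<Longrightarrow> iter_diff us g x = 0"
    and "length us = m"
  shows "iter_diff us g x = 0"
proof -
  \<comment> \<open>\<open>us\<close> holds the arguments that are still arbitrary,
    \<open>vs\<close> those already replaced by members of \<open>S\<close>.\<close>
  have "\<forall>vs x. set vs \<subseteq> S \<longrightarrow> length us + length vs = m \<longrightarrow> iter_diff (us @ vs) g x = 0" for us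
  proof (induction us)
    case Nil
    then show ?case using zero by simp
  next
    case (Cons u us)
    show ?case
    proof (intro allI impI)
      fix vs x assume vs: "set vs \<subseteq> S" "length (u # us) + length vs = m"
      obtain ws where ws: "set ws \<subseteq> S" "\<And>x. g (x + u) = g (x + sum_list ws)"
        using gen by blast
      have "iter_diff (w # us @ vs) g x = 0" if "w \<in> set ws" for w x
      proof -
        have "iter_diff (w # us @ vs) g = iter_diff (us @ (w # vs)) g"
          by (rule iter_diff_perm) simp
        then show ?thesis
          using Cons.IH[rule_format, of "w # vs" x] vs ws that by auto
      qed
      then have "iter_diff (sum_list ws # us @ vs) g x = 0"
        by (rule iter_diff_zero_sum_list)
      then show "iter_diff ((u # us) @ vs) g x = 0"
        using iter_diff_Cons_cong[of g u "sum_list ws" "us @ vs"] ws(2) by simp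
    qed
  qed
  from this[of us, rule_format, of "[]"] show ?thesis using assms(3) by simp
qed

lemma continuous_iter_diff:
  fixes g :: "'v::real_normed_vector \<Rightarrow> real" and U :: "'i \<Rightarrow> 't::topological_space \<Rightarrow> 'v"
  assumes "continuous_on UNIV g" "\<And>i. continuous_on UNIV (U i)" "continuous_on UNIV X"
  shows "continuous_on UNIV (\<lambda>t. iter_diff (map (\<lambda>i. U i t) is) g (X t))"
  using assms(3)
proof (induction "is" arbitrary: X)
  case Nil
  then show ?case
    using continuous_on_compose2[OF assms(1), of UNIV X] by simp
next
  case (Cons i "is")
  show ?case
    using Cons.IH[OF continuous_on_add[OF Cons.prems assms(2)[of i]]] Cons.IH[OF Cons.prems]
    by (simp add: iter_diff_Cons continuous_on_diff)
qed


section \<open>Vanishing of functions of the second derivatives of a metric\<close>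

type_synonym 'n quad = "real^'n^'n^'n^'n"

text \<open>Projection onto the arrays with the symmetries of second derivatives of a metric. The
  functions studied are defined on all arrays and factor through it (\<open>quad_sym_cong\<close>),
  which spares working in a linear subspace.\<close>

definition quad_sym :: "'n::finite quad \<Rightarrow> 'n quad" where
  "quad_sym u = (\<chi> k l i j. (u$k$l$i$j + u$l$k$i$j + u$k$l$j$i + u$l$k$j$i) / 4)"

text \<open>The coefficient belongs to the index because unit arrays are used as generators under
  addition only: a top-order difference is additive in its direction, but real multiples are never
  pulled out of it.\<close>

definition quad_unit :: "'n \<times> 'n \<times> 'n \<times> 'n \<times> real \<Rightarrow> 'n::finite quad" where
  "quad_unit e = (case e of (k, l, i, j, c) \<Rightarrow>
     \<chi> k' l' i' j'. if k' = k \<and> l' = l \<and> i' = i \<and> j' = j then c else 0)"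

definition quad_prod :: "real^'n \<Rightarrow> real^'n \<Rightarrow> real^'n^'n \<Rightarrow> 'n::finite quad" where
  "quad_prod a b h = (\<chi> k l i j. a$k * b$l * h$i$j)"

abbreviation "quad_square \<xi> \<equiv> quad_prod \<xi> \<xi>"

definition sym_unit :: "'n::finite \<Rightarrow> 'n \<Rightarrow> real \<Rightarrow> real^'n^'n" where
  "sym_unit i j c = (\<chi> i' j'. c / 2 * (axis i 1 $ i' * axis j 1 $ j' + axis j 1 $ i' * axis i 1 $ j'))"

definition flip_sign :: "'n \<Rightarrow> 'n \<Rightarrow> real" where
  "flip_sign m k = (if k = m then - 1 else 1)"

definition quad_flip :: "'n \<Rightarrow> 'n::finite quad \<Rightarrow> 'n quad" where
  "quad_flip m u = (\<chi> k l i j.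
     flip_sign m k * flip_sign m l * flip_sign m i * flip_sign m j * u$k$l$i$j)"

lemma quad_eqI:
  fixes u v :: "'n::finite quad"
  assumes "\<And>k l i j. u$k$l$i$j = v$k$l$i$j"
  shows "u = v"
  using assms by (simp add: vec_eq_iff)

text \<open>Symmetrising allows the factor in \<open>i\<close> and \<open>j\<close> to be taken
  symmetric, as \<open>contraction\<close> requires of \<open>h\<close>.\<close>

lemma quad_unit_sym:
  "quad_sym (quad_unit (k, l, i, j, c)) = quad_sym (quad_prod (axis k 1) (axis l 1) (sym_unit i j c))"
proof -
  have "quad_unit (k, l, i, j, c) $ a $ b $ d $ e = axis k 1 $ a * axis l 1 $ b * (axis i 1 $ d * axis j 1 $ e * c)"
    for a b d e
    by (auto simp: quad_unit_def axis_def)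
  then show ?thesis
    by (intro quad_eqI) (simp add: quad_sym_def quad_prod_def sym_unit_def field_simps)
qed

lemma transpose_sym_unit: "transpose (sym_unit i j c) = sym_unit i j c"
  by (simp add: sym_unit_def transpose_def vec_eq_iff algebra_simps)

lemma quad_sum_units:
  fixes u :: "'n::finite quad"
  shows "u = (\<Sum>(k,l,i,j)\<in>UNIV. quad_unit (k, l, i, j, u$k$l$i$j))"
proof (rule quad_eqI)
  fix a b d e
  have "(\<Sum>(k,l,i,j)\<in>UNIV. quad_unit (k, l, i, j, u$k$l$i$j))$a$b$d$e
      = (\<Sum>q\<in>UNIV. if q = (a,b,d,e) then u$a$b$d$e else 0)"
    unfolding sum_component
    by (rule sum.cong) (auto simp: quad_unit_def split: prod.splits)
  then show "u$a$b$d$e = (\<Sum>(k,l,i,j)\<in>UNIV. quad_unit (k, l, i, j, u$k$l$i$j))$a$b$d$e"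
    by simp
qed

lemma quad_sum_unit_list:
  fixes u :: "'n::finite quad"
  shows "\<exists>ws. set ws \<subseteq> range quad_unit \<and> u = sum_list ws"
proof -
  obtain qs :: "('n \<times> 'n \<times> 'n \<times> 'n) list" where qs: "set qs = UNIV" "distinct qs"
    using finite_distinct_list[OF finite_class.finite_UNIV] by blast
  have "u = sum_list (map (\<lambda>(k,l,i,j). quad_unit (k, l, i, j, u$k$l$i$j)) qs)"
    by (rule trans[OF quad_sum_units[of u]]) (simp only: sum_list_distinct_conv_sum_set[OF qs(2)] qs(1))
  then show ?thesis by (intro exI conjI) (auto split: prod.splits)
qed

text \<open>
  \<open>f k\<close> stands for the component with multi-index \<open>Jk\<close>, where \<open>J\<close> is fixed, and \<open>\<epsilon> m\<close> is the sign by which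
  the reflection of the \<open>m\<close>-th coordinate acts on the indices in \<open>J\<close>.
\<close>

locale curvature_family =
  fixes f :: "'n::finite \<Rightarrow> 'n quad \<Rightarrow> real" and \<epsilon> :: "'n \<Rightarrow> real"
  assumes quad_sym_cong: "quad_sym u = quad_sym v \<Longrightarrow> f k u = f k v"
    and pair_swap: "f k' (u + quad_unit (k, l, i, j, c)) = f k' (u + quad_unit (i, j, k, l, c))"
    and contraction: "transpose h = h \<Longrightarrow>
      (\<Sum>k\<in>UNIV. \<xi>$k * f k (u + quad_square \<xi> h)) = (\<Sum>k\<in>UNIV. \<xi>$k * f k u)"
    and skew: "f k u = 0 \<or> \<epsilon> k = 1"
    and reflection: "f k (quad_flip m u) = \<epsilon> m * flip_sign m k * f k u"
    and cont: "continuous_on UNIV (f k)"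
begin

section \<open>Polynomiality: vanishing of differences of high order\<close>

lemma quad_sym_add: "quad_sym (u + v) = quad_sym u + quad_sym v"
  by (rule quad_eqI) (simp add: quad_sym_def add_divide_distrib)

lemma shift_cong:
  assumes "quad_sym u = quad_sym v"
  shows "f k (x + u) = f k (x + v)"
  by (rule quad_sym_cong) (simp add: quad_sym_add assms)

text \<open>The combination of the \<open>f k\<close> with weights \<open>\<xi>\<close> does not
  feel the shift by \<open>quad_square \<xi> h\<close>, and differencing commutes with fixed linear
  combinations.\<close>

lemma contraction_diff:
  assumes "transpose h = h"
  shows "(\<Sum>k\<in>UNIV. \<xi>$k * iter_diff (quad_square \<xi> h # us) (f k) x) = 0"
proof -
  have "(\<Sum>k\<in>UNIV. \<xi>$k * iter_diff (quad_square \<xi> h # us) (f k) x)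
      = iter_diff (quad_square \<xi> h # us) (\<lambda>x. \<Sum>k\<in>UNIV. \<xi>$k * f k x) x"
    by (simp add: iter_diff_sum)
  also have "\<dots> = iter_diff us (\<lambda>x. 0) x"
    by (simp only: iter_diff_Cons_inner contraction[OF assms] diff_self)
  finally show ?thesis by simp
qed

lemma contraction_diff_axis:
  assumes "transpose h = h"
  shows "iter_diff (quad_square (axis k 1) h # us) (f k) x = 0"
proof -
  have "(\<Sum>k'\<in>UNIV. axis k 1 $ k' * iter_diff (quad_square (axis k 1) h # us) (f k') x)
      = iter_diff (quad_square (axis k 1) h # us) (f k) x"
    by (simp add: axis_def if_distrib[of "\<lambda>x. x * _"] cong: if_cong)
  then show ?thesis using contraction_diff[OF assms, of "axis k 1" us x] by simp
qed

text \<open>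
  Perturbing \<open>\<xi>\<close> to a basis \<open>\<xi> + t e\<^sub>i\<close>, the contraction with every basis vector vanishes; then let
  \<open>t\<close> tend to 0.
\<close>

lemma nilpotent_direction:
  fixes \<xi> :: "real^'n"
  assumes pos: "(\<Sum>i\<in>UNIV. \<xi>$i) \<ge> 0" and h: "\<And>h. h \<in> set hs \<Longrightarrow> transpose h = h"
    and len: "length hs = CARD('n)"
  shows "iter_diff (map (quad_square \<xi>) hs) (f k) x = 0"
proof -
  obtain ixs :: "'n list" where ixs': "set ixs = UNIV" "distinct ixs"
    using finite_distinct_list[OF finite_class.finite_UNIV] by blast
  then have len': "length ixs = length hs"
    using distinct_card[OF ixs'(2)] len by simp
  \<comment> \<open>Pairs the matrices in \<open>hs\<close> with the coordinates, equally many, so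
    that each matrix gets its own perturbed direction.\<close>
  define H where "H i = hs ! (THE m. m < length ixs \<and> ixs ! m = i)" for i
  have H: "H (ixs ! m) = hs ! m" if "m < length ixs" for m
  proof -
    have "(THE m'. m' < length ixs \<and> ixs ! m' = ixs ! m) = m"
      using that ixs'(2) by (intro the_equality) (auto simp: nth_eq_iff_index_eq)
    then show ?thesis by (simp add: H_def)
  qed
  have mapH: "map H ixs = hs"
    by (rule nth_equalityI) (auto simp: H len')
  have symH: "transpose (H i) = H i" for i
  proof -
    have "H i \<in> set (map H ixs)" using ixs' by simp
    then show ?thesis using h mapH by simp
  qed
  define U where "U i t = quad_square (\<xi> + t *\<^sub>R axis i 1) (H i)" for i and t :: real
  have U0: "map (\<lambda>i. U i 0) ixs = map (quad_square \<xi>) hs"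
    by (simp add: U_def mapH[symmetric])
  have zero: "iter_diff (map (\<lambda>i. U i t) ixs) (f k) x = 0" if t: "t > 0" for t
  proof -
    define X where "X k = iter_diff (map (\<lambda>i. U i t) ixs) (f k) x" for k
    define s where "s = (\<Sum>i\<in>UNIV. \<xi>$i * X i)"
    have eq: "s + t * X i = 0" for i
    proof -
      have ms: "mset ixs = mset (i # remove1 i ixs)"
        using ixs' by simp
      have perm: "mset (map (\<lambda>i. U i t) ixs) = mset (U i t # map (\<lambda>i. U i t) (remove1 i ixs))"
        by (simp only: mset_map ms mset.simps image_mset_add_mset list.map)
      have "X k' = iter_diff (U i t # map (\<lambda>i. U i t) (remove1 i ixs)) (f k') x" for k'
        unfolding X_def by (rule fun_cong[OF iter_diff_perm[OF perm]])
      then have "(\<Sum>k'\<in>UNIV. (\<xi> + t *\<^sub>R axis i 1)$k' * X k') = 0"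
        using contraction_diff[OF symH, of "\<xi> + t *\<^sub>R axis i 1" i] by (simp only: U_def)
      then show ?thesis
        by (simp add: s_def algebra_simps sum.distrib axis_def if_distrib[of "\<lambda>x. _ * x"] cong: if_cong)
    qed
    \<comment> \<open>The equations \<open>s + t * X i = 0\<close> form a rank-one perturbation of t
      times the identity. Weighting them by the coordinates of \<open>\<xi>\<close> yields a
      multiple of \<open>s\<close> whose factor is positive by \<open>pos\<close>.\<close>
    have "(\<Sum>i\<in>UNIV. \<xi>$i * s) + (\<Sum>i\<in>UNIV. t * (\<xi>$i * X i)) = (\<Sum>i\<in>UNIV. \<xi>$i * (s + t * X i))"
      by (simp add: distrib_left sum.distrib mult.left_commute)
    also have "\<dots> = 0" by (simp add: eq)
    finally have "(\<Sum>i\<in>UNIV. \<xi>$i) * s + t * s = 0"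
      by (simp add: sum_distrib_right[symmetric] sum_distrib_left[symmetric] s_def[symmetric])
    then have "(t + (\<Sum>i\<in>UNIV. \<xi>$i)) * s = 0" by (simp add: algebra_simps)
    then have "s = 0" using t pos by simp
    then show ?thesis using eq[of k] t by (simp add: X_def)
  qed
  have contU: "continuous_on UNIV (U i)" for i
    unfolding U_def quad_prod_def by (intro continuous_intros)
  have "continuous_on UNIV (\<lambda>t. iter_diff (map (\<lambda>i. U i t) ixs) (f k) x)"
    by (rule continuous_iter_diff[OF cont contU]) simp
  then have "((\<lambda>t. iter_diff (map (\<lambda>i. U i t) ixs) (f k) x) \<longlongrightarrow>
      iter_diff (map (\<lambda>i. U i 0) ixs) (f k) x) (at_right 0)"
    by (auto simp: continuous_on_def intro: filterlim_mono at_le)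
  moreover have "((\<lambda>t. iter_diff (map (\<lambda>i. U i t) ixs) (f k) x) \<longlongrightarrow> 0) (at_right 0)"
    by (rule tendsto_eventually) (simp add: zero eventually_at_right_less[THEN eventually_mono])
  ultimately show ?thesis
    using tendsto_unique[OF trivial_limit_at_right_real] U0 by metis
qed

text \<open>By polarisation the squares of these vectors span the symmetric 2-tensors. There are
  finitely many, as the pigeonhole argument needs, and their coordinates have nonnegative sum, as
  \<open>nilpotent_direction\<close> needs.\<close>

definition directions :: "(real^'n) set" where
  "directions = range (\<lambda>k. axis k 1) \<union> range (\<lambda>(k, l). axis k 1 + axis l 1)"

definition sym_squares :: "'n quad set" where
  "sym_squares = {quad_square \<xi> h | \<xi> h. \<xi> \<in> directions \<and> transpose h = h}"

lemma sum_directions: "\<xi> \<in> directions \<Longrightarrow> (\<Sum>i\<in>UNIV. \<xi>$i) \<ge> 0"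
  by (auto simp: directions_def intro!: sum_nonneg simp: axis_def)

lemma quad_unit_squares:
  "\<exists>ws. set ws \<subseteq> sym_squares \<and> quad_sym (sum_list ws) = quad_sym (quad_unit e)"
proof -
  obtain k l i j c where e: "e = (k, l, i, j, c)" by (cases e)
  have sq: "quad_square \<xi> (sym_unit i j c) \<in> sym_squares" if "\<xi> \<in> directions" for \<xi> c
    unfolding sym_squares_def using that transpose_sym_unit by blast
  have dir: "axis k 1 \<in> directions" "axis l 1 \<in> directions" "axis k 1 + axis l 1 \<in> directions"
    by (auto simp: directions_def)
  \<comment> \<open>Polarisation. The coefficient is \<open>c / 2\<close> because symmetrising the
    product of two axis vectors halves it; minus signs go into the matrix factor, as only sums of
    generators are available.\<close>
  define ws where "ws = [quad_square (axis k 1 + axis l 1) (sym_unit i j (c / 2)),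
    quad_square (axis k 1) (sym_unit i j (- c / 2)), quad_square (axis l 1) (sym_unit i j (- c / 2))]"
  have "set ws \<subseteq> sym_squares"
    using sq dir by (simp add: ws_def)
  moreover have "quad_sym (sum_list ws) = quad_sym (quad_unit e)"
    unfolding e quad_unit_sym ws_def
    by (rule quad_eqI) (simp add: quad_sym_def quad_prod_def sym_unit_def field_simps)
  ultimately show ?thesis by blast
qed

lemma length_sum_filter:
  assumes "finite K" "\<And>u. u \<in> set us \<Longrightarrow> c u \<in> K"
  shows "length us = (\<Sum>\<xi>\<in>K. length (filter (\<lambda>u. c u = \<xi>) us))"
  using assms(2)
proof (induction us)
  case (Cons u us)
  have "(\<Sum>\<xi>\<in>K. length (filter (\<lambda>u. c u = \<xi>) (u # us)))
      = (\<Sum>\<xi>\<in>K. (if \<xi> = c u then 1 else 0) + length (filter (\<lambda>u. c u = \<xi>) us))"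
    by (rule sum.cong) auto
  then show ?case using Cons assms(1) by (simp add: sum.distrib)
qed simp

text \<open>Pigeonhole: among \<open>card directions * CARD('n)\<close> generators at least
  \<open>CARD('n)\<close> share a direction, and \<open>nilpotent_direction\<close> kills the
  difference along these. This is polynomiality of \<open>f k\<close> in the form of vanishing
  differences.\<close>

lemma nilpotent:
  "\<exists>M. \<forall>us k x. length us = M \<longrightarrow> iter_diff us (f k) x = 0"
proof -
  define M where "M = card directions * CARD('n)"
  have fin: "finite directions" by (simp add: directions_def)
  have zero: "iter_diff us (f k) x = 0" if us: "set us \<subseteq> sym_squares" "length us = M" for us k x
  proof -
    \<comment> \<open>One direction is chosen for each generator, which may have several: an axis
      vector and its double give the same squares up to a factor in \<open>h\<close>.\<close>
    have "\<forall>u. \<exists>\<xi>. u \<in> sym_squares \<longrightarrow> \<xi> \<in> directions \<and> (\<exists>h. u = quad_square \<xi> h \<and> transpose h = h)"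
      by (auto simp: sym_squares_def)
    then obtain cls where cls: "\<And>u. u \<in> sym_squares \<Longrightarrow>
        cls u \<in> directions \<and> (\<exists>h. u = quad_square (cls u) h \<and> transpose h = h)"
      by metis
    have "\<exists>\<xi>\<in>directions. length (filter (\<lambda>u. cls u = \<xi>) us) \<ge> CARD('n)"
    proof (rule ccontr)
      assume "\<not> ?thesis"
      then have less: "\<And>\<xi>. \<xi> \<in> directions \<Longrightarrow> length (filter (\<lambda>u. cls u = \<xi>) us) < CARD('n)"
        by force
      have ne: "directions \<noteq> {}" by (auto simp: directions_def)
      have "length us = (\<Sum>\<xi>\<in>directions. length (filter (\<lambda>u. cls u = \<xi>) us))"
        by (rule length_sum_filter[OF fin]) (use cls us(1) in auto)
      also have "\<dots> < (\<Sum>\<xi>\<in>directions. CARD('n))"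
        by (rule sum_strict_mono[OF fin ne less])
      finally show False using us(2) by (simp add: M_def)
    qed
    then obtain \<xi> where xi: "\<xi> \<in> directions" "length (filter (\<lambda>u. cls u = \<xi>) us) \<ge> CARD('n)"
      by blast
    define vs where "vs = take CARD('n) (filter (\<lambda>u. cls u = \<xi>) us)"
    have sub: "mset vs \<subseteq># mset us"
    proof -
      have "mset vs \<subseteq># mset (filter (\<lambda>u. cls u = \<xi>) us)"
        unfolding vs_def by (metis append_take_drop_id mset_append mset_subset_eq_add_left)
      then show ?thesis
        by (metis mset_filter multiset_filter_subset subset_mset.order_trans)
    qed
    have vs: "length vs = CARD('n)" using xi by (simp add: vs_def)
    have mem: "\<exists>h. u = quad_square \<xi> h \<and> transpose h = h" if "u \<in> set vs" for u
    proof -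
      have "u \<in> set (filter (\<lambda>u. cls u = \<xi>) us)"
        using that unfolding vs_def by (rule in_set_takeD)
      then have "u \<in> sym_squares" "cls u = \<xi>" using us(1) by auto
      then show ?thesis using cls by blast
    qed
    then obtain h where h: "\<And>u. u \<in> set vs \<Longrightarrow> u = quad_square \<xi> (h u) \<and> transpose (h u) = h u"
      by metis
    have map: "map (quad_square \<xi>) (map h vs) = vs"
      using h by (auto intro!: map_idI simp: o_def)
    have "iter_diff vs (f k) x = 0" for x
      using nilpotent_direction[OF sum_directions[OF xi(1)], of "map h vs" k x] h vs map by auto
    then show ?thesis by (rule iter_diff_zero_mono[OF sub])
  qed
  have gen: "\<exists>ws. set ws \<subseteq> sym_squares \<and> (\<forall>x. f k (x + u) = f k (x + sum_list ws))" for k u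
  proof -
    have "\<exists>vs. set vs \<subseteq> sym_squares \<and> quad_sym (sum_list vs) = quad_sym (sum_list ws)"
      if "set ws \<subseteq> range quad_unit" for ws
      using that
    proof (induction ws)
      case Nil
      show ?case by (rule exI[of _ "[]"]) simp
    next
      case (Cons w ws)
      then obtain vs vs' where "set vs \<subseteq> sym_squares" "quad_sym (sum_list vs) = quad_sym (sum_list ws)"
        "set vs' \<subseteq> sym_squares" "quad_sym (sum_list vs') = quad_sym w"
        using quad_unit_squares by (metis (no_types, lifting) image_iff insert_subset list.simps(15))
      then show ?case
        by (intro exI[of _ "vs' @ vs"]) (simp add: quad_sym_add)
    qed
    then show ?thesis using quad_sum_unit_list[of u] shift_cong by metis
  qed
  have "iter_diff us (f k) x = 0" if "length us = M" for us k x
    by (rule iter_diff_zero_gen[OF gen zero that])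
  then show ?thesis by blast
qed

section \<open>Descent on the degree\<close>

context
  fixes m :: nat
  assumes next_zero: "\<And>us k x. length us = Suc m \<Longrightarrow> iter_diff us (f k) x = 0"
begin

text \<open>Once all differences of order m + 1 vanish, those of order m forget the base point and
  hence are additive in each argument: they are the polarisation of the top-degree part.\<close>

lemma iter_diff_const:
  assumes "length us = m"
  shows "iter_diff us (f k) x = iter_diff us (f k) y"
proof -
  have "iter_diff ((x - y) # us) (f k) y = 0" using assms by (intro next_zero) simp
  then show ?thesis by (simp add: iter_diff_Cons)
qed

lemma iter_diff_add:
  assumes "Suc (length us) = m"
  shows "iter_diff ((a + b) # us) (f k) x = iter_diff (a # us) (f k) x + iter_diff (b # us) (f k) x"
  using iter_diff_const[of "b # us" k x "x + a"] assms by (simp add: iter_diff_add_arg)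

lemma iter_diff_minus:
  assumes "Suc (length us) = m"
  shows "iter_diff ((- a) # us) (f k) x = - iter_diff (a # us) (f k) x"
  using iter_diff_add[OF assms, of a "- a" k x] by (simp add: iter_diff_Cons)

text \<open>Additivity gives scaling by signs, which is what reflections require; \<open>vs\<close>
  collects the arguments already treated.\<close>

lemma iter_diff_sign:
  assumes "\<And>e. e \<in> set es \<Longrightarrow> \<sigma> e = 1 \<or> \<sigma> e = - 1" "length es + length vs = m"
  shows "iter_diff (map (\<lambda>e. \<sigma> e *\<^sub>R U e) es @ vs) (f k) x
       = (\<Prod>e\<leftarrow>es. \<sigma> e) * iter_diff (map U es @ vs) (f k) x"
  using assms
proof (induction es arbitrary: vs)
  case (Cons e es)
  have "iter_diff (map (\<lambda>e. \<sigma> e *\<^sub>R U e) (e # es) @ vs) (f k) x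
      = \<sigma> e * iter_diff (U e # (map (\<lambda>e. \<sigma> e *\<^sub>R U e) es @ vs)) (f k) x"
    using Cons.prems(1)[of e] Cons.prems(2) by (auto simp: iter_diff_minus)
  also have "iter_diff (U e # (map (\<lambda>e. \<sigma> e *\<^sub>R U e) es @ vs)) (f k) x
      = iter_diff (map (\<lambda>e. \<sigma> e *\<^sub>R U e) es @ (U e # vs)) (f k) x"
    by (rule fun_cong[OF iter_diff_perm]) simp
  also have "\<dots> = (\<Prod>e\<leftarrow>es. \<sigma> e) * iter_diff (map U es @ (U e # vs)) (f k) x"
    using Cons by simp
  also have "iter_diff (map U es @ (U e # vs)) (f k) x = iter_diff (map U (e # es) @ vs) (f k) x"
    by (rule fun_cong[OF iter_diff_perm]) simp
  finally show ?case by simp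
qed simp

definition sign_of :: "'n \<Rightarrow> 'n \<times> 'n \<times> 'n \<times> 'n \<times> real \<Rightarrow> real" where
  "sign_of a e = (case e of (k, l, i, j, c) \<Rightarrow>
     flip_sign a k * flip_sign a l * flip_sign a i * flip_sign a j)"

lemma flip_unit: "quad_flip a (quad_unit e) = sign_of a e *\<^sub>R quad_unit e"
  by (rule quad_eqI) (auto simp: quad_flip_def quad_unit_def sign_of_def split: prod.split)

lemma sign_of_cases: "sign_of a e = 1 \<or> sign_of a e = - 1"
  by (auto simp: sign_of_def flip_sign_def split: prod.split)

lemma iter_diff_flip:
  "iter_diff (map (quad_flip a) us) (f k) (quad_flip a x) = \<epsilon> a * flip_sign a k * iter_diff us (f k) x"
proof (induction us arbitrary: x)
  case Nil
  then show ?case by (simp add: reflection)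
next
  case (Cons u us)
  have "quad_flip a x + quad_flip a u = quad_flip a (x + u)"
    by (rule quad_eqI) (simp add: quad_flip_def algebra_simps)
  then show ?case by (simp add: iter_diff_Cons Cons.IH algebra_simps)
qed

text \<open>A nonzero component has \<open>\<epsilon> k = 1\<close> by \<open>skew\<close>, so
  reflecting the k-th coordinate changes the sign of \<open>f k\<close>, while it multiplies the
  arguments by their \<open>sign_of k\<close>. Hence \<open>k\<close> occurs an odd number of times
  in the arguments.\<close>

lemma parity:
  assumes "length es = m" "iter_diff (map quad_unit es) (f k) x \<noteq> 0"
  shows "(\<Prod>e\<leftarrow>es. sign_of k e) = - 1"
proof -
  have "\<epsilon> k = 1"
  proof (rule ccontr)
    assume "\<epsilon> k \<noteq> 1"
    then have "f k = (\<lambda>u. 0)" using skew by blast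
    then show False using assms(2) by simp
  qed
  then have "iter_diff (map (quad_flip k) (map quad_unit es)) (f k) (quad_flip k x)
      = - iter_diff (map quad_unit es) (f k) x"
    unfolding iter_diff_flip by (simp add: flip_sign_def)
  moreover have "map (quad_flip k) (map quad_unit es) = map (\<lambda>e. sign_of k e *\<^sub>R quad_unit e) es"
    by (simp add: flip_unit)
  moreover have "iter_diff (map (\<lambda>e. sign_of k e *\<^sub>R quad_unit e) es) (f k) (quad_flip k x)
      = (\<Prod>e\<leftarrow>es. sign_of k e) * iter_diff (map quad_unit es) (f k) x"
    using iter_diff_sign[of es "sign_of k" "[]" quad_unit k "quad_flip k x"] sign_of_cases assms(1)
      iter_diff_const[of "map quad_unit es" k x "quad_flip k x"] by simp
  ultimately have "((\<Prod>e\<leftarrow>es. sign_of k e) + 1) * iter_diff (map quad_unit es) (f k) x = 0"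
    by (simp only: distrib_right mult_1 map_map)
  then show ?thesis using assms(2) by simp
qed

lemma iter_diff_unit_prod:
  "iter_diff (quad_unit (k, l, i, j, c) # us) (f k')
    = iter_diff (quad_prod (axis k 1) (axis l 1) (sym_unit i j c) # us) (f k')"
  by (intro iter_diff_Cons_cong shift_cong quad_unit_sym)

lemma iter_diff_kk: "iter_diff (quad_unit (k, k, i, j, c) # us) (f k) x = 0"
  unfolding iter_diff_unit_prod by (rule contraction_diff_axis[OF transpose_sym_unit])

lemma iter_diff_unit_sym:
  "iter_diff (quad_unit (k, l, i, j, c) # us) (f k') = iter_diff (quad_unit (l, k, i, j, c) # us) (f k')"
  by (intro iter_diff_Cons_cong shift_cong, unfold quad_unit_sym, intro quad_eqI)
    (simp add: quad_sym_def quad_prod_def)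

lemma iter_diff_unit_swap:
  "iter_diff (quad_unit (k, l, i, j, c) # us) (f k') = iter_diff (quad_unit (i, j, k, l, c) # us) (f k')"
  by (intro iter_diff_Cons_cong pair_swap)

text \<open>This is the part odd in s of the contraction law for the direction e_k + s e_b with s =
  1 and s = -1: the square (k, k) under \<open>f k\<close> and the square (b, b) under
  \<open>f b\<close> contribute nothing by \<open>iter_diff_kk\<close>. Taking signs for s keeps
  everything within additivity.\<close>

lemma exchange:
  assumes len: "Suc (length us) = m" and "b \<noteq> k"
  shows "2 * iter_diff (quad_unit (k, b, i, j, c) # us) (f k) x
    = - iter_diff (quad_unit (k, k, i, j, c) # us) (f b) x"
proof -
  define P where "P k l = quad_prod (axis k 1) (axis l 1) (sym_unit i j c)" for k l
  define D where "D k u = iter_diff (u # us) (f k) x" for k u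
  have add: "D k (u + v) = D k u + D k v" for k u v
    unfolding D_def by (rule iter_diff_add[OF len])
  have minus: "D k (- u) = - D k u" for k u
    unfolding D_def by (rule iter_diff_minus[OF len])
  have diff: "D k (u - v) = D k u - D k v" for k u v
    using add[of k u "- v"] minus[of k v] by simp
  have comb: "D k (P k k + P b b + s *\<^sub>R P k b + s *\<^sub>R P b k)
      + s * D b (P k k + P b b + s *\<^sub>R P k b + s *\<^sub>R P b k) = 0" if s: "s * s = 1" for s
  proof -
    define \<xi> :: "real^'n" where "\<xi> = axis k 1 + s *\<^sub>R axis b 1"
    have "s * (s * a) = a" for a using s by (simp add: mult.assoc[symmetric])
    then have sq: "quad_square \<xi> (sym_unit i j c) = P k k + P b b + s *\<^sub>R P k b + s *\<^sub>R P b k"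
      by (intro quad_eqI) (simp add: P_def quad_prod_def \<xi>_def algebra_simps)
    have "(\<Sum>k'\<in>UNIV. \<xi>$k' * D k' u) = D k u + s * D b u" for u
    proof -
      have "(\<Sum>k'\<in>UNIV. \<xi>$k' * D k' u)
          = (\<Sum>k'\<in>UNIV. (if k' = k then D k u else 0) + (if k' = b then s * D b u else 0))"
        by (rule sum.cong) (auto simp: \<xi>_def axis_def algebra_simps)
      then show ?thesis by (simp add: sum.distrib)
    qed
    then show ?thesis
      using contraction_diff[OF transpose_sym_unit, of \<xi> i j c us x] unfolding sq D_def by simp
  qed
  have E: "D k' (quad_unit (k, l, i, j, c)) = D k' (P k l)" for k' k l
    unfolding D_def P_def by (simp only: iter_diff_unit_prod)
  have "D k (P k k) = 0" "D b (P b b) = 0"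
    unfolding E[symmetric] unfolding D_def by (rule iter_diff_kk)+
  moreover have "D k' (P b k) = D k' (P k b)" for k'
    unfolding E[symmetric] unfolding D_def by (simp only: iter_diff_unit_sym[of b k])
  ultimately have "2 * D k (P k b) = - D b (P k k)"
    using comb[of 1] comb[of "- 1"] by (simp add: add diff)
  then show ?thesis unfolding E[symmetric] unfolding D_def .
qed

text \<open>Termination measure: at most 2 for each argument, and raised by one in total at each use
  of \<open>exchange\<close>.\<close>

definition squares_in :: "'n \<times> 'n \<times> 'n \<times> 'n \<times> real \<Rightarrow> nat" where
  "squares_in e = (case e of (k, l, i, j, c) \<Rightarrow> of_bool (k = l) + of_bool (i = j))"

text \<open>
  If \<open>k\<close> is the index of a nonzero component then, by reflection, \<open>k\<close> also occurs in a pair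
  \<open>(k, b)\<close> with \<open>b \<noteq> k\<close>, and the exchange lemma turns that pair into \<open>(k, k)\<close>. This cannot go on
  forever.
\<close>

lemma iter_diff_units_zero:
  "length es = m \<Longrightarrow> iter_diff (map quad_unit es) (f k) x = 0"
proof (induction "2 * m - sum_list (map squares_in es)" arbitrary: es k rule: less_induct)
  case less
  show ?case
  proof (rule ccontr)
    assume nz: "iter_diff (map quad_unit es) (f k) x \<noteq> 0"
    have "\<exists>e\<in>set es. sign_of k e \<noteq> 1"
    proof (rule ccontr)
      assume "\<not> ?thesis"
      then have "map (sign_of k) es = map (\<lambda>_. 1) es" by simp
      then have "(\<Prod>e\<leftarrow>es. sign_of k e) = 1"
        by (simp add: map_replicate_const)
      then show False using parity[OF less.prems nz] by simp
    qed
    then obtain e where e: "e \<in> set es" "sign_of k e \<noteq> 1" by blast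
    define es' where "es' = remove1 e es"
    have len: "Suc (length es') = m"
      using e(1) less.prems by (auto simp: es'_def length_remove1 dest: length_pos_if_in_set)
    have perm: "iter_diff (map quad_unit es) (f k) = iter_diff (quad_unit e # map quad_unit es') (f k)"
    proof (rule iter_diff_perm)
      have "mset es = mset (e # es')" using e(1) by (simp add: es'_def)
      then show "mset (map quad_unit es) = mset (quad_unit e # map quad_unit es')"
        unfolding mset_map by simp
    qed
    have squares: "sum_list (map squares_in es) = squares_in e + sum_list (map squares_in es')"
      unfolding es'_def by (rule sum_list_map_remove1[OF e(1)])
    obtain k1 l1 i1 j1 c where e': "e = (k1, l1, i1, j1, c)" by (cases e)
    have "k = k1 \<or> k = l1 \<or> k = i1 \<or> k = j1"
      using e(2) by (auto simp: e' sign_of_def flip_sign_def split: if_splits)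
    \<comment> \<open>The symmetry in the first pair and the exchange of the two pairs bring
      \<open>k\<close> to the first place; neither changes the number of equal pairs.\<close>
    then have "\<exists>b i j. squares_in (k, b, i, j, c) = squares_in e \<and>
      iter_diff (quad_unit e # map quad_unit es') (f k) = iter_diff (quad_unit (k, b, i, j, c) # map quad_unit es') (f k)"
    proof (elim disjE)
      assume k: "k = k1"
      show ?thesis unfolding e' k by (intro exI[of _ l1] exI[of _ i1] exI[of _ j1] conjI refl)
    next
      assume k: "k = l1"
      show ?thesis unfolding e' k
        by (intro exI[of _ k1] exI[of _ i1] exI[of _ j1] conjI iter_diff_unit_sym)
          (auto simp: squares_in_def)
    next
      assume k: "k = i1"
      show ?thesis unfolding e' k
        by (intro exI[of _ j1] exI[of _ k1] exI[of _ l1] conjI iter_diff_unit_swap)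
          (simp add: squares_in_def)
    next
      assume k: "k = j1"
      show ?thesis unfolding e' k
        by (intro exI[of _ i1] exI[of _ k1] exI[of _ l1] conjI
            trans[OF iter_diff_unit_swap iter_diff_unit_sym])
          (auto simp: squares_in_def)
    qed
    then obtain b i j where b: "squares_in (k, b, i, j, c) = squares_in e"
      "iter_diff (quad_unit (k, b, i, j, c) # map quad_unit es') (f k) x \<noteq> 0"
      using nz perm by metis
    have "b \<noteq> k" using b(2) iter_diff_kk by metis
    \<comment> \<open>The exchange moves the component index from \<open>k\<close> to
      \<open>b\<close>, so the induction has to range over \<open>k\<close> as well.\<close>
    then have "iter_diff (map quad_unit ((k, k, i, j, c) # es')) (f b) x \<noteq> 0"
      using exchange[of "map quad_unit es'" b k i j c x] b(2) len by simp
    moreover have "sum_list (map squares_in ((k, k, i, j, c) # es')) = Suc (sum_list (map squares_in es))"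
      using \<open>b \<noteq> k\<close> b(1) squares by (simp add: squares_in_def)
    moreover have "sum_list (map squares_in vs) \<le> 2 * length vs" for vs
      by (induction vs) (auto simp: squares_in_def split: prod.split)
    from this[of "(k, k, i, j, c) # es'"] have
      "sum_list (map squares_in ((k, k, i, j, c) # es')) \<le> 2 * m"
      using len by simp
    ultimately have nz': "iter_diff (map quad_unit ((k, k, i, j, c) # es')) (f b) x \<noteq> 0"
      and lt: "2 * m - sum_list (map squares_in ((k, k, i, j, c) # es'))
        < 2 * m - sum_list (map squares_in es)"
      by linarith+
    have "length ((k, k, i, j, c) # es') = m" using len by simp
    then show False using less.hyps[OF lt] nz' by blast
  qed
qed

lemma prev_zero:
  assumes "length us = m"
  shows "iter_diff us (f k) x = 0"
proof -
  have gen: "\<exists>ws. set ws \<subseteq> range quad_unit \<and> (\<forall>x. f k (x + u) = f k (x + sum_list ws))" for u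
  proof -
    obtain ws where "set ws \<subseteq> range quad_unit" "u = sum_list ws"
      using quad_sum_unit_list by blast
    then show ?thesis by blast
  qed
  have zero: "iter_diff us (f k) x = 0" if us: "set us \<subseteq> range quad_unit" "length us = m" for us x
  proof -
    have "\<forall>u\<in>set us. \<exists>e. u = quad_unit e" using us(1) by blast
    then obtain es where "us = map quad_unit es" using iffD2[OF ex_map_conv] by blast
    then show ?thesis using iter_diff_units_zero us(2) by simp
  qed
  show ?thesis by (rule iter_diff_zero_gen[OF gen zero assms])
qed

end

theorem vanishes: "f k u = 0"
proof -
  obtain M where M: "\<And>us k x. length us = M \<Longrightarrow> iter_diff us (f k) x = 0"
    using nilpotent by blast
  \<comment> \<open>Subtraction is truncated: once \<open>M - d\<close> is 0 the claim no longer
    changes, and for \<open>d = M\<close> the only list is empty, whose difference is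
    \<open>f k\<close> itself.\<close>
  have "\<forall>us k x. length us = M - d \<longrightarrow> iter_diff us (f k) x = 0" for d
  proof (induction d)
    case (Suc d)
    show ?case
    proof (cases "M - d")
      case 0
      then show ?thesis using Suc by simp
    next
      case (Suc m)
      then have "M - Suc d = m" by simp
      then show ?thesis using prev_zero[of m] Suc Suc.IH by metis
    qed
  qed (simp add: M)
  from this[of M, rule_format, of "[]"] show ?thesis by simp
qed

end


section \<open>Calculus of smooth functions\<close>

lemma
  assumes "open S" "x \<in> S" "\<And>y. y \<in> S \<Longrightarrow> f y = g y"
  shows frechet_derivative_cong: "frechet_derivative f (at x) = frechet_derivative g (at x)"
    and differentiable_cong_open: "f differentiable (at x) \<longleftrightarrow> g differentiable (at x)"
proof -
  have "(f has_derivative D) (at x) \<longleftrightarrow> (g has_derivative D) (at x)" for D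
    using assms has_derivative_transform_within_open[of f D x UNIV S g]
      has_derivative_transform_within_open[of g D x UNIV S f] by auto
  then show "frechet_derivative f (at x) = frechet_derivative g (at x)"
    "f differentiable (at x) \<longleftrightarrow> g differentiable (at x)"
    by (simp_all add: frechet_derivative_def differentiable_def)
qed

lemma ck_on_cong:
  assumes "open S" "\<And>y. y \<in> S \<Longrightarrow> f y = g y"
  shows "ck_on k S f \<longleftrightarrow> ck_on k S g"
  using assms(2)
proof (induction k arbitrary: f g)
  case 0
  then show ?case by (auto intro: continuous_on_cong)
next
  case (Suc k)
  have "ck_on k S (\<lambda>x. frechet_derivative f (at x) v) \<longleftrightarrow> ck_on k S (\<lambda>x. frechet_derivative g (at x) v)" for v
    by (rule Suc.IH) (use frechet_derivative_cong[OF assms(1) _ Suc.prems] in simp)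
  then show ?case
    using differentiable_cong_open[OF assms(1) _ Suc.prems] by auto
qed

lemma ck_on_subset: "ck_on k S f \<Longrightarrow> T \<subseteq> S \<Longrightarrow> ck_on k T f"
  by (induction k arbitrary: f) (auto intro: continuous_on_subset)

lemma ck_on_lower: "ck_on (Suc k) S f \<Longrightarrow> ck_on k S f"
proof (induction k arbitrary: f)
  case 0
  then show ?case
    by (auto intro!: continuous_at_imp_continuous_on differentiable_imp_continuous_within)
next
  case (Suc k)
  have "ck_on (Suc k) S (\<lambda>x. frechet_derivative f (at x) v)" for v
    using Suc.prems unfolding ck_on.simps(2)[of "Suc k"] by blast
  moreover have "\<forall>x\<in>S. f differentiable (at x)"
    using Suc.prems unfolding ck_on.simps(2)[of "Suc k"] by blast
  ultimately show ?case using Suc.IH by simp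
qed

lemma ck_on_SucI:
  assumes "open S" "\<And>x. x \<in> S \<Longrightarrow> (f has_derivative D x) (at x)" "\<And>v. ck_on k S (\<lambda>x. D x v)"
  shows "ck_on (Suc k) S f"
proof -
  have eq: "frechet_derivative f (at x) = D x" if "x \<in> S" for x
    using frechet_derivative_at[OF assms(2)[OF that]] by simp
  have "ck_on k S (\<lambda>x. frechet_derivative f (at x) v) \<longleftrightarrow> ck_on k S (\<lambda>x. D x v)" for v
    by (rule ck_on_cong[OF assms(1)]) (simp add: eq)
  then show ?thesis using assms by (auto simp: differentiable_def)
qed

lemma ck_on_has_derivative:
  "ck_on (Suc k) S f \<Longrightarrow> x \<in> S \<Longrightarrow> (f has_derivative frechet_derivative f (at x)) (at x)"
  by (simp add: frechet_derivative_works)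

lemma ck_on_const: "open S \<Longrightarrow> ck_on k S (\<lambda>x. c)"
  by (induction k arbitrary: c) (auto intro!: ck_on_SucI[where D = "\<lambda>x v. 0"])

lemma ck_on_linear:
  assumes "open S" "bounded_linear L"
  shows "ck_on k S L"
proof (cases k)
  case 0
  then show ?thesis using assms linear_continuous_on by auto
next
  case (Suc k')
  then show ?thesis
    using assms by (auto simp del: ck_on.simps intro!: ck_on_SucI[where D = "\<lambda>x. L"]
        bounded_linear.has_derivative[OF assms(2)] ck_on_const derivative_eq_intros)
qed

lemma ck_on_compose_linear:
  assumes "open S" "bounded_linear L" "ck_on k S f"
  shows "ck_on k S (\<lambda>x. L (f x))"
  using assms(3)
proof (induction k arbitrary: f)
  case 0
  then show ?case
    using bounded_linear.continuous_on[OF assms(2)] by simp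
next
  case (Suc k)
  show ?case
  proof (rule ck_on_SucI[OF assms(1)])
    show "((\<lambda>x. L (f x)) has_derivative (\<lambda>v. L (frechet_derivative f (at x) v))) (at x)" if "x \<in> S" for x
      by (rule bounded_linear.has_derivative[OF assms(2) ck_on_has_derivative[OF Suc.prems that]])
    show "ck_on k S (\<lambda>x. L (frechet_derivative f (at x) v))" for v
      by (rule Suc.IH) (use Suc.prems in simp)
  qed
qed

lemma ck_on_add:
  assumes "open S" "ck_on k S f" "ck_on k S g"
  shows "ck_on k S (\<lambda>x. f x + g x)"
  using assms(2,3)
proof (induction k arbitrary: f g)
  case 0
  then show ?case by (simp add: continuous_on_add)
next
  case (Suc k)
  show ?case
  proof (rule ck_on_SucI[OF assms(1)])
    show "((\<lambda>x. f x + g x) has_derivative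
        (\<lambda>v. frechet_derivative f (at x) v + frechet_derivative g (at x) v)) (at x)" if "x \<in> S" for x
      by (intro has_derivative_add ck_on_has_derivative[OF Suc.prems(1) that]
          ck_on_has_derivative[OF Suc.prems(2) that])
    show "ck_on k S (\<lambda>x. frechet_derivative f (at x) v + frechet_derivative g (at x) v)" for v
      by (rule Suc.IH) (use Suc.prems in simp_all)
  qed
qed

lemma ck_on_sum:
  assumes "open S" "\<And>i. i \<in> I \<Longrightarrow> ck_on k S (f i)"
  shows "ck_on k S (\<lambda>x. \<Sum>i\<in>I. f i x)"
  using assms(2)
  by (induction I rule: infinite_finite_induct) (auto intro: ck_on_const ck_on_add assms(1))

lemma ck_on_bilinear:
  assumes "open S" "bounded_bilinear B" "ck_on k S f" "ck_on k S g"
  shows "ck_on k S (\<lambda>x. B (f x) (g x))"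
  using assms(3,4)
proof (induction k arbitrary: f g)
  case 0
  then show ?case by (simp add: bounded_bilinear.continuous_on[OF assms(2)])
next
  case (Suc k)
  show ?case
  proof (rule ck_on_SucI[OF assms(1)])
    show "((\<lambda>x. B (f x) (g x)) has_derivative
        (\<lambda>v. B (f x) (frechet_derivative g (at x) v) + B (frechet_derivative f (at x) v) (g x))) (at x)"
      if "x \<in> S" for x
      by (rule bounded_bilinear.FDERIV[OF assms(2) ck_on_has_derivative[OF Suc.prems(1) that]
          ck_on_has_derivative[OF Suc.prems(2) that]])
    show "ck_on k S (\<lambda>x. B (f x) (frechet_derivative g (at x) v) + B (frechet_derivative f (at x) v) (g x))" for v
      using Suc.prems ck_on_lower[OF Suc.prems(1)] ck_on_lower[OF Suc.prems(2)]
      by (intro ck_on_add[OF assms(1)] Suc.IH) auto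
  qed
qed

lemma has_derivative_euclidean_sum:
  fixes D :: "'a::euclidean_space \<Rightarrow> 'b::real_normed_vector"
  assumes "linear D"
  shows "D v = (\<Sum>b\<in>Basis. (v \<bullet> b) *\<^sub>R D b)"
proof -
  have "D v = D (\<Sum>b\<in>Basis. (v \<bullet> b) *\<^sub>R b)" by (simp add: euclidean_representation)
  then show ?thesis by (simp only: linear_sum[OF assms] linear_scale[OF assms])
qed

lemma ck_on_compose:
  fixes f :: "'a::euclidean_space \<Rightarrow> 'b::euclidean_space" and g :: "'b \<Rightarrow> 'c::real_normed_vector"
  assumes "open S" "ck_on k S f" "ck_on k T g" "f ` S \<subseteq> T"
  shows "ck_on k S (\<lambda>x. g (f x))"
  using assms(2,3)
proof (induction k arbitrary: g)
  case 0
  then show ?case using continuous_on_compose2[OF _ _ assms(4)] by auto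
next
  case (Suc k)
  show ?case
  proof (rule ck_on_SucI[OF assms(1)])
    fix x assume x: "x \<in> S"
    have g': "(g has_derivative frechet_derivative g (at (f x))) (at (f x))"
      by (rule ck_on_has_derivative[OF Suc.prems(2)]) (use x assms(4) in auto)
    have "((\<lambda>x. g (f x)) has_derivative (\<lambda>v. frechet_derivative g (at (f x)) (frechet_derivative f (at x) v))) (at x)"
      by (rule has_derivative_compose[OF ck_on_has_derivative[OF Suc.prems(1) x] g'])
    \<comment> \<open>\<open>ck_on\<close> speaks of derivatives in fixed directions, whereas here
      the direction moves with \<open>x\<close>; expanding it in the basis leaves products of
      functions that are \<open>ck_on k\<close>.\<close>
    also have "(\<lambda>v. frechet_derivative g (at (f x)) (frechet_derivative f (at x) v))
        = (\<lambda>v. \<Sum>b\<in>Basis. (frechet_derivative f (at x) v \<bullet> b) *\<^sub>R frechet_derivative g (at (f x)) b)"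
      by (rule ext) (rule has_derivative_euclidean_sum[OF has_derivative_linear[OF g']])
    finally show "((\<lambda>x. g (f x)) has_derivative
      (\<lambda>v. \<Sum>b\<in>Basis. (frechet_derivative f (at x) v \<bullet> b) *\<^sub>R frechet_derivative g (at (f x)) b)) (at x)" .
  next
    fix v
    have "ck_on k S (\<lambda>x. frechet_derivative g (at (f x)) b)" for b
      using Suc.IH[OF ck_on_lower[OF Suc.prems(1)], of "\<lambda>y. frechet_derivative g (at y) b"] Suc.prems(2)
      by simp
    moreover have "ck_on k S (\<lambda>x. frechet_derivative f (at x) v \<bullet> b)" for b
      by (rule ck_on_compose_linear[OF assms(1) bounded_linear_inner_left]) (use Suc.prems in simp)
    ultimately show "ck_on k S (\<lambda>x. \<Sum>b\<in>Basis. (frechet_derivative f (at x) v \<bullet> b) *\<^sub>R frechet_derivative g (at (f x)) b)"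
      by (intro ck_on_sum[OF assms(1)] ck_on_bilinear[OF assms(1) bounded_bilinear_scaleR])
  qed
qed

lemma smooth_on_cong: "open S \<Longrightarrow> (\<And>y. y \<in> S \<Longrightarrow> f y = g y) \<Longrightarrow> smooth_on S f \<longleftrightarrow> smooth_on S g"
  unfolding smooth_on_def using ck_on_cong by blast

lemma smooth_on_subset: "smooth_on S f \<Longrightarrow> T \<subseteq> S \<Longrightarrow> smooth_on T f"
  unfolding smooth_on_def using ck_on_subset by blast

lemma smooth_on_const: "open S \<Longrightarrow> smooth_on S (\<lambda>x. c)"
  by (simp add: smooth_on_def ck_on_const)

lemma smooth_on_linear: "open S \<Longrightarrow> bounded_linear L \<Longrightarrow> smooth_on S L"
  by (simp add: smooth_on_def ck_on_linear)

lemma smooth_on_compose_linear: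
  "open S \<Longrightarrow> bounded_linear L \<Longrightarrow> smooth_on S f \<Longrightarrow> smooth_on S (\<lambda>x. L (f x))"
  by (simp add: smooth_on_def ck_on_compose_linear)

lemma smooth_on_add: "open S \<Longrightarrow> smooth_on S f \<Longrightarrow> smooth_on S g \<Longrightarrow> smooth_on S (\<lambda>x. f x + g x)"
  by (simp add: smooth_on_def ck_on_add)

lemma smooth_on_sum: "open S \<Longrightarrow> (\<And>i. i \<in> I \<Longrightarrow> smooth_on S (f i)) \<Longrightarrow> smooth_on S (\<lambda>x. \<Sum>i\<in>I. f i x)"
  by (simp add: smooth_on_def ck_on_sum)

lemma smooth_on_mult:
  fixes f g :: "'a::euclidean_space \<Rightarrow> real"
  shows "open S \<Longrightarrow> smooth_on S f \<Longrightarrow> smooth_on S g \<Longrightarrow> smooth_on S (\<lambda>x. f x * g x)"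
  by (simp add: smooth_on_def ck_on_bilinear bounded_bilinear_mult)

lemma smooth_on_cmult:
  fixes f :: "'a::euclidean_space \<Rightarrow> real"
  shows "open S \<Longrightarrow> smooth_on S f \<Longrightarrow> smooth_on S (\<lambda>x. c * f x)"
  by (simp add: smooth_on_mult smooth_on_const)

lemma smooth_on_diff:
  fixes f g :: "'a::euclidean_space \<Rightarrow> real"
  assumes "open S" "smooth_on S f" "smooth_on S g"
  shows "smooth_on S (\<lambda>x. f x - g x)"
  using smooth_on_add[OF assms(1,2) smooth_on_cmult[OF assms(1,3), of "- 1"]] by simp

lemma smooth_on_prod:
  fixes f :: "'i \<Rightarrow> 'a::euclidean_space \<Rightarrow> real"
  assumes "open S" "\<And>i. i \<in> I \<Longrightarrow> smooth_on S (f i)"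
  shows "smooth_on S (\<lambda>x. \<Prod>i\<in>I. f i x)"
  using assms(2)
  by (induction I rule: infinite_finite_induct) (auto intro: smooth_on_const smooth_on_mult assms(1))

lemma smooth_on_compose:
  fixes f :: "'a::euclidean_space \<Rightarrow> 'b::euclidean_space" and g :: "'b \<Rightarrow> 'c::real_normed_vector"
  assumes "open S" "smooth_on S f" "smooth_on T g" "f ` S \<subseteq> T"
  shows "smooth_on S (\<lambda>x. g (f x))"
  using assms ck_on_compose unfolding smooth_on_def by blast

lemma smooth_on_inverse:
  fixes f :: "'a::euclidean_space \<Rightarrow> real"
  assumes "open S" "smooth_on S f" "\<And>x. x \<in> S \<Longrightarrow> f x \<noteq> 0"
  shows "smooth_on S (\<lambda>x. inverse (f x))"
  unfolding smooth_on_def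
proof
  fix k
  show "ck_on k S (\<lambda>x. inverse (f x))"
  proof (induction k)
    case 0
    have "continuous_on S f" using assms(2) unfolding smooth_on_def by (metis ck_on.simps(1))
    then show ?case using assms(3) by (simp add: continuous_on_inverse)
  next
    case (Suc k)
    have f: "ck_on k S f" for k using assms(2) by (simp add: smooth_on_def)
    show ?case
    proof (rule ck_on_SucI[OF assms(1)])
      fix x assume x: "x \<in> S"
      show "((\<lambda>x. inverse (f x)) has_derivative
          (\<lambda>v. - (inverse (f x) * frechet_derivative f (at x) v * inverse (f x)))) (at x)"
        by (rule Deriv.has_derivative_inverse[OF assms(3)[OF x] ck_on_has_derivative[OF f x]])
    next
      fix v
      have "ck_on k S (\<lambda>x. frechet_derivative f (at x) v)"
        using f[of "Suc k"] by simp
      then show "ck_on k S (\<lambda>x. - (inverse (f x) * frechet_derivative f (at x) v * inverse (f x)))"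
        by (intro ck_on_compose_linear[OF assms(1) bounded_linear_minus[OF bounded_linear_ident]]
            ck_on_bilinear[OF assms(1) bounded_bilinear_mult] Suc.IH)
    qed
  qed
qed

lemma smooth_on_divide:
  fixes f g :: "'a::euclidean_space \<Rightarrow> real"
  assumes "open S" "smooth_on S f" "smooth_on S g" "\<And>x. x \<in> S \<Longrightarrow> g x \<noteq> 0"
  shows "smooth_on S (\<lambda>x. f x / g x)"
  unfolding divide_inverse by (intro smooth_on_mult smooth_on_inverse assms)

lemma bounded_linear_axis: "bounded_linear (axis i :: 'b::euclidean_space \<Rightarrow> 'b^'n)"
  unfolding linear_conv_bounded_linear[symmetric]
  by (rule linearI) (auto simp: axis_def vec_eq_iff)

lemma smooth_on_vec:
  fixes f :: "'a::euclidean_space \<Rightarrow> 'b::euclidean_space^'n"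
  assumes "open S"
  shows "smooth_on S f \<longleftrightarrow> (\<forall>i. smooth_on S (\<lambda>x. f x $ i))"
proof
  assume "smooth_on S f"
  then show "\<forall>i. smooth_on S (\<lambda>x. f x $ i)"
    using smooth_on_compose_linear[OF assms bounded_linear_vec_nth] by blast
next
  assume "\<forall>i. smooth_on S (\<lambda>x. f x $ i)"
  then have "smooth_on S (\<lambda>x. \<Sum>i\<in>UNIV. axis i (f x $ i))"
    by (intro smooth_on_sum[OF assms] smooth_on_compose_linear[OF assms bounded_linear_axis]) simp
  moreover have "(\<Sum>i\<in>UNIV. axis i (f x $ i)) = f x" for x
    by (simp add: vec_eq_iff axis_def)
  ultimately show "smooth_on S f" by simp
qed

lemma smooth_on_matrix:
  fixes f :: "'a::euclidean_space \<Rightarrow> real^'n^'m"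
  assumes "open S"
  shows "smooth_on S f \<longleftrightarrow> (\<forall>i j. smooth_on S (\<lambda>x. f x $ i $ j))"
  by (simp add: smooth_on_vec[OF assms])

lemma smooth_on_matrix_mult:
  fixes f :: "'a::euclidean_space \<Rightarrow> real^'n^'m" and g :: "'a \<Rightarrow> real^'k^'n"
  assumes "open S" "smooth_on S f" "smooth_on S g"
  shows "smooth_on S (\<lambda>x. f x ** g x)"
  using assms unfolding smooth_on_matrix[OF assms(1)]
  by (auto simp: matrix_matrix_mult_def intro!: smooth_on_sum smooth_on_mult)

lemma smooth_on_transpose:
  fixes f :: "'a::euclidean_space \<Rightarrow> real^'n^'m"
  assumes "open S" "smooth_on S f"
  shows "smooth_on S (\<lambda>x. transpose (f x))"
  using assms unfolding smooth_on_matrix[OF assms(1)] by (simp add: transpose_def)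

lemma smooth_on_det:
  fixes f :: "'a::euclidean_space \<Rightarrow> real^'n^'n"
  assumes "open S" "smooth_on S f"
  shows "smooth_on S (\<lambda>x. det (f x))"
  using assms unfolding smooth_on_matrix[OF assms(1)] det_def
  by (intro smooth_on_sum smooth_on_mult smooth_on_prod smooth_on_const) auto

lemma smooth_on_imp_continuous: "smooth_on S f \<Longrightarrow> continuous_on S f"
  unfolding smooth_on_def by (metis ck_on.simps(1))

lemma smooth_on_has_derivative:
  "smooth_on S f \<Longrightarrow> x \<in> S \<Longrightarrow> (f has_derivative frechet_derivative f (at x)) (at x)"
  unfolding smooth_on_def by (rule ck_on_has_derivative) auto

lemma smooth_on_derivative: "smooth_on S f \<Longrightarrow> smooth_on S (\<lambda>x. frechet_derivative f (at x) v)"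
  unfolding smooth_on_def by (metis ck_on.simps(2))

lemma smooth_on_component: "open S \<Longrightarrow> smooth_on S (\<lambda>x::real^'n. x $ i)"
  by (rule smooth_on_linear) (simp_all add: bounded_linear_vec_nth)


section \<open>Partial derivatives and order of vanishing\<close>

definition pd :: "'n \<Rightarrow> (real^'n \<Rightarrow> real) \<Rightarrow> real^'n::finite \<Rightarrow> real" where
  "pd k f y = frechet_derivative f (at y) (axis k 1)"

lemma pd_cong:
  "open S \<Longrightarrow> x \<in> S \<Longrightarrow> (\<And>y. y \<in> S \<Longrightarrow> f y = g y) \<Longrightarrow> pd k f x = pd k g x"
  unfolding pd_def by (subst frechet_derivative_cong) auto

lemma smooth_on_pd: "smooth_on S f \<Longrightarrow> smooth_on S (pd k f)"
  using smooth_on_derivative[of S f "axis k 1"] by (simp add: pd_def[abs_def])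

lemma pd_eqI: "(f has_derivative D) (at y) \<Longrightarrow> pd k f y = D (axis k 1)"
  unfolding pd_def using frechet_derivative_at by metis

lemma derivative_eq_pd_sum:
  assumes "(f has_derivative D) (at (y::real^'n))"
  shows "D v = (\<Sum>k\<in>UNIV. v $ k * pd k f y)"
proof -
  have "D v = D (\<Sum>k\<in>UNIV. (v $ k) *\<^sub>R axis k 1)"
    using basis_expansion[of v] by (simp add: scalar_mult_eq_scaleR)
  also have "\<dots> = (\<Sum>k\<in>UNIV. v $ k * D (axis k 1))"
    using has_derivative_linear[OF assms] by (simp add: linear_sum linear_scale)
  finally show ?thesis using pd_eqI[OF assms] by simp
qed

lemma pd_const [simp]: "pd k (\<lambda>y. c) y = 0"
  by (rule pd_eqI[of _ "\<lambda>v. 0", simplified]) simp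

lemma pd_add:
  assumes "smooth_on S f" "smooth_on S g" "y \<in> S"
  shows "pd k (\<lambda>y. f y + g y) y = pd k f y + pd k g y"
  using pd_eqI[OF has_derivative_add[OF smooth_on_has_derivative[OF assms(1,3)]
        smooth_on_has_derivative[OF assms(2,3)]]] by (simp add: pd_def)

lemma pd_diff:
  assumes "smooth_on S f" "smooth_on S g" "y \<in> S"
  shows "pd k (\<lambda>y. f y - g y) y = pd k f y - pd k g y"
  using pd_eqI[OF has_derivative_diff[OF smooth_on_has_derivative[OF assms(1,3)]
        smooth_on_has_derivative[OF assms(2,3)]]] by (simp add: pd_def)

lemma pd_mult:
  assumes "smooth_on S f" "smooth_on S g" "y \<in> S"
  shows "pd k (\<lambda>y. f y * g y) y = f y * pd k g y + pd k f y * g y"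
  using pd_eqI[OF has_derivative_mult[OF smooth_on_has_derivative[OF assms(1,3)]
        smooth_on_has_derivative[OF assms(2,3)]]] by (simp add: pd_def)

lemma pd_cmult:
  assumes "smooth_on S f" "y \<in> S"
  shows "pd k (\<lambda>y. c * f y) y = c * pd k f y"
  using pd_eqI[OF has_derivative_mult_right[OF smooth_on_has_derivative[OF assms]]]
  by (simp add: pd_def)

lemma pd_sum:
  assumes "\<And>i. i \<in> I \<Longrightarrow> smooth_on S (f i)" "y \<in> S"
  shows "pd k (\<lambda>y. \<Sum>i\<in>I. f i y) y = (\<Sum>i\<in>I. pd k (f i) y)"
  unfolding pd_def
  by (rule fun_cong[OF frechet_derivative_at[symmetric]])
    (intro has_derivative_sum smooth_on_has_derivative[OF assms(1) assms(2)])

lemma pd_component: "pd k (\<lambda>y. y $ i) y = (if i = k then 1 else 0)"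
  using pd_eqI[OF bounded_linear.has_derivative[OF bounded_linear_vec_nth[of i] has_derivative_ident], of k y]
  by (simp add: axis_def)

lemma pd_compose:
  fixes \<phi> :: "real^'m \<Rightarrow> real^'n::finite" and f :: "real^'n \<Rightarrow> real"
  assumes "smooth_on S \<phi>" "smooth_on T f" "y \<in> S" "\<phi> y \<in> T"
  shows "pd k (\<lambda>y. f (\<phi> y)) y = (\<Sum>l\<in>UNIV. pd k (\<lambda>y. \<phi> y $ l) y * pd l f (\<phi> y))"
proof -
  note \<phi>' = smooth_on_has_derivative[OF assms(1,3)]
  note f' = smooth_on_has_derivative[OF assms(2,4)]
  have comp: "pd k (\<lambda>y. \<phi> y $ l) y = frechet_derivative \<phi> (at y) (axis k 1) $ l" for l
    by (rule pd_eqI[OF bounded_linear.has_derivative[OF bounded_linear_vec_nth \<phi>']])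
  show ?thesis
    unfolding comp derivative_eq_pd_sum[OF f', symmetric]
    by (rule pd_eqI[OF has_derivative_compose[OF \<phi>' f']])
qed

text \<open>All partial derivatives of order below m vanish, so that equality of 2-jets is order 3
  of the difference. Orders add under products, which replaces explicit second derivatives of
  composite expressions.\<close>

primrec vanishes_to_order :: "nat \<Rightarrow> (real^'n::finite \<Rightarrow> real) \<Rightarrow> real^'n \<Rightarrow> bool" where
  "vanishes_to_order 0 f y \<longleftrightarrow> True"
| "vanishes_to_order (Suc m) f y \<longleftrightarrow> f y = 0 \<and> (\<forall>k. vanishes_to_order m (pd k f) y)"

abbreviation "vord \<equiv> vanishes_to_order"

lemma vord_cong:
  assumes "open S" "y \<in> S" "\<And>z. z \<in> S \<Longrightarrow> f z = g z"
  shows "vord m f y \<longleftrightarrow> vord m g y"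
  using assms(3)
proof (induction m arbitrary: f g)
  case (Suc m)
  have "vord m (pd k f) y \<longleftrightarrow> vord m (pd k g) y" for k
    by (rule Suc.IH) (rule pd_cong[OF assms(1) _ Suc.prems])
  then show ?case using Suc.prems assms(2) by simp
qed simp

lemma vord_lower: "vord (Suc m) f y \<Longrightarrow> vord m f y"
  by (induction m arbitrary: f) auto

lemma vord_zero: "vord m (\<lambda>y. 0) y"
  by (induction m) (auto simp: pd_def[abs_def] frechet_derivative_const)

lemma vord_add:
  assumes "open S" "y \<in> S" "smooth_on S f" "smooth_on S g" "vord m f y" "vord m g y"
  shows "vord m (\<lambda>z. f z + g z) y"
  using assms(3-)
proof (induction m arbitrary: f g)
  case (Suc m)
  have "vord m (\<lambda>z. pd k f z + pd k g z) y" for k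
    using Suc.prems by (intro Suc.IH) (auto intro: smooth_on_pd)
  moreover have "vord m (pd k (\<lambda>z. f z + g z)) y \<longleftrightarrow> vord m (\<lambda>z. pd k f z + pd k g z) y" for k
    by (rule vord_cong[OF assms(1,2)]) (rule pd_add[OF Suc.prems(1,2)])
  ultimately show ?case using Suc.prems by simp
qed simp

lemma vord_mult:
  assumes "open S" "y \<in> S" "smooth_on S f" "smooth_on S g" "vord a f y" "vord b g y" "m \<le> a + b"
  shows "vord m (\<lambda>z. f z * g z) y"
  using assms(3-)
proof (induction m arbitrary: f g a b)
  case (Suc m)
  have "vord m (pd k (\<lambda>z. f z * g z)) y" for k
  proof -
    \<comment> \<open>Truncated subtraction is right here: if \<open>a = 0\<close>, then
      \<open>b\<close> alone accounts for the required order.\<close>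
    have a: "vord (a - 1) (pd k f) y" using Suc.prems(3) by (cases a) auto
    have b: "vord (b - 1) (pd k g) y" using Suc.prems(4) by (cases b) auto
    have "vord m (\<lambda>z. f z * pd k g z + pd k f z * g z) y"
    proof (intro vord_add[OF assms(1,2)] smooth_on_mult[OF assms(1)] smooth_on_pd Suc.prems(1,2))
      show "vord m (\<lambda>z. f z * pd k g z) y"
        by (rule Suc.IH[OF Suc.prems(1) smooth_on_pd[OF Suc.prems(2)] Suc.prems(3) b]) (use Suc.prems in auto)
      show "vord m (\<lambda>z. pd k f z * g z) y"
        by (rule Suc.IH[OF smooth_on_pd[OF Suc.prems(1)] Suc.prems(2) a Suc.prems(4)]) (use Suc.prems in auto)
    qed
    moreover have "vord m (pd k (\<lambda>z. f z * g z)) y \<longleftrightarrow> vord m (\<lambda>z. f z * pd k g z + pd k f z * g z) y"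
      by (rule vord_cong[OF assms(1,2)]) (rule pd_mult[OF Suc.prems(1,2)])
    ultimately show ?thesis by simp
  qed
  moreover have "f y * g y = 0"
    using Suc.prems by (cases a; cases b) auto
  ultimately show ?case by simp
qed simp

lemma vord_sum:
  assumes "open S" "y \<in> S" "\<And>i. i \<in> I \<Longrightarrow> smooth_on S (f i)" "\<And>i. i \<in> I \<Longrightarrow> vord m (f i) y"
  shows "vord m (\<lambda>z. \<Sum>i\<in>I. f i z) y"
  using assms(3,4)
  by (induction I rule: infinite_finite_induct)
    (auto intro!: vord_zero vord_add[OF assms(1,2)] smooth_on_sum[OF assms(1)])

lemma vord_cmult:
  assumes "open S" "y \<in> S" "smooth_on S f" "vord m f y"
  shows "vord m (\<lambda>z. c * f z) y"
  by (rule vord_mult[OF assms(1,2) smooth_on_const[OF assms(1)] assms(3), of 0 c m]) (use assms in auto)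

lemma vord_diff:
  assumes "open S" "y \<in> S" "smooth_on S f" "smooth_on S g" "vord m f y" "vord m g y"
  shows "vord m (\<lambda>z. f z - g z) y"
  using vord_add[OF assms(1-3) smooth_on_cmult[OF assms(1,4)] assms(5) vord_cmult[OF assms(1,2,4,6)], of "- 1"]
  by simp

lemma vord_compose:
  fixes \<phi> :: "real^'m \<Rightarrow> real^'n::finite"
  assumes "open S" "y \<in> S" "smooth_on S \<phi>" "\<phi> ` S \<subseteq> T" "smooth_on T f" "vord m f (\<phi> y)"
  shows "vord m (\<lambda>z. f (\<phi> z)) y"
  using assms(5-)
proof (induction m arbitrary: f)
  case (Suc m)
  have "vord m (pd k (\<lambda>z. f (\<phi> z))) y" for k
  proof -
    have \<phi>: "smooth_on S (\<lambda>z. \<phi> z $ l)" for l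
      by (rule smooth_on_compose_linear[OF assms(1) bounded_linear_vec_nth assms(3)])
    have f: "smooth_on S (\<lambda>z. pd l f (\<phi> z))" for l
      by (rule smooth_on_compose[OF assms(1,3) smooth_on_pd[OF Suc.prems(1)] assms(4)])
    have "vord m (\<lambda>z. \<Sum>l\<in>UNIV. pd k (\<lambda>z. \<phi> z $ l) z * pd l f (\<phi> z)) y"
    proof (intro vord_sum[OF assms(1,2)] smooth_on_mult[OF assms(1)] smooth_on_pd \<phi> f)
      fix l
      have "vord m (\<lambda>z. pd l f (\<phi> z)) y"
        by (rule Suc.IH[OF smooth_on_pd[OF Suc.prems(1)]]) (use Suc.prems in simp)
      then show "vord m (\<lambda>z. pd k (\<lambda>z. \<phi> z $ l) z * pd l f (\<phi> z)) y"
        by (intro vord_mult[OF assms(1,2) smooth_on_pd[OF \<phi>] f, where a = 0 and b = m]) auto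
    qed
    moreover have "vord m (pd k (\<lambda>z. f (\<phi> z))) y
        \<longleftrightarrow> vord m (\<lambda>z. \<Sum>l\<in>UNIV. pd k (\<lambda>z. \<phi> z $ l) z * pd l f (\<phi> z)) y"
      by (rule vord_cong[OF assms(1,2)]) (rule pd_compose[OF assms(3) Suc.prems(1)]; use assms(4) in auto)
    ultimately show ?thesis by simp
  qed
  then show ?case using Suc.prems by simp
qed simp

text \<open>Mean value theorem twice: in direction \<open>k\<close> for the difference over
  \<open>l\<close>, then in direction \<open>l\<close>.\<close>

lemma mixed_difference:
  fixes f :: "real^'n::finite \<Rightarrow> real"
  assumes f: "smooth_on S f" and ball: "\<And>s r. 0 \<le> s \<Longrightarrow> s \<le> t \<Longrightarrow> 0 \<le> r \<Longrightarrow> r \<le> t \<Longrightarrow>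
      y + s *\<^sub>R axis k 1 + r *\<^sub>R axis l 1 \<in> S" and t: "0 < t"
  shows "\<exists>s r. 0 < s \<and> s < t \<and> 0 < r \<and> r < t \<and>
    f (y + t *\<^sub>R axis k 1 + t *\<^sub>R axis l 1) - f (y + t *\<^sub>R axis k 1) - f (y + t *\<^sub>R axis l 1) + f y
      = t * t * pd l (pd k f) (y + s *\<^sub>R axis k 1 + r *\<^sub>R axis l 1)"
proof -
  have line: "((\<lambda>s. g (z + s *\<^sub>R axis m 1)) has_real_derivative pd m g (z + s *\<^sub>R axis m 1)) (at s)"
    if "smooth_on S g" "z + s *\<^sub>R axis m 1 \<in> S" for g :: "real^'n \<Rightarrow> real" and z m s
  proof -
    have "((\<lambda>s. z + s *\<^sub>R axis m 1) has_derivative (\<lambda>h. h *\<^sub>R axis m 1)) (at s)"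
      by (auto intro!: derivative_eq_intros)
    from has_derivative_compose[OF this smooth_on_has_derivative[OF that]]
    have "((\<lambda>s. g (z + s *\<^sub>R axis m 1)) has_derivative
        (\<lambda>h. frechet_derivative g (at (z + s *\<^sub>R axis m 1)) (h *\<^sub>R axis m 1))) (at s)" .
    moreover have "frechet_derivative g (at (z + s *\<^sub>R axis m 1)) (h *\<^sub>R axis m 1)
        = pd m g (z + s *\<^sub>R axis m 1) * h" for h
      using linear_scale[OF has_derivative_linear[OF smooth_on_has_derivative[OF that]]]
      by (simp add: pd_def)
    ultimately show ?thesis by (simp add: has_field_derivative_def)
  qed
  define \<phi> where "\<phi> s = f ((y + t *\<^sub>R axis l 1) + s *\<^sub>R axis k 1) - f (y + s *\<^sub>R axis k 1)" for s
  have "\<exists>s>0. s < t \<and> \<phi> t - \<phi> 0 = (t - 0) *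
      (pd k f ((y + t *\<^sub>R axis l 1) + s *\<^sub>R axis k 1) - pd k f (y + s *\<^sub>R axis k 1))"
  proof (rule MVT2[OF t])
    fix s assume s: "0 \<le> s" "s \<le> t"
    have 1: "(y + t *\<^sub>R axis l 1) + s *\<^sub>R axis k 1 \<in> S" using ball[of s t] s t by (simp add: algebra_simps)
    have 2: "y + s *\<^sub>R axis k 1 \<in> S" using ball[of s 0] s t by simp
    show "(\<phi> has_real_derivative
        pd k f ((y + t *\<^sub>R axis l 1) + s *\<^sub>R axis k 1) - pd k f (y + s *\<^sub>R axis k 1)) (at s)"
      unfolding \<phi>_def[abs_def] by (intro DERIV_diff line[OF f 1] line[OF f 2])
  qed
  then obtain s where s: "0 < s" "s < t" "\<phi> t - \<phi> 0 = t *
      (pd k f ((y + t *\<^sub>R axis l 1) + s *\<^sub>R axis k 1) - pd k f (y + s *\<^sub>R axis k 1))"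
    by auto
  have "\<exists>r>0. r < t \<and> pd k f ((y + s *\<^sub>R axis k 1) + t *\<^sub>R axis l 1) - pd k f ((y + s *\<^sub>R axis k 1) + 0 *\<^sub>R axis l 1)
      = (t - 0) * pd l (pd k f) ((y + s *\<^sub>R axis k 1) + r *\<^sub>R axis l 1)"
  proof (rule MVT2[OF t])
    fix r assume r: "0 \<le> r" "r \<le> t"
    have "(y + s *\<^sub>R axis k 1) + r *\<^sub>R axis l 1 \<in> S" using ball[of s r] s r by simp
    then show "((\<lambda>r. pd k f ((y + s *\<^sub>R axis k 1) + r *\<^sub>R axis l 1)) has_real_derivative
        pd l (pd k f) ((y + s *\<^sub>R axis k 1) + r *\<^sub>R axis l 1)) (at r)"
      by (rule line[OF smooth_on_pd[OF f]])
  qed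
  then obtain r where "0 < r" "r < t"
    "pd k f ((y + s *\<^sub>R axis k 1) + t *\<^sub>R axis l 1) - pd k f (y + s *\<^sub>R axis k 1)
      = t * pd l (pd k f) ((y + s *\<^sub>R axis k 1) + r *\<^sub>R axis l 1)"
    by auto
  then show ?thesis using s
    by (intro exI[of _ s] exI[of _ r]) (simp add: \<phi>_def algebra_simps)
qed

text \<open>The second difference quotient is symmetric in \<open>k\<close> and \<open>l\<close> and
  by \<open>mixed_difference\<close> tends to either mixed derivative. This symmetry helps to make
  the array of second derivatives of a metric a fixed point of \<open>quad_sym\<close>.\<close>

lemma pd_commute:
  fixes f :: "real^'n::finite \<Rightarrow> real"
  assumes "open S" "y \<in> S" "smooth_on S f"
  shows "pd k (pd l f) y = pd l (pd k f) y"
proof -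
  obtain e where e: "e > 0" "ball y e \<subseteq> S" using assms by (meson open_contains_ball)
  define p where "p k l s r = y + s *\<^sub>R axis k 1 + r *\<^sub>R axis l 1" for k l :: 'n and s r :: real
  have p: "dist y (p k l s r) \<le> s + r" if "0 \<le> s" "0 \<le> r" for k l s r
  proof -
    have "dist y (p k l s r) = norm (s *\<^sub>R axis k (1::real) + r *\<^sub>R axis l 1)"
    proof -
      have "y - p k l s r = - (s *\<^sub>R axis k (1::real) + r *\<^sub>R axis l 1)" by (simp add: p_def)
      then show ?thesis unfolding dist_norm by (metis norm_minus_cancel)
    qed
    also have "\<dots> \<le> s + r"
      using that by (intro order_trans[OF norm_triangle_ineq]) (simp add: norm_axis_1)
    finally show ?thesis .
  qed
  define \<Delta> where "\<Delta> t = (f (p k l t t) - f (y + t *\<^sub>R axis k 1) - f (y + t *\<^sub>R axis l 1) + f y) / (t * t)" for t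
  have lim: "(\<Delta> \<longlongrightarrow> pd l' (pd k' f) y) (at_right 0)"
    if kl: "(k' = k \<and> l' = l) \<or> (k' = l \<and> l' = k)" for k' l'
  proof (rule tendstoI)
    fix \<epsilon> :: real assume \<epsilon>: "\<epsilon> > 0"
    have "continuous_on S (pd l' (pd k' f))"
      by (intro smooth_on_imp_continuous smooth_on_pd assms(3))
    then obtain d where d: "d > 0" "\<And>z. z \<in> S \<Longrightarrow> dist z y < d \<Longrightarrow> dist (pd l' (pd k' f) z) (pd l' (pd k' f) y) < \<epsilon>"
      using assms(2) \<epsilon> unfolding continuous_on_iff by metis
    \<comment> \<open>Half of the radius, because the intermediate point lies within
      \<open>s + r\<close>, less than 2t, of \<open>y\<close>.\<close>
    have "dist (\<Delta> t) (pd l' (pd k' f) y) < \<epsilon>" if t: "0 < t" "t < min d e / 2" for t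
    proof -
      have "\<exists>s r. 0 < s \<and> s < t \<and> 0 < r \<and> r < t \<and>
        f (y + t *\<^sub>R axis k' 1 + t *\<^sub>R axis l' 1) - f (y + t *\<^sub>R axis k' 1) - f (y + t *\<^sub>R axis l' 1) + f y
          = t * t * pd l' (pd k' f) (y + s *\<^sub>R axis k' 1 + r *\<^sub>R axis l' 1)"
      proof (rule mixed_difference[OF assms(3) _ t(1)])
        fix s r assume "0 \<le> s" "s \<le> t" "0 \<le> r" "r \<le> t"
        then show "y + s *\<^sub>R axis k' 1 + r *\<^sub>R axis l' 1 \<in> S"
          using p[of s r k' l'] t e(2) by (force simp: p_def)
      qed
      then obtain s r where sr: "0 < s" "s < t" "0 < r" "r < t"
        "f (y + t *\<^sub>R axis k' 1 + t *\<^sub>R axis l' 1) - f (y + t *\<^sub>R axis k' 1) - f (y + t *\<^sub>R axis l' 1) + f y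
          = t * t * pd l' (pd k' f) (p k' l' s r)"
        unfolding p_def by blast
      have "f (y + t *\<^sub>R axis k' 1 + t *\<^sub>R axis l' 1) - f (y + t *\<^sub>R axis k' 1) - f (y + t *\<^sub>R axis l' 1) + f y
        = f (p k l t t) - f (y + t *\<^sub>R axis k 1) - f (y + t *\<^sub>R axis l 1) + f y"
        using kl by (auto simp: p_def algebra_simps)
      then have "\<Delta> t = pd l' (pd k' f) (p k' l' s r)"
        using sr(5) t(1) unfolding \<Delta>_def by (simp add: field_simps)
      moreover have "dist y (p k' l' s r) < min d e" using p[of s r k' l'] sr t by linarith
      ultimately show ?thesis
        using d(2)[of "p k' l' s r"] e(2) by (auto simp: dist_commute)
    qed
    then show "\<forall>\<^sub>F t in at_right 0. dist (\<Delta> t) (pd l' (pd k' f) y) < \<epsilon>"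
      using d(1) e(1) by (auto simp: eventually_at_right_field intro!: exI[of _ "min d e / 2"])
  qed
  show ?thesis
    by (rule tendsto_unique[OF trivial_limit_at_right_real lim lim]) auto
qed


section \<open>Local inverses of smooth maps\<close>

lemma jacobian_nth:
  assumes "smooth_on S T" "y \<in> S"
  shows "jacobian T (at y) $ i $ j = pd j (\<lambda>y. T y $ i) y"
proof -
  have "pd j (\<lambda>y. T y $ i) y = frechet_derivative T (at y) (axis j 1) $ i"
    by (rule pd_eqI[OF bounded_linear.has_derivative[OF bounded_linear_vec_nth smooth_on_has_derivative[OF assms]]])
  then show ?thesis by (simp add: jacobian_def matrix_def)
qed

lemma jacobian_eqI:
  assumes "(T has_derivative D) (at y)"
  shows "jacobian T (at y) = matrix D"
  unfolding jacobian_def using frechet_derivative_at[OF assms] by simp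

lemma smooth_on_jacobian:
  fixes T :: "real^'n \<Rightarrow> real^'m"
  assumes "open S" "smooth_on S T"
  shows "smooth_on S (\<lambda>y. jacobian T (at y))"
  unfolding smooth_on_matrix[OF assms(1)]
proof (intro allI)
  fix i j
  have "smooth_on S (pd j (\<lambda>y. T y $ i))"
    using assms(2) unfolding smooth_on_vec[OF assms(1)] by (intro smooth_on_pd) simp
  then show "smooth_on S (\<lambda>y. jacobian T (at y) $ i $ j)"
    by (subst smooth_on_cong[OF assms(1)]) (rule jacobian_nth[OF assms(2)])
qed

text \<open>Inverse function theorem with a smooth inverse: Cramer's rule writes the derivative of
  \<open>S\<close> at \<open>z\<close> as a rational function of the Jacobian at \<open>S z\<close>,
  so \<open>S\<close> gains one degree of differentiability at a time. Since \<open>T y = y\<close>,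
  both domains fit into \<open>N\<close>.\<close>

lemma local_inverse:
  fixes T :: "real^'n \<Rightarrow> real^'n"
  assumes N: "open N" "y \<in> N" and T: "smooth_on N T" "T y = y" and inv: "det (jacobian T (at y)) \<noteq> 0"
  obtains U V S where "open U" "open V" "y \<in> U" "U \<subseteq> N" "V \<subseteq> N" "homeomorphism U V T S"
    "smooth_on V S" "\<And>z. z \<in> U \<Longrightarrow> det (jacobian T (at z)) \<noteq> 0"
proof -
  define J where "J z = jacobian T (at z)" for z
  have J: "smooth_on N J" unfolding J_def[abs_def] by (rule smooth_on_jacobian[OF N(1) T(1)])
  have detJ: "smooth_on N (\<lambda>z. det (J z))" by (rule smooth_on_det[OF N(1) J])
  define N' where "N' = N \<inter> (\<lambda>z. det (J z)) -` (- {0})"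
  have N': "open N'" "y \<in> N'" "N' \<subseteq> N"
    unfolding N'_def using continuous_open_preimage[OF smooth_on_imp_continuous[OF detJ] N(1), of "- {0}"] N inv
    by (auto simp: J_def)
  define T' where "T' z = Blinfun (frechet_derivative T (at z))" for z
  have T': "blinfun_apply (T' z) = frechet_derivative T (at z)" if "z \<in> N" for z
    unfolding T'_def
    by (rule bounded_linear_Blinfun_apply[OF has_derivative_bounded_linear[OF smooth_on_has_derivative[OF T(1) that]]])
  have JT: "J z *v v = frechet_derivative T (at z) v" if "z \<in> N" for z v
    unfolding J_def jacobian_def
    using has_derivative_linear[OF smooth_on_has_derivative[OF T(1) that]] by simp
  define invf where "invf = Blinfun (\<lambda>v. matrix_inv (J y) *v v)"
  have invf: "invf o\<^sub>L T' y = id_blinfun"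
  proof (rule blinfun_eqI)
    fix v
    have "invertible (J y)" using inv by (simp add: J_def invertible_det_nz)
    then have "matrix_inv (J y) ** J y = mat 1"
      unfolding invertible_def matrix_inv_def by (rule someI2_ex) simp
    then have "matrix_inv (J y) *v (J y *v v) = v"
      by (simp add: matrix_vector_mul_assoc)
    then show "blinfun_apply (invf o\<^sub>L T' y) v = blinfun_apply id_blinfun v"
      by (simp add: invf_def T'[OF N(2)] JT[OF N(2), symmetric] bounded_linear_Blinfun_apply
          matrix_vector_mul_bounded_linear)
  qed
  have contT': "continuous_on N' T'"
  proof (rule continuous_on_blinfun_componentwise)
    fix i :: "real^'n" assume "i \<in> Basis"
    have "continuous_on N' (\<lambda>z. frechet_derivative T (at z) i)"
      by (rule continuous_on_subset[OF smooth_on_imp_continuous[OF smooth_on_derivative[OF T(1)]] N'(3)])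
    then show "continuous_on N' (\<lambda>z. blinfun_apply (T' z) i)"
      by (rule continuous_on_eq) (use T' N'(3) in auto)
  qed
  obtain U' V' S S' where S: "open U'" "U' \<subseteq> N'" "y \<in> U'" "open V'" "T y \<in> V'" "homeomorphism U' V' T S"
    "\<And>z. z \<in> V' \<Longrightarrow> (S has_derivative (S' z)) (at z)"
    "\<And>z. z \<in> V' \<Longrightarrow> S' z = inv (blinfun_apply (T' (S z)))"
    "\<And>z. z \<in> V' \<Longrightarrow> bij (blinfun_apply (T' (S z)))"
  proof (rule inverse_function_theorem[OF N'(1) _ contT' N'(2) invf])
    show "(T has_derivative blinfun_apply (T' z)) (at z)" if "z \<in> N'" for z
      using smooth_on_has_derivative[OF T(1)] T' N'(3) that by (metis subsetD)
  qed (rule that)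
  have SV: "S z \<in> U'" "T (S z) = z" if "z \<in> V'" for z
    using S(6) that by (auto simp: homeomorphism_def)
  have deriv: "S' z v $ m = det (\<chi> i j. if j = m then v $ i else J (S z) $ i $ j) / det (J (S z))"
    if z: "z \<in> V'" for z v m
  proof -
    have SN: "S z \<in> N" "det (J (S z)) \<noteq> 0" using SV[OF z] S(2) by (auto simp: N'_def)
    have "blinfun_apply (T' (S z)) (S' z v) = v"
      unfolding S(8)[OF z] by (rule surj_f_inv_f[OF bij_is_surj[OF S(9)[OF z]]])
    then have "J (S z) *v S' z v = v" by (simp add: T'[OF SN(1)] JT[OF SN(1)])
    then have "S' z v = (\<chi> k. det (\<chi> i j. if j = k then v $ i else J (S z) $ i $ j) / det (J (S z)))"
      using cramer[OF SN(2)] by blast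
    then show ?thesis by (simp only: vec_lambda_beta)
  qed
  define R where "R v m z = det (\<chi> i j. if j = m then v $ i else J z $ i $ j) / det (J z)" for v :: "real^'n" and m z
  have R: "smooth_on N' (R v m)" for v m
    unfolding R_def[abs_def]
  proof (intro smooth_on_divide smooth_on_det N'(1) smooth_on_subset[OF J N'(3)])
    show "smooth_on N' (\<lambda>z. \<chi> i j. if j = m then v $ i else J z $ i $ j)"
      unfolding smooth_on_matrix[OF N'(1)]
    proof (intro allI)
      fix i j
      have "smooth_on N' (\<lambda>z. J z $ i $ j)"
        using smooth_on_subset[OF J N'(3)] unfolding smooth_on_matrix[OF N'(1)] by simp
      then show "smooth_on N' (\<lambda>z. (\<chi> i j. if j = m then v $ i else J z $ i $ j) $ i $ j)"
        by (cases "j = m") (simp_all add: smooth_on_const[OF N'(1)])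
    qed
  qed (auto simp: N'_def)
  have "ck_on k V' S" for k
  proof (induction k)
    case 0
    then show ?case using S(6) by (simp add: homeomorphism_def)
  next
    case (Suc k)
    show ?case
    proof (rule ck_on_SucI[OF S(4) S(7)])
      fix v
      have "ck_on k V' (\<lambda>z. R v m (S z))" for m
        using R SV S(2) by (intro ck_on_compose[OF S(4) Suc.IH, of N']) (auto simp: smooth_on_def)
      then have "ck_on k V' (\<lambda>z. \<Sum>m\<in>UNIV. axis m (R v m (S z)))"
        by (intro ck_on_sum[OF S(4)] ck_on_compose_linear[OF S(4) bounded_linear_axis])
      moreover have "(\<Sum>m\<in>UNIV. axis m (R v m (S z))) = S' z v" if "z \<in> V'" for z
        by (simp add: vec_eq_iff axis_def deriv[OF that] R_def)
      ultimately show "ck_on k V' (\<lambda>z. S' z v)"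
        using ck_on_cong[OF S(4), of "\<lambda>z. \<Sum>m\<in>UNIV. axis m (R v m (S z))" "\<lambda>z. S' z v"] by blast
    qed
  qed
  then have smoothS: "smooth_on V' S" by (simp add: smooth_on_def)
  define V where "V = V' \<inter> N"
  define U where "U = U' \<inter> T -` V"
  have U: "open U"
    unfolding U_def V_def using continuous_open_preimage[of U' T "V' \<inter> N"] S(1,4,6) N(1)
    by (auto simp: homeomorphism_def)
  have hom: "homeomorphism U V T S"
  proof (rule homeomorphism_of_subsets[OF S(6)])
    show "T ` U = V"
      using S(6) by (force simp: U_def V_def homeomorphism_def)
  qed (auto simp: U_def V_def)
  show thesis
  proof (rule that[OF U _ _ _ _ hom])
    show "open V" using S(4) N(1) by (simp add: V_def open_Int)
    show "y \<in> U" using S(3,5) N(2) T(2) by (simp add: U_def V_def)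
    show "U \<subseteq> N" using S(2) N'(3) by (auto simp: U_def)
    show "V \<subseteq> N" by (simp add: V_def)
    show "smooth_on V S" by (rule smooth_on_subset[OF smoothS]) (simp add: V_def)
    show "det (jacobian T (at z)) \<noteq> 0" if "z \<in> U" for z
      using that S(2) by (auto simp: U_def N'_def J_def)
  qed
qed


section \<open>Charts, lifted metrics and their jets\<close>

lemma jacobian_compose:
  fixes f :: "real^'n \<Rightarrow> real^'m" and g :: "real^'m \<Rightarrow> real^'k"
  assumes "f differentiable (at y)" "g differentiable (at (f y))"
  shows "jacobian (\<lambda>y. g (f y)) (at y) = jacobian g (at (f y)) ** jacobian f (at y)"
proof -
  have f: "(f has_derivative frechet_derivative f (at y)) (at y)"
    and g: "(g has_derivative frechet_derivative g (at (f y))) (at (f y))"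
    using assms by (simp_all add: frechet_derivative_works)
  have "jacobian (\<lambda>y. g (f y)) (at y)
      = matrix (frechet_derivative g (at (f y)) \<circ> frechet_derivative f (at y))"
    unfolding o_def by (rule jacobian_eqI[OF has_derivative_compose[OF f g]])
  also have "\<dots> = jacobian g (at (f y)) ** jacobian f (at y)"
    unfolding jacobian_def
    by (rule matrix_compose[OF has_derivative_linear[OF f] has_derivative_linear[OF g]])
  finally show ?thesis .
qed

lemma smooth_on_differentiable: "smooth_on S f \<Longrightarrow> x \<in> S \<Longrightarrow> f differentiable (at x)"
  using smooth_on_has_derivative by (auto simp: differentiable_def)

lemma jacobian_cong:
  assumes "open S" "x \<in> S" "\<And>y. y \<in> S \<Longrightarrow> f y = g y"
  shows "jacobian f (at x) = jacobian g (at x)"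
  unfolding jacobian_def by (simp only: frechet_derivative_cong[OF assms])

lemma jacobian_ident: "jacobian (\<lambda>y. y) (at x) = mat 1"
proof -
  have "jacobian (\<lambda>y. y) (at x) = matrix (\<lambda>v. v)"
    by (rule jacobian_eqI) (rule has_derivative_ident)
  then show ?thesis using matrix_id_mat_1 by (simp add: id_def)
qed

lemma congruence_nth:
  fixes M G :: "real^'n^'n"
  shows "(transpose M ** G ** M) $ i $ j = (\<Sum>b\<in>UNIV. \<Sum>a\<in>UNIV. M$a$i * M$b$j * G$a$b)"
  by (simp add: matrix_matrix_mult_def transpose_def sum_distrib_left sum_distrib_right mult_ac)

lemma has_signature_congruence:
  fixes G M :: "real^'n^'n"
  assumes "has_signature r s G" "invertible M"
  shows "has_signature r s (transpose M ** G ** M)"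
proof -
  obtain P :: "real^'n^'n" and S where P: "invertible P" "card S = r" "card (- S) = s"
    "transpose P ** G ** P = (\<chi> i j. if i \<noteq> j then 0 else if i \<in> S then 1 else - 1)"
    using assms(1) unfolding has_signature_def by blast
  obtain M' where M': "M ** M' = mat 1" "M' ** M = mat 1"
    using assms(2) unfolding invertible_def by blast
  define Q where "Q = M' ** P"
  have "invertible M'" using M' unfolding invertible_def by blast
  then have Q: "invertible Q" unfolding Q_def using P(1) by (rule invertible_mult)
  have MQ: "M ** Q = P"
    unfolding Q_def by (simp add: matrix_mul_assoc M')
  have "transpose Q ** (transpose M ** G ** M) ** Q = transpose (M ** Q) ** G ** (M ** Q)"
    by (simp add: matrix_mul_assoc matrix_transpose_mul)
  also have "\<dots> = (\<chi> i j. if i \<noteq> j then 0 else if i \<in> S then 1 else - 1)"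
    by (simp only: MQ P(4))
  finally have eq: "transpose Q ** (transpose M ** G ** M) ** Q
    = (\<chi> i j. if i \<noteq> j then 0 else if i \<in> S then 1 else - 1)" .
  show ?thesis
    unfolding has_signature_def by (rule exI, rule exI, intro conjI, rule Q, rule P(2), rule P(3), rule eq)
qed

lemma transpose_congruence: "transpose G = G \<Longrightarrow> transpose (transpose M ** G ** M) = transpose M ** G ** M"
  for M G :: "real^'n^'n"
  by (simp add: matrix_transpose_mul matrix_mul_assoc)

text \<open>\<open>H\<close> prescribes a metric in the chart \<open>c\<close>; its matrices in the
  other charts, which \<open>metrics_on\<close> also asks for, are forced by the transformation
  law.\<close>

definition lift :: "('a, 'n::finite) chart \<Rightarrow> (real^'n \<Rightarrow> real^'n^'n) \<Rightarrow> ('a, 'n) metric_field" where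
  "lift c H z c' = transpose (tangent_matrix c' c id z) ** H (snd c z) ** tangent_matrix c' c id z"

definition local_metric :: "nat \<Rightarrow> nat \<Rightarrow> (real^'n) set \<Rightarrow> (real^'n \<Rightarrow> real^'n^'n::finite) \<Rightarrow> bool" where
  "local_metric r s N H \<longleftrightarrow> open N \<and> smooth_on N H \<and>
     (\<forall>y\<in>N. transpose (H y) = H y \<and> has_signature r s (H y))"

definition jet_at :: "(real^'n \<Rightarrow> real^'n^'n) \<Rightarrow> real^'n::finite \<Rightarrow>
    (real^'n^'n) \<times> (real^'n^'n^'n) \<times> (real^'n^'n^'n^'n)" where
  "jet_at H y = (H y, \<chi> k i j. pd k (\<lambda>y. H y $ i $ j) y, \<chi> k l i j. pd k (pd l (\<lambda>y. H y $ i $ j)) y)"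

lemma jet_at_cong:
  assumes "open S" "y \<in> S" "\<And>z. z \<in> S \<Longrightarrow> H z = H' z"
  shows "jet_at H y = jet_at H' y"
proof -
  have 1: "pd k (\<lambda>y. H y $ i $ j) z = pd k (\<lambda>y. H' y $ i $ j) z" if "z \<in> S" for k i j z
    by (rule pd_cong[OF assms(1) that]) (simp add: assms(3))
  have "pd k (pd l (\<lambda>y. H y $ i $ j)) y = pd k (pd l (\<lambda>y. H' y $ i $ j)) y" for k l i j
    by (rule pd_cong[OF assms(1,2) 1])
  then show ?thesis using 1[OF assms(2)] assms(2,3) by (simp add: jet_at_def)
qed

lemma jet_at_eq_iff:
  assumes "open N" "y \<in> N" "smooth_on N H" "smooth_on N H'"
  shows "jet_at H y = jet_at H' y \<longleftrightarrow> (\<forall>i j. vord 3 (\<lambda>z. H z $ i $ j - H' z $ i $ j) y)"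
proof -
  have sm: "smooth_on N (\<lambda>z. H z $ i $ j)" "smooth_on N (\<lambda>z. H' z $ i $ j)" for i j
    using assms(3,4) unfolding smooth_on_matrix[OF assms(1)] by auto
  have pd1: "pd k (\<lambda>z. H z $ i $ j - H' z $ i $ j) z = pd k (\<lambda>z. H z $ i $ j) z - pd k (\<lambda>z. H' z $ i $ j) z"
    if "z \<in> N" for k i j z
    by (rule pd_diff[OF sm that])
  have pd2: "pd k (pd l (\<lambda>z. H z $ i $ j - H' z $ i $ j)) y
      = pd k (pd l (\<lambda>z. H z $ i $ j)) y - pd k (pd l (\<lambda>z. H' z $ i $ j)) y" for k l i j
  proof -
    have "pd k (pd l (\<lambda>z. H z $ i $ j - H' z $ i $ j)) y
        = pd k (\<lambda>z. pd l (\<lambda>z. H z $ i $ j) z - pd l (\<lambda>z. H' z $ i $ j) z) y"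
      by (rule pd_cong[OF assms(1,2)]) (rule pd1)
    then show ?thesis using pd_diff[OF smooth_on_pd[OF sm(1)] smooth_on_pd[OF sm(2)] assms(2)] by simp
  qed
  have "vord 3 (\<lambda>z. H z $ i $ j - H' z $ i $ j) y \<longleftrightarrow> H y $ i $ j = H' y $ i $ j \<and>
    (\<forall>k. pd k (\<lambda>z. H z $ i $ j) y = pd k (\<lambda>z. H' z $ i $ j) y \<and>
      (\<forall>l. pd l (pd k (\<lambda>z. H z $ i $ j)) y = pd l (pd k (\<lambda>z. H' z $ i $ j)) y))" for i j
    by (simp add: numeral_3_eq_3 pd1[OF assms(2)] pd2)
  then show ?thesis by (auto simp: jet_at_def vec_eq_iff)
qed

locale atlas =
  fixes A :: "('a::{t2_space,second_countable_topology}, 'n::finite) chart set"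
  assumes atlas: "smooth_atlas A"
begin

lemma chart:
  assumes "c \<in> A"
  shows "open (fst c)" "inj_on (snd c) (fst c)" "open (snd c ` fst c)"
    "homeomorphism (fst c) (snd c ` fst c) (snd c) (chart_inv c)"
  using atlas assms unfolding smooth_atlas_def by auto

lemma chart_inv_chart: "c \<in> A \<Longrightarrow> z \<in> fst c \<Longrightarrow> chart_inv c (snd c z) = z"
  using chart(4) by (auto simp: homeomorphism_def)

lemma chart_chart_inv:
  assumes "c \<in> A" "y \<in> snd c ` fst c"
  shows "snd c (chart_inv c y) = y" "chart_inv c y \<in> fst c"
  using chart_inv_chart[OF assms(1)] assms(2) by auto

lemma open_chart_image: "c \<in> A \<Longrightarrow> open B \<Longrightarrow> B \<subseteq> fst c \<Longrightarrow> open (snd c ` B)"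
  using homeomorphism_imp_open_map[OF chart(4), of c B] chart[of c]
  by (meson open_Int open_openin_trans openin_open_trans openin_open_eq)

lemma open_chart_inv_image: "c \<in> A \<Longrightarrow> open N \<Longrightarrow> N \<subseteq> snd c ` fst c \<Longrightarrow> open (chart_inv c ` N)"
  using homeomorphism_imp_open_map[OF homeomorphism_symD[OF chart(4)], of c N] chart[of c]
  by (meson open_Int open_openin_trans openin_open_trans openin_open_eq)

lemma transition_smooth:
  "c \<in> A \<Longrightarrow> c' \<in> A \<Longrightarrow> smooth_on (snd c ` (fst c \<inter> fst c')) (\<lambda>y. snd c' (chart_inv c y))"
  using atlas unfolding smooth_atlas_def by blast

lemma tangent_matrix_id: "tangent_matrix c c' id x = jacobian (\<lambda>y. snd c' (chart_inv c y)) (at (snd c x))"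
  by (simp add: tangent_matrix_def)

text \<open>Chain rule; on \<open>B\<close> the chart \<open>c2\<close> followed by its inverse can
  be inserted between \<open>\<tau>\<close> and \<open>\<sigma>\<close>.\<close>

lemma tangent_matrix_compose:
  assumes c: "c1 \<in> A" "c2 \<in> A" and x: "x \<in> fst c1"
    and B: "open B" "snd c1 x \<in> B" "\<And>y. y \<in> B \<Longrightarrow> \<tau> (chart_inv c1 y) \<in> fst c2"
    and f: "(\<lambda>y. snd c2 (\<tau> (chart_inv c1 y))) differentiable (at (snd c1 x))"
    and g: "(\<lambda>y. snd c3 (\<sigma> (chart_inv c2 y))) differentiable (at (snd c2 (\<tau> x)))"
  shows "tangent_matrix c2 c3 \<sigma> (\<tau> x) ** tangent_matrix c1 c2 \<tau> x
    = tangent_matrix c1 c3 (\<lambda>z. \<sigma> (\<tau> z)) x"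
proof -
  have x': "snd c2 (\<tau> (chart_inv c1 (snd c1 x))) = snd c2 (\<tau> x)"
    by (simp add: chart_inv_chart c(1) x)
  have "tangent_matrix c1 c3 (\<lambda>z. \<sigma> (\<tau> z)) x
      = jacobian (\<lambda>y. (\<lambda>y. snd c3 (\<sigma> (chart_inv c2 y))) ((\<lambda>y. snd c2 (\<tau> (chart_inv c1 y))) y)) (at (snd c1 x))"
    unfolding tangent_matrix_def
    by (rule jacobian_cong[OF B(1,2)]) (simp add: chart_inv_chart[OF c(2) B(3)])
  also have "\<dots> = tangent_matrix c2 c3 \<sigma> (\<tau> x) ** tangent_matrix c1 c2 \<tau> x"
    unfolding tangent_matrix_def using f g by (subst jacobian_compose) (simp_all add: x')
  finally show ?thesis by simp
qed

lemma tangent_matrix_cocycle: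
  assumes "c1 \<in> A" "c2 \<in> A" "c3 \<in> A" "x \<in> fst c1" "x \<in> fst c2" "x \<in> fst c3"
  shows "tangent_matrix c2 c3 id x ** tangent_matrix c1 c2 id x = tangent_matrix c1 c3 id x"
proof -
  have "tangent_matrix c2 c3 id (id x) ** tangent_matrix c1 c2 id x = tangent_matrix c1 c3 (\<lambda>z. id (id z)) x"
  proof (rule tangent_matrix_compose[OF assms(1,2,4)])
    show "open (snd c1 ` (fst c1 \<inter> fst c2))"
      by (intro open_chart_image open_Int chart(1) assms Int_lower1)
    show "(\<lambda>y. snd c2 (id (chart_inv c1 y))) differentiable at (snd c1 x)"
      using smooth_on_differentiable[OF transition_smooth[of c1 c2]] assms by simp
    show "(\<lambda>y. snd c3 (id (chart_inv c2 y))) differentiable at (snd c2 (id x))"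
      using smooth_on_differentiable[OF transition_smooth[of c2 c3]] assms by simp
  qed (use assms chart_inv_chart[OF assms(1)] in auto)
  then show ?thesis by (simp add: id_def)
qed

lemma tangent_matrix_same:
  assumes "c \<in> A" "x \<in> fst c"
  shows "tangent_matrix c c id x = mat 1"
proof -
  have "tangent_matrix c c id x = jacobian (\<lambda>y. y) (at (snd c x))"
    unfolding tangent_matrix_id
    by (rule jacobian_cong[OF chart(3)[OF assms(1)]]) (use assms chart_inv_chart[OF assms(1)] in auto)
  then show ?thesis by (simp add: jacobian_ident)
qed

lemma tangent_matrix_invertible:
  assumes "c \<in> A" "c' \<in> A" "x \<in> fst c" "x \<in> fst c'"
  shows "invertible (tangent_matrix c c' id x)"
  unfolding invertible_def
proof (intro exI conjI)
  show "tangent_matrix c c' id x ** tangent_matrix c' c id x = mat 1"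
    using tangent_matrix_cocycle[OF assms(2,1,2,4,3,4)] tangent_matrix_same[OF assms(2,4)] by simp
  show "tangent_matrix c' c id x ** tangent_matrix c c' id x = mat 1"
    using tangent_matrix_cocycle[OF assms(1,2,1,3,4,3)] tangent_matrix_same[OF assms(1,3)] by simp
qed

lemma lift_same: "c \<in> A \<Longrightarrow> z \<in> fst c \<Longrightarrow> lift c H z c = H (snd c z)"
  by (simp add: lift_def tangent_matrix_same transpose_mat)

lemma lift_metric:
  assumes c: "c \<in> A" and N: "N \<subseteq> snd c ` fst c" and H: "local_metric r s N H"
  shows "lift c H \<in> metrics_on A r s (chart_inv c ` N)"
proof -
  have N': "open N" "smooth_on N H" and HN: "\<And>y. y \<in> N \<Longrightarrow> transpose (H y) = H y \<and> has_signature r s (H y)"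
    using H by (auto simp: local_metric_def)
  have zN: "snd c z \<in> N \<and> z \<in> fst c" if "z \<in> chart_inv c ` N" for z
    using that N chart_chart_inv[OF c] by auto
  have "transpose (lift c H z c') = lift c H z c' \<and> has_signature r s (lift c H z c')"
    if "z \<in> chart_inv c ` N" "c' \<in> charts_at A z" for z c'
    using HN[of "snd c z"] zN[OF that(1)] that(2) tangent_matrix_invertible[of c' c z] c
    by (auto simp: lift_def charts_at_def intro: transpose_congruence has_signature_congruence)
  moreover have "metric_push A id (chart_inv c ` N) (lift c H) (lift c H)"
    unfolding metric_push_def
  proof (intro ballI)
    fix z c1 c2 assume z: "z \<in> chart_inv c ` N" "c1 \<in> charts_at A z" "c2 \<in> charts_at A (id z)"
    have "tangent_matrix c2 c id z ** tangent_matrix c1 c2 id z = tangent_matrix c1 c id z"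
      by (rule tangent_matrix_cocycle) (use z zN c in \<open>auto simp: charts_at_def\<close>)
    then show "lift c H z c1 = transpose (tangent_matrix c1 c2 id z) ** lift c H (id z) c2 ** tangent_matrix c1 c2 id z"
      unfolding lift_def by (simp add: matrix_transpose_mul[symmetric] matrix_mul_assoc[symmetric])
        (metis matrix_mul_assoc matrix_transpose_mul)
  qed
  moreover have "smooth_on (snd c' ` (fst c' \<inter> chart_inv c ` N)) (\<lambda>y. lift c H (chart_inv c' y) c')"
    if c': "c' \<in> A" for c'
  proof -
    define S where "S = snd c' ` (fst c' \<inter> chart_inv c ` N)"
    have S: "open S" unfolding S_def
      by (intro open_chart_image open_Int chart(1) open_chart_inv_image c c' N N' Int_lower1)
    define \<phi> where "\<phi> y = snd c (chart_inv c' y)" for y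
    have \<phi>: "smooth_on S \<phi>"
      unfolding \<phi>_def[abs_def] S_def
      by (rule smooth_on_subset[OF transition_smooth[OF c' c]]) (use zN in auto)
    have "\<phi> ` S \<subseteq> N"
      using zN by (auto simp: \<phi>_def S_def chart_inv_chart[OF c'])
    then have "smooth_on S (\<lambda>y. transpose (jacobian \<phi> (at y)) ** H (\<phi> y) ** jacobian \<phi> (at y))"
      by (intro smooth_on_matrix_mult[OF S] smooth_on_transpose[OF S] smooth_on_jacobian[OF S \<phi>]
          smooth_on_compose[OF S \<phi> N'(2)])
    moreover have "lift c H (chart_inv c' y) c' = transpose (jacobian \<phi> (at y)) ** H (\<phi> y) ** jacobian \<phi> (at y)"
      if "y \<in> S" for y
    proof -
      have "snd c' (chart_inv c' y) = y" using that by (auto simp: S_def chart_inv_chart[OF c'])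
      then show ?thesis by (simp add: lift_def tangent_matrix_id \<phi>_def[abs_def])
    qed
    moreover have "smooth_on S (\<lambda>y. lift c H (chart_inv c' y) c') \<longleftrightarrow>
        smooth_on S (\<lambda>y. transpose (jacobian \<phi> (at y)) ** H (\<phi> y) ** jacobian \<phi> (at y))"
      by (rule smooth_on_cong[OF S]) fact
    ultimately show ?thesis
      unfolding S_def[symmetric] by blast
  qed
  ultimately show ?thesis unfolding metrics_on_def by blast
qed

lemma metric_in_chart:
  assumes "c \<in> A" "open U" "g \<in> metrics_on A r s U"
  shows "local_metric r s (snd c ` (fst c \<inter> U)) (\<lambda>y. g (chart_inv c y) c)"
proof -
  have "open (snd c ` (fst c \<inter> U))"
    by (intro open_chart_image open_Int chart(1) assms Int_lower1)
  moreover have "c \<in> charts_at A (chart_inv c y) \<and> chart_inv c y \<in> U" if "y \<in> snd c ` (fst c \<inter> U)" for y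
    using that assms(1) chart_inv_chart[OF assms(1)] by (auto simp: charts_at_def)
  ultimately show ?thesis
    using assms unfolding local_metric_def metrics_on_def by auto
qed

lemma jet2_of_chart:
  assumes "c \<in> A" "x \<in> fst c"
  shows "snd (jet2_of A g x) c = jet_at (\<lambda>y. g (chart_inv c y) c) (snd c x)"
proof -
  have "pdiff c k (pdiff c l (\<lambda>z. g z c $ i $ j)) x
      = pd k (pd l (\<lambda>y. g (chart_inv c y) c $ i $ j)) (snd c x)" for k l i j
  proof -
    have "pd k (\<lambda>y. pd l (\<lambda>y. g (chart_inv c y) c $ i $ j) (snd c (chart_inv c y))) (snd c x)
        = pd k (pd l (\<lambda>y. g (chart_inv c y) c $ i $ j)) (snd c x)"
      by (rule pd_cong[OF chart(3)[OF assms(1)]]) (use assms chart_chart_inv[OF assms(1)] in auto)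
    then show ?thesis by (simp add: pdiff_def pd_def)
  qed
  moreover have "pdiff c k (\<lambda>z. g z c $ i $ j) x = pd k (\<lambda>y. g (chart_inv c y) c $ i $ j) (snd c x)" for k i j
    by (simp add: pdiff_def pd_def)
  ultimately show ?thesis
    using assms by (simp add: jet2_of_def jet_at_def charts_at_def chart_inv_chart)
qed

lemma jet2_of_lift:
  assumes "c \<in> A" "x \<in> fst c"
  shows "snd (jet2_of A (lift c H) x) c = jet_at H (snd c x)"
  unfolding jet2_of_chart[OF assms]
  by (rule jet_at_cong[OF chart(3)[OF assms(1)]])
    (use assms in \<open>auto simp: chart_inv_chart lift_same\<close>)

text \<open>
  The two metrics have the same jet in a chart iff the difference of their components vanishes to
  order 3, a condition that survives changes of coordinates and linear combinations.
\<close>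

lemma jet2_determined:
  assumes U: "open U" "g \<in> metrics_on A r s U" and U': "open U'" "g' \<in> metrics_on A r s U'"
    and x: "x \<in> U" "x \<in> U'" and c: "c \<in> charts_at A x"
    and eq: "snd (jet2_of A g x) c = snd (jet2_of A g' x) c"
  shows "jet2_of A g x = jet2_of A g' x"
proof -
  have cA: "c \<in> A" "x \<in> fst c" using c by (auto simp: charts_at_def)
  define V where "V = U \<inter> U'"
  have V: "open V" "x \<in> V" using U U' x by (auto simp: V_def)
  define h where "h g c y = (g (chart_inv c y) c :: real^'n^'n)" for g :: "('a, 'n) metric_field" and c y
  have sm: "smooth_on (snd c ` (fst c \<inter> V)) (h g c)" "smooth_on (snd c ` (fst c \<inter> V)) (h g' c)"
    if "c \<in> A" for c
    using metric_in_chart[OF that U] metric_in_chart[OF that U']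
    unfolding local_metric_def h_def[abs_def]
    by (auto simp: V_def elim!: smooth_on_subset)
  have op: "open (snd c ` (fst c \<inter> V))" if "c \<in> A" for c
    by (intro open_chart_image open_Int chart(1) that V Int_lower1)
  have mem: "snd c x \<in> snd c ` (fst c \<inter> V)" if "x \<in> fst c" for c
    using that V by blast
  have jet: "jet_at (h g0 c0) (snd c0 x) = snd (jet2_of A g0 x) c0" if "c0 \<in> A" "x \<in> fst c0" for g0 c0
    unfolding jet2_of_chart[OF that] h_def[abs_def] ..
  have flat: "vord 3 (\<lambda>z. h g c z $ i $ j - h g' c z $ i $ j) (snd c x)" for i j
    using jet_at_eq_iff[OF op[OF cA(1)] mem[OF cA(2)] sm[OF cA(1)]] eq unfolding jet[OF cA] by blast
  have "snd (jet2_of A g x) c' = snd (jet2_of A g' x) c'" if c': "c' \<in> charts_at A x" for c'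
  proof -
    have c'A: "c' \<in> A" "x \<in> fst c'" using c' by (auto simp: charts_at_def)
    define S where "S = snd c' ` (fst c' \<inter> (fst c \<inter> V))"
    have S: "open S" unfolding S_def
      by (intro open_chart_image open_Int chart(1) c'A cA V Int_lower1)
    have xS: "snd c' x \<in> S" using c'A cA V by (auto simp: S_def)
    have Ssub: "S \<subseteq> snd c' ` (fst c' \<inter> V)" by (auto simp: S_def)
    define \<phi> where "\<phi> y = snd c (chart_inv c' y)" for y
    have \<phi>: "smooth_on S \<phi>"
      unfolding \<phi>_def[abs_def] S_def
      by (rule smooth_on_subset[OF transition_smooth[OF c'A(1) cA(1)]]) auto
    have im: "\<phi> ` S \<subseteq> snd c ` (fst c \<inter> V)"
      by (auto simp: \<phi>_def S_def chart_inv_chart[OF c'A(1)])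
    have \<phi>x: "\<phi> (snd c' x) = snd c x" by (simp add: \<phi>_def chart_inv_chart[OF c'A])
    define M where "M y = jacobian \<phi> (at y)" for y
    have M: "smooth_on S (\<lambda>y. M y $ a $ i)" for a i
      using smooth_on_jacobian[OF S \<phi>] unfolding M_def[abs_def] smooth_on_matrix[OF S] by blast
    have trans: "h g0 c' y = transpose (M y) ** h g0 c (\<phi> y) ** M y"
      if "y \<in> S" "g0 \<in> metrics_on A r s U0" "V \<subseteq> U0" for y g0 U0
    proof -
      obtain z where z: "y = snd c' z" "z \<in> fst c'" "z \<in> fst c" "z \<in> V" using \<open>y \<in> S\<close> by (auto simp: S_def)
      have "metric_push A id U0 g0 g0" using that by (simp add: metrics_on_def)
      then have "g0 z c' = transpose (tangent_matrix c' c id z) ** g0 (id z) c ** tangent_matrix c' c id z"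
        unfolding metric_push_def
        by (elim ballE[of _ _ z] ballE[of _ _ c'] ballE[of _ _ c])
          (use z that(3) cA(1) c'A(1) in \<open>simp_all add: charts_at_def subset_eq\<close>)
      moreover have "tangent_matrix c' c id z = M y"
        unfolding M_def \<phi>_def[abs_def] tangent_matrix_id z(1) ..
      moreover have "h g0 c' y = g0 z c'" "h g0 c (\<phi> y) = g0 z c"
        using z cA(1) c'A(1) by (simp_all add: h_def \<phi>_def chart_inv_chart)
      ultimately show ?thesis by simp
    qed
    define D where "D a b z = h g c z $ a $ b - h g' c z $ a $ b" for a b z
    have smD: "smooth_on (snd c ` (fst c \<inter> V)) (D a b)" for a b
      using sm[OF cA(1)] unfolding smooth_on_matrix[OF op[OF cA(1)]] D_def[abs_def]
      by (intro smooth_on_diff[OF op[OF cA(1)]]) auto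
    have D: "smooth_on S (\<lambda>y. D a b (\<phi> y))" "vord 3 (\<lambda>y. D a b (\<phi> y)) (snd c' x)" for a b
    proof -
      show "smooth_on S (\<lambda>y. D a b (\<phi> y))"
        by (rule smooth_on_compose[OF S \<phi> smD im])
      show "vord 3 (\<lambda>y. D a b (\<phi> y)) (snd c' x)"
        by (rule vord_compose[OF S xS \<phi> im smD]) (use flat \<phi>x in \<open>simp add: D_def[abs_def]\<close>)
    qed
    have "vord 3 (\<lambda>y. h g c' y $ i $ j - h g' c' y $ i $ j) (snd c' x)" for i j
    proof -
      have MMD: "vord 3 (\<lambda>y. (M y$a$i * M y$b$j) * D a b (\<phi> y)) (snd c' x)"
        "smooth_on S (\<lambda>y. (M y$a$i * M y$b$j) * D a b (\<phi> y))" for a b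
        using vord_mult[OF S xS smooth_on_mult[OF S M M] D(1) _ D(2), where a = 0 and m = 3]
          smooth_on_mult[OF S smooth_on_mult[OF S M M] D(1)] by simp_all
      then have "vord 3 (\<lambda>y. \<Sum>b\<in>UNIV. \<Sum>a\<in>UNIV. (M y$a$i * M y$b$j) * D a b (\<phi> y)) (snd c' x)"
        by (intro vord_sum[OF S xS] smooth_on_sum[OF S] MMD)
      moreover have "h g c' y $ i $ j - h g' c' y $ i $ j
          = (\<Sum>b\<in>UNIV. \<Sum>a\<in>UNIV. (M y$a$i * M y$b$j) * D a b (\<phi> y))" if "y \<in> S" for y
        unfolding trans[OF that U(2), unfolded V_def, OF Int_lower1] trans[OF that U'(2), unfolded V_def, OF Int_lower2]
          congruence_nth D_def right_diff_distrib sum_subtractf ..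
      ultimately show ?thesis
        using vord_cong[OF S xS, of "\<lambda>y. h g c' y $ i $ j - h g' c' y $ i $ j"
            "\<lambda>y. \<Sum>b\<in>UNIV. \<Sum>a\<in>UNIV. (M y$a$i * M y$b$j) * D a b (\<phi> y)"] by blast
    qed
    then show ?thesis
      unfolding jet[OF c'A, symmetric]
      using jet_at_eq_iff[OF S xS smooth_on_subset[OF sm(1)[OF c'A(1)] Ssub] smooth_on_subset[OF sm(2)[OF c'A(1)] Ssub]]
      by blast
  qed
  moreover have "snd (jet2_of A g x) c' = snd (jet2_of A g' x) c'" if "c' \<notin> charts_at A x" for c'
    using that by (simp add: jet2_of_def)
  ultimately have "snd (jet2_of A g x) = snd (jet2_of A g' x)" by blast
  then show ?thesis by (simp add: prod_eq_iff jet2_of_def)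
qed

text \<open>The base point is recovered because charts are injective, the rest by
  \<open>jet2_determined\<close>. Thus the \<open>inv_into\<close> in \<open>tensor_morphism\<close>
  is a true inverse.\<close>

lemma jet2_coords_inj: "c \<in> A \<Longrightarrow> inj_on (jet2_coords c) (jet2_over A r s c)"
proof (rule inj_onI)
  fix z z' assume c: "c \<in> A" and z: "z \<in> jet2_over A r s c" "z' \<in> jet2_over A r s c"
    "jet2_coords c z = jet2_coords c z'"
  obtain g x U where g: "z = jet2_of A g x" "open U" "x \<in> U" "g \<in> metrics_on A r s U" "x \<in> fst c"
    using z(1) by (auto simp: jet2_over_def jet2_bundle_def jet2_of_def)
  obtain g' x' U' where g': "z' = jet2_of A g' x'" "open U'" "x' \<in> U'" "g' \<in> metrics_on A r s U'" "x' \<in> fst c"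
    using z(2) by (auto simp: jet2_over_def jet2_bundle_def jet2_of_def)
  have "snd c x = snd c x'" and eq: "snd z c = snd z' c"
    using z(3) by (auto simp: jet2_coords_def g(1) g'(1) jet2_of_def)
  then have "x = x'" using chart(2)[OF c] g(5) g'(5) by (auto dest: inj_onD)
  then show "z = z'"
    using jet2_determined[OF g(2,4) g'(2,4) g(3)] g'(1,3) g(1,5) c eq by (simp add: charts_at_def)
qed

section \<open>Coordinate maps as local diffeomorphisms of the manifold\<close>

lemma chart_inv_homeomorphism:
  assumes "c \<in> A" "U \<subseteq> snd c ` fst c"
  shows "homeomorphism (chart_inv c ` U) U (snd c) (chart_inv c)"
proof (rule homeomorphism_of_subsets[OF chart(4)[OF assms(1)] _ assms(2)])
  show "chart_inv c ` U \<subseteq> fst c" using chart_chart_inv(2)[OF assms(1)] assms(2) by auto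
  show "snd c ` chart_inv c ` U = U"
    using chart_chart_inv(1)[OF assms(1)] assms(2) by (force simp: image_image)
qed

lemma chart_map_homeomorphism:
  assumes "c \<in> A" "U \<subseteq> snd c ` fst c" "V \<subseteq> snd c ` fst c" "homeomorphism U V T S"
  shows "homeomorphism (chart_inv c ` U) (chart_inv c ` V)
    (\<lambda>z. chart_inv c (T (snd c z))) (\<lambda>z. chart_inv c (S (snd c z)))"
  using homeomorphism_compose[OF homeomorphism_compose[OF chart_inv_homeomorphism[OF assms(1,2)] assms(4)]
      homeomorphism_symD[OF chart_inv_homeomorphism[OF assms(1,3)]]]
  by (simp add: o_def)

text \<open>The second conclusion supplies the open set on which
  \<open>tangent_matrix_compose\<close> may insert a chart after the map.\<close>

lemma chart_map_smooth:
  assumes c: "c \<in> A" and U: "open U" "U \<subseteq> snd c ` fst c" and T: "smooth_on U T" "T ` U \<subseteq> snd c ` fst c"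
    and cont: "continuous_on (chart_inv c ` U) (\<lambda>z. chart_inv c (T (snd c z)))"
  shows "smooth_map A (chart_inv c ` U) (\<lambda>z. chart_inv c (T (snd c z)))"
    "c1 \<in> A \<Longrightarrow> c2 \<in> A \<Longrightarrow>
      open (snd c1 ` {z \<in> fst c1 \<inter> chart_inv c ` U. chart_inv c (T (snd c z)) \<in> fst c2})"
proof -
  define \<tau> where "\<tau> z = chart_inv c (T (snd c z))" for z
  have op: "open (snd c1 ` {z \<in> fst c1 \<inter> chart_inv c ` U. \<tau> z \<in> fst c2})" if "c1 \<in> A" "c2 \<in> A" for c1 c2
  proof (rule open_chart_image[OF that(1)])
    have "open ((fst c1 \<inter> chart_inv c ` U) \<inter> \<tau> -` fst c2)"
    proof (rule continuous_open_preimage)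
      show "continuous_on (fst c1 \<inter> chart_inv c ` U) \<tau>"
        unfolding \<tau>_def[abs_def] by (rule continuous_on_subset[OF cont]) auto
    qed (intro open_Int chart(1) that open_chart_inv_image c U)+
    also have "(fst c1 \<inter> chart_inv c ` U) \<inter> \<tau> -` fst c2 = {z \<in> fst c1 \<inter> chart_inv c ` U. \<tau> z \<in> fst c2}"
      by auto
    finally show "open {z \<in> fst c1 \<inter> chart_inv c ` U. \<tau> z \<in> fst c2}" .
  qed auto
  have "smooth_on (snd c1 ` {z \<in> fst c1 \<inter> chart_inv c ` U. \<tau> z \<in> fst c2}) (\<lambda>y. snd c2 (\<tau> (chart_inv c1 y)))"
    if c12: "c1 \<in> A" "c2 \<in> A" for c1 c2
  proof -
    define D where "D = snd c1 ` {z \<in> fst c1 \<inter> chart_inv c ` U. \<tau> z \<in> fst c2}"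
    have D: "open D" unfolding D_def by (rule op[OF c12])
    have zU: "snd c z \<in> U" "z \<in> fst c" if "z \<in> chart_inv c ` U" for z
      using that U(2) chart_chart_inv[OF c] by auto
    have 1: "smooth_on D (\<lambda>y. snd c (chart_inv c1 y))"
      by (rule smooth_on_subset[OF transition_smooth[OF c12(1) c]]) (use zU in \<open>auto simp: D_def\<close>)
    have im1: "(\<lambda>y. snd c (chart_inv c1 y)) ` D \<subseteq> U"
      using zU(1) by (auto simp: D_def chart_inv_chart[OF c12(1)])
    have 2: "smooth_on D (\<lambda>y. T (snd c (chart_inv c1 y)))"
      by (rule smooth_on_compose[OF D 1 T(1) im1])
    have "smooth_on D (\<lambda>y. (\<lambda>y. snd c2 (chart_inv c y)) (T (snd c (chart_inv c1 y))))"
    proof (rule smooth_on_compose[OF D 2 transition_smooth[OF c c12(2)]], safe)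
      fix y assume "y \<in> D"
      then obtain z where z: "y = snd c1 z" "z \<in> fst c1" "z \<in> chart_inv c ` U" "\<tau> z \<in> fst c2"
        by (auto simp: D_def)
      have TU: "T (snd c z) \<in> snd c ` fst c" using zU(1)[OF z(3)] T(2) by auto
      then have "T (snd c z) = snd c (\<tau> z)" "\<tau> z \<in> fst c"
        using chart_chart_inv[OF c TU] by (simp_all add: \<tau>_def)
      then show "T (snd c (chart_inv c1 y)) \<in> snd c ` (fst c \<inter> fst c2)"
        using z by (auto simp: chart_inv_chart[OF c12(1)])
    qed
    then show ?thesis by (simp add: D_def \<tau>_def)
  qed
  then show "smooth_map A (chart_inv c ` U) (\<lambda>z. chart_inv c (T (snd c z)))"
    unfolding smooth_map_def \<tau>_def[abs_def, symmetric] using cont by (simp add: \<tau>_def[abs_def])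
  show "c1 \<in> A \<Longrightarrow> c2 \<in> A \<Longrightarrow>
      open (snd c1 ` {z \<in> fst c1 \<inter> chart_inv c ` U. chart_inv c (T (snd c z)) \<in> fst c2})"
    using op by (simp add: \<tau>_def)
qed

end


section \<open>Components of a natural tensor in a chart\<close>

locale natural_tensor = atlas A
  for A :: "('a::{t2_space,second_countable_topology}, 'n::finite) chart set" +
  fixes r s p :: nat and \<omega> :: "('a, 'n) jet2 \<Rightarrow> ('a, 'n) tensor" and c :: "('a, 'n) chart" and x :: 'a
  assumes tensor: "tensor_morphism A r s p \<omega>" and natural: "natural A r s p \<omega>"
    and chart_at: "c \<in> charts_at A x"
begin

abbreviation "Oc \<equiv> snd c ` fst c"

definition "y0 = snd c x"

definition near_metric :: "(real^'n \<Rightarrow> real^'n^'n) \<Rightarrow> bool" where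
  "near_metric H \<longleftrightarrow> (\<exists>N. y0 \<in> N \<and> N \<subseteq> Oc \<and> local_metric r s N H)"

definition component :: "(real^'n \<Rightarrow> real^'n^'n) \<Rightarrow> 'n list \<Rightarrow> real" where
  "component H I = \<omega> (jet2_of A (lift c H) x) c I"

lemma c: "c \<in> A" "x \<in> fst c"
  using chart_at by (auto simp: charts_at_def)

lemma base: "y0 \<in> Oc" "chart_inv c y0 = x"
  using c by (auto simp: y0_def chart_inv_chart)

lemma near_metricE:
  assumes "near_metric H"
  obtains N where "open N" "y0 \<in> N" "N \<subseteq> Oc" "local_metric r s N H" "smooth_on N H"
    "open (chart_inv c ` N)" "x \<in> chart_inv c ` N" "lift c H \<in> metrics_on A r s (chart_inv c ` N)"
proof -
  obtain N where N: "y0 \<in> N" "N \<subseteq> Oc" "local_metric r s N H"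
    using assms by (auto simp: near_metric_def)
  have "x \<in> chart_inv c ` N" using N(1) base by (metis imageI)
  then show thesis
    using that[of N] N lift_metric[OF c(1) N(2,3)] open_chart_inv_image[OF c(1) _ N(2)]
    by (auto simp: local_metric_def)
qed

lemma jet_lift_over:
  assumes "N \<subseteq> Oc" "local_metric r s N H" "y \<in> N"
  shows "jet2_of A (lift c H) (chart_inv c y) \<in> jet2_over A r s c"
    "jet2_coords c (jet2_of A (lift c H) (chart_inv c y)) = (y, jet_at H y)"
proof -
  have "open (chart_inv c ` N)"
    using assms by (intro open_chart_inv_image c) (auto simp: local_metric_def)
  moreover have z: "snd c (chart_inv c y) = y" "chart_inv c y \<in> fst c"
    using chart_chart_inv[OF c(1)] assms by auto
  ultimately show "jet2_of A (lift c H) (chart_inv c y) \<in> jet2_over A r s c"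
    using lift_metric[OF c(1) assms(1,2)] assms(3)
    unfolding jet2_over_def jet2_bundle_def by (auto simp: jet2_of_def)
  show "jet2_coords c (jet2_of A (lift c H) (chart_inv c y)) = (y, jet_at H y)"
    using jet2_of_lift[OF c(1) z(2), of H] z by (simp add: jet2_coords_def jet2_of_def)
qed

lemma jet_cong:
  assumes "near_metric H" "near_metric H'" "jet_at H y0 = jet_at H' y0"
  shows "jet2_of A (lift c H) x = jet2_of A (lift c H') x"
proof -
  obtain N where N: "open (chart_inv c ` N)" "x \<in> chart_inv c ` N" "lift c H \<in> metrics_on A r s (chart_inv c ` N)"
    using near_metricE[OF assms(1)] by blast
  obtain N' where N': "open (chart_inv c ` N')" "x \<in> chart_inv c ` N'" "lift c H' \<in> metrics_on A r s (chart_inv c ` N')"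
    using near_metricE[OF assms(2)] by blast
  show ?thesis
    by (rule jet2_determined[OF N(1,3) N'(1,3) N(2) N'(2) chart_at])
      (use jet2_of_lift[OF c] assms(3) in \<open>simp add: y0_def\<close>)
qed

lemma component_cong:
  assumes "near_metric H" "near_metric H'" "jet_at H y0 = jet_at H' y0"
  shows "component H I = component H' I"
  unfolding component_def jet_cong[OF assms] ..

lemma vord_jet_eq:
  assumes "near_metric H" "near_metric H'" "\<And>i j. vord 3 (\<lambda>y. H y $ i $ j - H' y $ i $ j) y0"
  shows "jet_at H y0 = jet_at H' y0"
proof -
  obtain N where N: "open N" "y0 \<in> N" "smooth_on N H" using near_metricE[OF assms(1)] by blast
  obtain N' where N': "open N'" "y0 \<in> N'" "smooth_on N' H'" using near_metricE[OF assms(2)] by blast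
  show ?thesis
    using jet_at_eq_iff[of "N \<inter> N'" y0 H H'] assms(3) N N'
      smooth_on_subset[OF N(3), of "N \<inter> N'"] smooth_on_subset[OF N'(3), of "N \<inter> N'"]
    by (simp add: open_Int)
qed

lemma component_permute:
  assumes "near_metric H" "length I = p" "\<pi> permutes {..<p}"
  shows "component H (permute_list \<pi> I) = of_int (sign \<pi>) * component H I"
proof -
  obtain N where N: "y0 \<in> N" "N \<subseteq> Oc" "local_metric r s N H"
    using assms(1) by (auto simp: near_metric_def)
  have "jet2_of A (lift c H) x \<in> jet2_bundle A r s"
    using jet_lift_over(1)[OF N(2,3,1)] base by (simp add: jet2_over_def)
  then have "\<omega> (jet2_of A (lift c H) x) \<in> p_vectors A p x"
    using tensor by (auto simp: tensor_morphism_def jet2_of_def)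
  then show ?thesis
    using assms(2,3) unfolding p_vectors_def component_def by blast
qed

text \<open>The transposition of the two positions of \<open>k\<close> fixes the multi-index but has
  sign -1.\<close>

lemma component_repeated:
  assumes "near_metric H" "Suc (length J) = p" "k \<in> set J"
  shows "component H (J @ [k]) = 0"
proof -
  obtain i where i: "i < length J" "J ! i = k" using assms(3) by (auto simp: in_set_conv_nth)
  define \<pi> where "\<pi> = Transposition.transpose i (length J)"
  have \<pi>: "\<pi> permutes {..<p}"
    unfolding \<pi>_def using i(1) assms(2) by (intro permutes_swap_id) auto
  have "permute_list \<pi> (J @ [k]) = J @ [k]"
  proof (rule nth_equalityI)
    fix m assume "m < length (permute_list \<pi> (J @ [k]))"
    then have m: "m < Suc (length J)" by simp
    then have "permute_list \<pi> (J @ [k]) ! m = (J @ [k]) ! \<pi> m"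
      using \<pi> assms(2) by (intro permute_list_nth) auto
    also have "\<dots> = (J @ [k]) ! m"
      using i by (cases "m = i"; cases "m = length J") (auto simp: \<pi>_def nth_append Transposition.transpose_def)
    finally show "permute_list \<pi> (J @ [k]) ! m = (J @ [k]) ! m" .
  qed simp
  moreover have "sign \<pi> = -1" using i(1) by (simp add: \<pi>_def sign_swap_id)
  ultimately show ?thesis
    using component_permute[OF assms(1) _ \<pi>, of "J @ [k]"] assms(2) by simp
qed

text \<open>Jet coordinates do not fill an open set, as arrays of derivatives are symmetric.
  \<open>F\<close> extends the component smoothly to an open subset of the ambient space, and
  derivatives are taken through it.\<close>

definition extends where
  "extends I W F \<longleftrightarrow> open W \<and> smooth_on W F \<and>
     (\<forall>z\<in>jet2_over A r s c. jet2_coords c z \<in> W \<longrightarrow> \<omega> z c I = F (jet2_coords c z))"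

lemma extension_at:
  assumes "near_metric H" "length I = p"
  shows "\<exists>W F. extends I W F \<and> (y0, jet_at H y0) \<in> W"
proof -
  obtain N where N: "y0 \<in> N" "N \<subseteq> Oc" "local_metric r s N H"
    using assms(1) by (auto simp: near_metric_def)
  have "smooth_on_subset (jet2_coords c ` jet2_over A r s c)
          (\<lambda>v. \<omega> (inv_into (jet2_over A r s c) (jet2_coords c) v) c I)"
    using tensor c(1) assms(2) by (simp add: tensor_morphism_def)
  from this[unfolded smooth_on_subset_def, rule_format, OF imageI[OF jet_lift_over(1)[OF N(2,3,1)]]]
  obtain W F where W: "open W" "(y0, jet_at H y0) \<in> W" "smooth_on W F"
    "\<And>v. v \<in> W \<inter> jet2_coords c ` jet2_over A r s c \<Longrightarrow>
      F v = \<omega> (inv_into (jet2_over A r s c) (jet2_coords c) v) c I"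
    unfolding jet_lift_over(2)[OF N(2,3,1)] by blast
  have "\<omega> z c I = F (jet2_coords c z)" if "z \<in> jet2_over A r s c" "jet2_coords c z \<in> W" for z
    using W(4)[of "jet2_coords c z"] inv_into_f_f[OF jet2_coords_inj[OF c(1)]] that by simp
  then show ?thesis unfolding extends_def using W(1-3) by blast
qed

text \<open>Naturality for the diffeomorphism that \<open>T\<close> induces near \<open>x\<close>
  through the chart \<open>c\<close>, with \<open>G\<close> the pullback of \<open>H\<close>. As it
  fixes \<open>x\<close>, both sides are components at \<open>x\<close>.\<close>

theorem component_natural:
  assumes H: "near_metric H" and N: "open N" "y0 \<in> N" and T: "smooth_on N T" "T y0 = y0"
    and det: "det (jacobian T (at y0)) \<noteq> 0"
    and G: "G = (\<lambda>y. transpose (jacobian T (at y)) ** H (T y) ** jacobian T (at y))"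
  shows "near_metric G"
    and "length J = p \<Longrightarrow> component H J =
      (\<Sum>I | length I = p. (\<Prod>m<p. jacobian T (at y0) $ (J ! m) $ (I ! m)) * component G I)"
proof -
  obtain NH where NH: "open NH" "y0 \<in> NH" "NH \<subseteq> Oc" "local_metric r s NH H" "smooth_on NH H"
    using near_metricE[OF H] by blast
  \<comment> \<open>\<open>T\<close> is inverted inside the region where \<open>H\<close> is a
    metric, so that \<open>G\<close> is a metric on \<open>U\<close> and \<open>H\<close> one on
    \<open>V\<close>.\<close>
  obtain U V S where S: "open U" "open V" "y0 \<in> U" "U \<subseteq> N \<inter> NH" "V \<subseteq> N \<inter> NH" "homeomorphism U V T S"
    "smooth_on V S" "\<And>z. z \<in> U \<Longrightarrow> det (jacobian T (at z)) \<noteq> 0"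
    by (rule local_inverse[of "N \<inter> NH" y0 T])
      (use N NH T det smooth_on_subset[OF T(1), of "N \<inter> NH"] in \<open>auto simp: open_Int\<close>)
  have TU: "T ` U = V" and SV: "S ` V = U" using S(6) by (auto simp: homeomorphism_def)
  have sub: "U \<subseteq> Oc" "V \<subseteq> Oc" using S NH by auto
  have Tsm: "smooth_on U T" by (rule smooth_on_subset[OF T(1)]) (use S in auto)
  have HV: "local_metric r s V H"
    using NH(4) S(2,5) smooth_on_subset[OF NH(5), of V] by (auto simp: local_metric_def)
  have GU: "local_metric r s U G"
    unfolding local_metric_def
  proof (intro conjI ballI)
    show "smooth_on U G"
      unfolding G using S NH TU
      by (intro smooth_on_matrix_mult smooth_on_transpose smooth_on_jacobian smooth_on_compose[OF _ Tsm NH(5)] Tsm) auto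
    fix y assume y: "y \<in> U"
    then have "T y \<in> NH" using TU S by auto
    then have "transpose (H (T y)) = H (T y)" "has_signature r s (H (T y))"
      using NH(4) by (auto simp: local_metric_def)
    then show "transpose (G y) = G y" "has_signature r s (G y)"
      unfolding G using S(8)[OF y]
      by (auto intro: transpose_congruence has_signature_congruence simp: invertible_det_nz)
  qed (rule S(1))
  show "near_metric G"
    unfolding near_metric_def using GU S(3) sub(1) by blast
  define \<tau> where "\<tau> z = chart_inv c (T (snd c z))" for z
  define \<sigma> where "\<sigma> z = chart_inv c (S (snd c z))" for z
  define UX where "UX = chart_inv c ` U"
  define VX where "VX = chart_inv c ` V"
  have opX: "open UX" "open VX"
    unfolding UX_def VX_def by (intro open_chart_inv_image c S sub)+
  have hom: "homeomorphism UX VX \<tau> \<sigma>"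
    unfolding UX_def VX_def \<tau>_def[abs_def] \<sigma>_def[abs_def]
    by (rule chart_map_homeomorphism[OF c(1) sub S(6)])
  have cont: "continuous_on UX \<tau>" "continuous_on VX \<sigma>" using hom by (auto simp: homeomorphism_def)
  have smU: "smooth_map A UX \<tau>"
    and opU: "\<And>c1 c2. c1 \<in> A \<Longrightarrow> c2 \<in> A \<Longrightarrow> open (snd c1 ` {z \<in> fst c1 \<inter> UX. \<tau> z \<in> fst c2})"
    using chart_map_smooth[OF c(1) S(1) sub(1) Tsm] cont(1) sub(2) TU
    unfolding UX_def \<tau>_def[abs_def] by auto
  have smV: "smooth_map A VX \<sigma>"
    using chart_map_smooth(1)[OF c(1) S(2) sub(2) S(7)] cont(2) sub(1) SV
    unfolding VX_def \<sigma>_def[abs_def] by auto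
  have diffeo: "local_diffeo A UX VX \<tau>"
    unfolding local_diffeo_def using opX hom smU smV by blast
  have zU: "snd c z \<in> U" "z \<in> fst c" if "z \<in> UX" for z
    using that sub(1) chart_chart_inv[OF c(1)] by (auto simp: UX_def)
  have \<tau>z: "snd c (\<tau> z) = T (snd c z)" "\<tau> z \<in> fst c" if "z \<in> UX" for z
  proof -
    have "T (snd c z) \<in> Oc" using zU(1)[OF that] TU sub(2) by auto
    then show "snd c (\<tau> z) = T (snd c z)" "\<tau> z \<in> fst c"
      unfolding \<tau>_def using chart_chart_inv[OF c(1)] by auto
  qed
  have tcc: "tangent_matrix c c \<tau> z = jacobian T (at (snd c z))" if "z \<in> UX" for z
    unfolding tangent_matrix_def
  proof (rule jacobian_cong[OF S(1) zU(1)[OF that]])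
    fix y assume y: "y \<in> U"
    then have "chart_inv c y \<in> UX" "snd c (chart_inv c y) = y"
      using sub(1) chart_chart_inv[OF c(1)] by (auto simp: UX_def)
    then show "snd c (\<tau> (chart_inv c y)) = T y" using \<tau>z(1) by simp
  qed
  have diff\<tau>: "(\<lambda>y. snd c2 (\<tau> (chart_inv c1 y))) differentiable (at (snd c1 z))"
    if "c1 \<in> A" "c2 \<in> A" "z \<in> fst c1" "z \<in> UX" "\<tau> z \<in> fst c2" for c1 c2 z
    using smU that unfolding smooth_map_def
    by (intro smooth_on_differentiable[of "snd c1 ` {z \<in> fst c1 \<inter> UX. \<tau> z \<in> fst c2}"]) auto
  have diffid: "(\<lambda>y. snd c2 (id (chart_inv c1 y))) differentiable (at (snd c1 z))"
    if "c1 \<in> A" "c2 \<in> A" "z \<in> fst c1" "z \<in> fst c2" for c1 c2 z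
    using smooth_on_differentiable[OF transition_smooth[OF that(1,2)]] that by auto
  have push: "metric_push A \<tau> UX (lift c G) (lift c H)"
    unfolding metric_push_def
  proof (intro ballI)
    fix z c1 c2 assume z: "z \<in> UX" and "c1 \<in> charts_at A z" "c2 \<in> charts_at A (\<tau> z)"
    then have c12: "c1 \<in> A" "z \<in> fst c1" "c2 \<in> A" "\<tau> z \<in> fst c2" by (auto simp: charts_at_def)
    define M1 where "M1 = tangent_matrix c1 c id z"
    define M2 where "M2 = tangent_matrix c2 c id (\<tau> z)"
    define K where "K = tangent_matrix c1 c2 \<tau> z"
    define J where "J = jacobian T (at (snd c z))"
    \<comment> \<open>Both \<open>M2 ** K\<close> and \<open>J ** M1\<close> are the tangent matrix
      of \<open>\<tau>\<close> from \<open>c1\<close> to \<open>c\<close>; this reduces the law for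
      arbitrary charts to the definition of \<open>G\<close> in \<open>c\<close>.\<close>
    have "M2 ** K = tangent_matrix c1 c (\<lambda>z. id (\<tau> z)) z"
      unfolding M2_def K_def
    proof (rule tangent_matrix_compose[OF c12(1,3,2) opU[OF c12(1,3)]])
      show "(\<lambda>y. snd c (id (chart_inv c2 y))) differentiable at (snd c2 (\<tau> z))"
        by (rule diffid[OF c12(3) c(1) c12(4) \<tau>z(2)[OF z]])
    qed (use diff\<tau> c12 z in \<open>auto simp: chart_inv_chart[OF c12(1)]\<close>)
    moreover have "J ** M1 = tangent_matrix c1 c (\<lambda>z. \<tau> (id z)) z"
    proof -
      have "tangent_matrix c c \<tau> (id z) ** tangent_matrix c1 c id z = tangent_matrix c1 c (\<lambda>z. \<tau> (id z)) z"
      proof (rule tangent_matrix_compose[OF c12(1) c(1) c12(2)])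
        show "open (snd c1 ` (fst c1 \<inter> fst c))"
          by (intro open_chart_image open_Int chart(1) c c12 Int_lower1)
        show "(\<lambda>y. snd c (id (chart_inv c1 y))) differentiable at (snd c1 z)"
          by (rule diffid[OF c12(1) c(1) c12(2) zU(2)[OF z]])
        show "(\<lambda>y. snd c (\<tau> (chart_inv c y))) differentiable at (snd c (id z))"
          using diff\<tau>[OF c(1) c(1) zU(2)[OF z] z \<tau>z(2)[OF z]] by simp
      qed (use c12 zU(2)[OF z] in \<open>auto simp: chart_inv_chart[OF c12(1)]\<close>)
      then show ?thesis by (simp add: tcc[OF z] J_def M1_def)
    qed
    ultimately have KJ: "M2 ** K = J ** M1" by simp
    have "lift c G z c1 = transpose M1 ** (transpose J ** H (T (snd c z)) ** J) ** M1"
      by (simp add: lift_def M1_def J_def G)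
    also have "\<dots> = transpose (J ** M1) ** H (T (snd c z)) ** (J ** M1)"
      by (simp add: matrix_mul_assoc matrix_transpose_mul)
    also have "\<dots> = transpose K ** (transpose M2 ** H (T (snd c z)) ** M2) ** K"
      unfolding KJ[symmetric] by (simp add: matrix_mul_assoc matrix_transpose_mul)
    finally show "lift c G z c1 = transpose (tangent_matrix c1 c2 \<tau> z) ** lift c H (\<tau> z) c2 ** tangent_matrix c1 c2 \<tau> z"
      by (simp add: lift_def[of c H] M2_def K_def \<tau>z(1)[OF z])
  qed
  have xU: "x \<in> UX" using S(3) base(2) by (force simp: UX_def)
  have \<tau>x: "\<tau> x = x" using T(2) base(2) by (simp add: \<tau>_def y0_def)
  have "\<tau> ` UX = VX" using hom by (simp add: homeomorphism_def)
  then have "tensor_push A p \<tau> x (\<omega> (jet2_of A (lift c G) x)) (\<omega> (jet2_of A (lift c H) (\<tau> x)))"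
    using natural diffeo opX(1) xU push lift_metric[OF c(1) sub(1) GU] lift_metric[OF c(1) sub(2) HV]
    unfolding natural_def UX_def[symmetric] VX_def[symmetric] by blast
  then show "length J = p \<Longrightarrow> component H J =
      (\<Sum>I | length I = p. (\<Prod>m<p. jacobian T (at y0) $ (J ! m) $ (I ! m)) * component G I)"
    unfolding tensor_push_def using chart_at tcc[OF xU] by (simp add: \<tau>x component_def y0_def)
qed

lemma component_linear:
  fixes P :: "real^'n^'n"
  assumes H: "near_metric H" and P: "invertible P"
  defines "G \<equiv> (\<lambda>y. transpose P ** H (y0 + P *v (y - y0)) ** P)"
  shows "near_metric G"
    and "length J = p \<Longrightarrow>
      component H J = (\<Sum>I | length I = p. (\<Prod>m<p. P $ (J ! m) $ (I ! m)) * component G I)"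
proof -
  define T where "T y = y0 + P *v (y - y0)" for y
  have T_eq: "T = (\<lambda>y. (y0 - P *v y0) + P *v y)"
    by (simp add: fun_eq_iff T_def matrix_vector_mult_diff_distrib)
  have deriv: "(T has_derivative (\<lambda>v. 0 + P *v v)) (at y)" for y
    unfolding T_eq by (intro has_derivative_add has_derivative_const has_derivative_ident
        bounded_linear.has_derivative[OF matrix_vector_mul_bounded_linear])
  have jac: "jacobian T (at y) = P" for y
    using jacobian_eqI[OF deriv] by simp
  have T: "smooth_on UNIV T"
    unfolding T_eq
    by (intro smooth_on_add smooth_on_const smooth_on_linear matrix_vector_mul_bounded_linear open_UNIV)
  have det: "det (jacobian T (at y0)) \<noteq> 0" unfolding jac using P by (simp add: invertible_det_nz)
  have "T y0 = y0" by (simp add: T_def)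
  note nat = component_natural[OF H open_UNIV UNIV_I T this det refl]
  show "near_metric G"
    "length J = p \<Longrightarrow> component H J = (\<Sum>I | length I = p. (\<Prod>m<p. P $ (J ! m) $ (I ! m)) * component G I)"
    using nat unfolding jac G_def T_def by blast+
qed

end


section \<open>Matrix fields\<close>

lemma matrix_mult_scaleR_left: "(a *\<^sub>R A) ** B = a *\<^sub>R (A ** B)" for A :: "real^'n^'m" and B :: "real^'k^'n"
  by (simp add: matrix_matrix_mult_def vec_eq_iff sum_distrib_left mult.assoc)

lemma matrix_mult_scaleR_right: "A ** (a *\<^sub>R B) = a *\<^sub>R (A ** B)" for A :: "real^'n^'m" and B :: "real^'k^'n"
  by (simp add: matrix_matrix_mult_def vec_eq_iff sum_distrib_left mult.left_commute)

lemma transpose_add: "transpose (A + B) = transpose A + transpose B" for A B :: "real^'n^'m"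
  by (simp add: transpose_def vec_eq_iff)

lemma transpose_scaleR: "transpose (a *\<^sub>R A) = a *\<^sub>R transpose A" for A :: "real^'n^'m"
  by (simp add: transpose_def vec_eq_iff)

lemma matrix_add_rdistrib: "(A + B) ** C = A ** C + B ** C" for A B :: "real^'n^'m" and C :: "real^'k^'n"
  by (simp add: matrix_matrix_mult_def vec_eq_iff distrib_right sum.distrib)

lemma matrix_diff_distrib:
  "A ** (B - C) = A ** B - A ** C" "(B - C) ** D = B ** D - C ** D"
  for A :: "real^'n^'m" and B C :: "real^'k^'n" and D :: "real^'l^'k"
  by (simp_all add: matrix_matrix_mult_def vec_eq_iff right_diff_distrib left_diff_distrib sum_subtractf)

lemmas matrix_algebra = matrix_diff_distrib matrix_add_ldistrib matrix_add_rdistrib matrix_mult_scaleR_left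
  matrix_mult_scaleR_right transpose_add transpose_scaleR matrix_transpose_mul transpose_mat

lemma vord_matrix_mult:
  fixes X Y :: "real^'n \<Rightarrow> real^'n^'n"
  assumes S: "open S" "y \<in> S" and XY: "smooth_on S X" "smooth_on S Y"
    and "\<And>i j. vord a (\<lambda>z. X z $ i $ j) y" "\<And>i j. vord b (\<lambda>z. Y z $ i $ j) y" "m \<le> a + b"
  shows "vord m (\<lambda>z. (X z ** Y z) $ i $ j) y"
proof -
  have sm: "smooth_on S (\<lambda>z. X z $ i $ j)" "smooth_on S (\<lambda>z. Y z $ i $ j)" for i j
    using XY unfolding smooth_on_matrix[OF S(1)] by auto
  have "vord m (\<lambda>z. \<Sum>k\<in>UNIV. X z $ i $ k * Y z $ k $ j) y"
    by (intro vord_sum[OF S] smooth_on_mult[OF S(1)] sm vord_mult[OF S sm assms(5,6,7)])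
  then show ?thesis by (simp add: matrix_matrix_mult_def)
qed

text \<open>By the chain rule a derivative of f o T - f consists of terms containing a derivative of
  T - id, which have the right order, and of the same kind of difference for a derivative of f, to
  which the induction applies.\<close>

lemma vord_near_identity:
  fixes T :: "real^'n \<Rightarrow> real^'n"
  assumes S: "open S" "y \<in> S" and T: "smooth_on S T" "T ` S \<subseteq> W" "T y = y" and W: "S \<subseteq> W"
    and near: "\<And>l. vord m (\<lambda>z. T z $ l - z $ l) y" and f: "smooth_on W f"
  shows "vord m (\<lambda>z. f (T z) - f z) y"
  using near f
proof (induction m arbitrary: f)
  case (Suc m)
  have sT: "smooth_on S (\<lambda>z. T z $ l)" for l
    using T(1) unfolding smooth_on_vec[OF S(1)] by simp
  have sT': "smooth_on S (\<lambda>z. T z $ l - z $ l)" for l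
    by (intro smooth_on_diff[OF S(1)] sT smooth_on_component[OF S(1)])
  have fT: "smooth_on S (\<lambda>z. g (T z))" if "smooth_on W g" for g :: "real^'n \<Rightarrow> real"
    by (rule smooth_on_compose[OF S(1) T(1) that T(2)])
  have fS: "smooth_on S f" by (rule smooth_on_subset[OF Suc.prems(2) W])
  have "vord m (pd k (\<lambda>z. f (T z) - f z)) y" for k
  proof -
    have eq: "pd k (\<lambda>z. f (T z) - f z) z
        = (\<Sum>l\<in>UNIV. pd k (\<lambda>z. T z $ l - z $ l) z * pd l f (T z)) + (pd k f (T z) - pd k f z)"
      if z: "z \<in> S" for z
    proof -
      have Tz: "T z \<in> W" using T(2) z by auto
      have "pd k (\<lambda>z. T z $ l - z $ l) z = pd k (\<lambda>z. T z $ l) z - (if l = k then 1 else 0)" for l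
        using pd_diff[OF sT smooth_on_component[OF S(1)] z] by (simp add: pd_component)
      then have "(\<Sum>l\<in>UNIV. pd k (\<lambda>z. T z $ l - z $ l) z * pd l f (T z))
          = (\<Sum>l\<in>UNIV. pd k (\<lambda>z. T z $ l) z * pd l f (T z)) - (\<Sum>l\<in>UNIV. (if l = k then pd l f (T z) else 0))"
        by (simp add: left_diff_distrib sum_subtractf if_distrib[of "\<lambda>x. x * _"] cong: if_cong)
      then show ?thesis
        using pd_diff[OF fT[OF Suc.prems(2)] fS z, of k] pd_compose[OF T(1) Suc.prems(2) z Tz, of k]
        by simp
    qed
    have "vord m (\<lambda>z. (\<Sum>l\<in>UNIV. pd k (\<lambda>z. T z $ l - z $ l) z * pd l f (T z)) + (pd k f (T z) - pd k f z)) y"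
    proof (rule vord_add[OF S smooth_on_sum[OF S(1)] _ vord_sum[OF S]])
      show 1: "smooth_on S (\<lambda>z. pd k (\<lambda>z. T z $ l - z $ l) z * pd l f (T z))" for l
        by (rule smooth_on_mult[OF S(1) smooth_on_pd[OF sT'] fT[OF smooth_on_pd[OF Suc.prems(2)]]])
      then show "smooth_on S (\<lambda>z. pd k (\<lambda>z. T z $ l - z $ l) z * pd l f (T z))" for l .
      show "smooth_on S (\<lambda>z. pd k f (T z) - pd k f z)"
        by (rule smooth_on_diff[OF S(1) fT[OF smooth_on_pd[OF Suc.prems(2)]] smooth_on_pd[OF fS]])
      show "vord m (\<lambda>z. pd k (\<lambda>z. T z $ l - z $ l) z * pd l f (T z)) y" for l
        by (rule vord_mult[OF S smooth_on_pd[OF sT'] fT[OF smooth_on_pd[OF Suc.prems(2)]], where a = m and b = 0])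
          (use Suc.prems(1) in simp_all)
      show "vord m (\<lambda>z. pd k f (T z) - pd k f z) y"
        by (rule Suc.IH[OF _ smooth_on_pd[OF Suc.prems(2)]]) (rule vord_lower[OF Suc.prems(1)])
    qed
    then show ?thesis
      by (rule iffD2[OF vord_cong[OF S], rotated]) (rule eq)
  qed
  then show ?case using T(3) by simp
qed simp

lemma sum_diagonal_components:
  fixes R :: "real^'n^'n" and t :: "'n list \<Rightarrow> real"
  assumes "length J = p" "\<And>i j. i \<noteq> j \<Longrightarrow> R $ i $ j = 0"
  shows "(\<Sum>I | length I = p. (\<Prod>m<p. R $ (J ! m) $ (I ! m)) * t I) = (\<Prod>m<p. R $ (J ! m) $ (J ! m)) * t J"
proof -
  have fin: "finite {I :: 'n list. length I = p}"
    using finite_lists_length_eq[of "UNIV :: 'n set" p] by simp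
  have "(\<Sum>I | length I = p. (\<Prod>m<p. R $ (J ! m) $ (I ! m)) * t I)
      = (\<Sum>I | length I = p. if I = J then (\<Prod>m<p. R $ (J ! m) $ (J ! m)) * t J else 0)"
  proof (rule sum.cong[OF refl])
    fix I :: "'n list" assume I: "I \<in> {I. length I = p}"
    show "(\<Prod>m<p. R $ (J ! m) $ (I ! m)) * t I = (if I = J then (\<Prod>m<p. R $ (J ! m) $ (J ! m)) * t J else 0)"
    proof (cases "I = J")
      case False
      then obtain m where "m < p" "I ! m \<noteq> J ! m" using I assms(1) by (auto simp: list_eq_iff_nth_eq)
      then have "(\<Prod>m<p. R $ (J ! m) $ (I ! m)) = 0"
        by (intro prod_zero) (auto intro!: bexI[of _ m] assms(2))
      then show ?thesis using False by simp
    qed simp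
  qed
  also have "\<dots> = (\<Prod>m<p. R $ (J ! m) $ (J ! m)) * t J"
    using fin assms(1) by simp
  finally show ?thesis .
qed


section \<open>Model metrics\<close>

locale natural_tensor_normal = natural_tensor A r s p \<omega> c x
  for A :: "('a::{t2_space,second_countable_topology}, 'n::finite) chart set" and r s p \<omega> c x +
  fixes S :: "'n set"
  assumes S: "card S = r" "card (- S) = s"
begin

definition E :: "real^'n^'n" where
  "E = (\<chi> i j. if i \<noteq> j then 0 else if i \<in> S then 1 else - 1)"

lemma E_nth: "E $ i $ j = (if i = j then E $ i $ i else 0)"
  by (simp add: E_def)

lemma E_mult_nth: "(E ** X) $ i $ j = E $ i $ i * X $ i $ j"
proof -
  have "(E ** X) $ i $ j = (\<Sum>k\<in>UNIV. if k = i then E $ i $ i * X $ i $ j else 0)"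
    unfolding matrix_matrix_mult_def vec_lambda_beta by (rule sum.cong) (auto simp: E_def)
  then show ?thesis by simp
qed

lemma E_involution: "E ** E = mat 1" "E ** (E ** X) = X" "X ** E ** E = X"
proof -
  have "(E ** E) $ i $ j = mat 1 $ i $ j" for i j
    unfolding E_mult_nth by (simp add: E_def mat_def)
  then show *: "E ** E = mat 1"
    by (simp add: vec_eq_iff)
  show "E ** (E ** X) = X"
    by (simp add: matrix_mul_assoc *)
  show "X ** E ** E = X"
    by (simp add: matrix_mul_assoc[symmetric] *)
qed

lemma transpose_E: "transpose E = E"
  by (auto simp: E_def transpose_def vec_eq_iff)

lemma near_metric_E: "near_metric (\<lambda>y. E)"
proof -
  have "has_signature r s E"
    unfolding has_signature_def
  proof (rule exI, rule exI, intro conjI)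
    show "invertible (mat 1 :: real^'n^'n)" by (simp add: invertible_det_nz)
    show "transpose (mat 1) ** E ** mat 1 = (\<chi> i j. if i \<noteq> j then 0 else if i \<in> S then 1 else - 1)"
      by (simp add: transpose_mat E_def)
  qed (rule S)+
  then have "local_metric r s Oc (\<lambda>y. E)"
    unfolding local_metric_def using chart(3)[OF c(1)] by (simp add: smooth_on_const transpose_E)
  then show ?thesis unfolding near_metric_def using base(1) by blast
qed

lemma near_metric_congruence:
  assumes "near_metric H" "open N" "y0 \<in> N" "smooth_on N M" "det (M y0) \<noteq> 0"
  shows "near_metric (\<lambda>y. transpose (M y) ** H y ** M y)"
proof -
  obtain NH where NH: "open NH" "y0 \<in> NH" "NH \<subseteq> Oc" "local_metric r s NH H" "smooth_on NH H"
    using near_metricE[OF assms(1)] by blast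
  define N' where "N' = N \<inter> NH \<inter> (\<lambda>y. det (M y)) -` (- {0})"
  have NN: "open (N \<inter> NH)" using assms NH by auto
  have M: "smooth_on (N \<inter> NH) M" by (rule smooth_on_subset[OF assms(4)]) auto
  have N': "open N'"
    unfolding N'_def
    by (rule continuous_open_preimage[OF smooth_on_imp_continuous[OF smooth_on_det[OF NN M]] NN]) auto
  have sub: "N' \<subseteq> N \<inter> NH" "y0 \<in> N'" using assms NH by (auto simp: N'_def)
  have "local_metric r s N' (\<lambda>y. transpose (M y) ** H y ** M y)"
    unfolding local_metric_def
  proof (intro conjI ballI N')
    show "smooth_on N' (\<lambda>y. transpose (M y) ** H y ** M y)"
      by (intro smooth_on_matrix_mult[OF N'] smooth_on_transpose[OF N'] smooth_on_subset[OF M sub(1)]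
          smooth_on_subset[OF NH(5)]) (use sub in auto)
    fix y assume y: "y \<in> N'"
    then have "transpose (H y) = H y" "has_signature r s (H y)" "invertible (M y)"
      using NH(4) by (auto simp: local_metric_def N'_def invertible_det_nz)
    then show "transpose (transpose (M y) ** H y ** M y) = transpose (M y) ** H y ** M y"
      "has_signature r s (transpose (M y) ** H y ** M y)"
      by (auto intro: transpose_congruence has_signature_congruence)
  qed
  then show ?thesis unfolding near_metric_def using sub NH(3) by blast
qed

text \<open>The change of coordinates y + E sh(y) alters the metric, up to higher order, by the
  symmetrised derivative of \<open>sh\<close>: the factor \<open>E\<close> raises the index and
  cancels against \<open>K y0 = E\<close>. The Jacobian at \<open>y0\<close> is the identity, so the
  components stay the same. The case m = 1 serves to kill first derivatives, m = 2 to modify second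
  derivatives.\<close>

lemma pullback_near_identity:
  fixes sh :: "'n \<Rightarrow> real^'n \<Rightarrow> real"
  assumes K: "near_metric K" "K y0 = E" and sh: "\<And>l. smooth_on UNIV (sh l)" "\<And>l. vord (Suc m) (sh l) y0"
    and m: "m \<ge> 1"
  shows "\<exists>G. near_metric G \<and> (\<forall>J. length J = p \<longrightarrow> component K J = component G J) \<and>
    (\<forall>i j. vord (Suc m) (\<lambda>y. G y $ i $ j - (K y $ i $ j + pd j (sh i) y + pd i (sh j) y)) y0)"
proof -
  obtain N where N: "open N" "y0 \<in> N" "smooth_on N K" using near_metricE[OF K(1)] by blast
  define T where "T y = (\<chi> l. y $ l + E $ l $ l * sh l y)" for y
  have T: "smooth_on UNIV T"
    unfolding smooth_on_vec[OF open_UNIV] T_def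
    by (auto intro!: smooth_on_add smooth_on_cmult smooth_on_component sh)
  have Ty0: "T y0 = y0" using sh(2) by (simp add: T_def vec_eq_iff)
  have "continuous_on UNIV T" by (rule smooth_on_imp_continuous[OF T])
  then have "open (T -` N)" using N(1) by (simp add: open_vimage)
  define N' where "N' = N \<inter> T -` N"
  have N': "open N'" "y0 \<in> N'" using \<open>open (T -` N)\<close> N Ty0 by (auto simp: N'_def)
  define D where "D y = (\<chi> a b. pd b (sh a) y)" for y
  have D: "smooth_on UNIV D"
    unfolding smooth_on_matrix[OF open_UNIV] D_def by (simp add: smooth_on_pd sh)
  have Dv: "vord m (\<lambda>y. D y $ i $ j) y0" for i j
    using sh(2)[of i] by (simp add: D_def)
  have J: "jacobian T (at y) = mat 1 + E ** D y" for y
  proof -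
    have "jacobian T (at y) $ i $ j = (mat 1 + E ** D y) $ i $ j" for i j
    proof -
      have "jacobian T (at y) $ i $ j = pd j (\<lambda>y. y $ i + E $ i $ i * sh i y) y"
        unfolding jacobian_nth[OF T UNIV_I] by (simp add: T_def)
      also have "\<dots> = (if i = j then 1 else 0) + E $ i $ i * pd j (sh i) y"
        using pd_add[OF smooth_on_component[OF open_UNIV] smooth_on_cmult[OF open_UNIV sh(1)] UNIV_I]
          pd_cmult[OF sh(1) UNIV_I] by (simp add: pd_component)
      also have "E $ i $ i * pd j (sh i) y = (E ** D y) $ i $ j"
        by (simp add: E_mult_nth D_def)
      finally show ?thesis by (simp add: mat_def)
    qed
    then show ?thesis by (simp add: vec_eq_iff)
  qed
  have "D y0 = 0" using Dv m by (cases m) (auto simp: vec_eq_iff)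
  then have J0: "jacobian T (at y0) = mat 1" unfolding J by (simp add: matrix_matrix_mult_def vec_eq_iff)
  define G where "G = (\<lambda>y. transpose (jacobian T (at y)) ** K (T y) ** jacobian T (at y))"
  have det: "det (jacobian T (at y0)) \<noteq> 0" unfolding J0 by simp
  note nat = component_natural[OF K(1) open_UNIV UNIV_I T Ty0 det G_def]
  have comp: "component K J = component G J" if "length J = p" for J
    unfolding nat(2)[OF that] J0
    using sum_diagonal_components[OF that, of "mat 1" "component G"] by (simp add: mat_def)
  define KT where "KT y = K (T y)" for y
  have sub: "smooth_on N' K" "smooth_on N' D" "smooth_on N' T"
    by (rule smooth_on_subset[OF N(3)] smooth_on_subset[OF D] smooth_on_subset[OF T]; simp add: N'_def)+
  have KT: "smooth_on N' KT"
    unfolding KT_def[abs_def] by (rule smooth_on_compose[OF N'(1) sub(3) N(3)]) (auto simp: N'_def)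
  have smE: "smooth_on N' (\<lambda>y. E)" by (rule smooth_on_const[OF N'(1)])
  note sm = smooth_on_matrix_mult[OF N'(1)] smooth_on_transpose[OF N'(1)] smooth_on_add[OF N'(1)]
  have KE: "smooth_on N' (\<lambda>y. KT y - E)"
    using smooth_on_add[OF N'(1) KT smooth_on_const[OF N'(1), of "- E"]] by simp
  have KEv: "vord 1 (\<lambda>y. (KT y - E) $ i $ j) y0" for i j
    by (simp add: KT_def Ty0 K(2))
  have Tv: "vord (Suc m) (\<lambda>y. T y $ l - y $ l) y0" for l
    using vord_cmult[OF open_UNIV UNIV_I sh(1,2), of "E $ l $ l" l] by (simp add: T_def)
  have 1: "vord (Suc m) (\<lambda>y. KT y $ i $ j - K y $ i $ j) y0" for i j
  proof -
    obtain V where V: "open V" "y0 \<in> V" "V \<subseteq> N'" "T ` V \<subseteq> N'"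
    proof -
      have "open (N' \<inter> T -` N')" using N'(1) \<open>continuous_on UNIV T\<close> by (simp add: open_Int open_vimage)
      then show thesis using that[of "N' \<inter> T -` N'"] N' Ty0 by auto
    qed
    show ?thesis
      unfolding KT_def
    proof (rule vord_near_identity[OF V(1,2) _ V(4) Ty0 V(3) Tv])
      show "smooth_on V T" by (rule smooth_on_subset[OF T]) simp
      show "smooth_on N' (\<lambda>y. K y $ i $ j)"
        using sub(1) unfolding smooth_on_matrix[OF N'(1)] by blast
    qed
  qed
  have DT: "vord m (\<lambda>y. transpose (D y) $ i $ j) y0" for i j
    using Dv by (simp add: transpose_def)
  note smDE = sm(1)[OF sm(2)[OF sub(2)] smE] and smED = sm(1)[OF smE sub(2)]
  note smKED = sm(1)[OF KT smED]
  have DE: "vord m (\<lambda>y. (transpose (D y) ** E) $ i $ j) y0" for i j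
    by (rule vord_matrix_mult[OF N' sm(2)[OF sub(2)] smE DT, where b = 0]) simp_all
  have ED: "vord m (\<lambda>y. (E ** D y) $ i $ j) y0" for i j
    by (rule vord_matrix_mult[OF N' smE sub(2) _ Dv, where a = 0]) simp_all
  have KED: "vord m (\<lambda>y. (KT y ** (E ** D y)) $ i $ j) y0" for i j
    by (rule vord_matrix_mult[OF N' KT smED _ ED, where a = 0]) simp_all
  \<comment> \<open>\<open>D\<close> has order m and \<open>KT - E\<close> order 1, so their
    products have order m + 1; the term quadratic in \<open>D\<close> has order 2m, which suffices
    as m \<ge> 1.\<close>
  have 2: "vord (Suc m) (\<lambda>y. ((transpose (D y) ** E) ** (KT y - E)) $ i $ j) y0" for i j
    by (rule vord_matrix_mult[OF N' smDE KE DE KEv]) simp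
  have 3: "vord (Suc m) (\<lambda>y. ((KT y - E) ** (E ** D y)) $ i $ j) y0" for i j
    by (rule vord_matrix_mult[OF N' KE smED KEv ED]) simp
  have 4: "vord (Suc m) (\<lambda>y. ((transpose (D y) ** E) ** (KT y ** (E ** D y))) $ i $ j) y0" for i j
    by (rule vord_matrix_mult[OF N' smDE smKED DE KED]) (use m in simp)
  \<comment> \<open>An exact identity, by \<open>E ** E = mat 1\<close>; the bracket collects the
    terms of higher order.\<close>
  have alg: "G y = K y + D y + transpose (D y) + ((KT y - K y) + (transpose (D y) ** E) ** (KT y - E)
      + (KT y - E) ** (E ** D y) + (transpose (D y) ** E) ** (KT y ** (E ** D y)))" for y
    unfolding G_def J KT_def[symmetric]
    by (simp add: matrix_algebra transpose_E matrix_mul_assoc E_involution)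
  have smn: "smooth_on N' (\<lambda>y. KT y $ i $ j - K y $ i $ j)"
    "smooth_on N' (\<lambda>y. ((transpose (D y) ** E) ** (KT y - E)) $ i $ j)"
    "smooth_on N' (\<lambda>y. ((KT y - E) ** (E ** D y)) $ i $ j)"
    "smooth_on N' (\<lambda>y. ((transpose (D y) ** E) ** (KT y ** (E ** D y))) $ i $ j)" for i j
    subgoal using KT sub(1) unfolding smooth_on_matrix[OF N'(1)] by (intro smooth_on_diff[OF N'(1)]) auto
    subgoal using sm(1)[OF smDE KE] unfolding smooth_on_matrix[OF N'(1)] by blast
    subgoal using sm(1)[OF KE smED] unfolding smooth_on_matrix[OF N'(1)] by blast
    subgoal using sm(1)[OF smDE smKED] unfolding smooth_on_matrix[OF N'(1)] by blast
    done
  have "vord (Suc m) (\<lambda>y. (KT y $ i $ j - K y $ i $ j) + ((transpose (D y) ** E) ** (KT y - E)) $ i $ j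
      + ((KT y - E) ** (E ** D y)) $ i $ j + ((transpose (D y) ** E) ** (KT y ** (E ** D y))) $ i $ j) y0" for i j
    by (intro vord_add[OF N'] smooth_on_add[OF N'(1)] smn 1 2 3 4)
  moreover have "G y $ i $ j - (K y $ i $ j + pd j (sh i) y + pd i (sh j) y)
      = (KT y $ i $ j - K y $ i $ j) + ((transpose (D y) ** E) ** (KT y - E)) $ i $ j
      + ((KT y - E) ** (E ** D y)) $ i $ j + ((transpose (D y) ** E) ** (KT y ** (E ** D y))) $ i $ j" for i j y
    unfolding alg by (simp add: D_def transpose_def)
  ultimately have "vord (Suc m) (\<lambda>y. G y $ i $ j - (K y $ i $ j + pd j (sh i) y + pd i (sh j) y)) y0" for i j
    by (simp only:)
  then show ?thesis using nat(1) comp by blast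
qed

section \<open>Metrics with value \<open>E\<close>, zero first and prescribed second derivatives at
  the base point\<close>

definition w :: "'n \<Rightarrow> real^'n \<Rightarrow> real" where
  "w k y = y $ k - y0 $ k"

lemma smooth_w: "smooth_on UNIV (w k)"
  unfolding w_def[abs_def]
  by (intro smooth_on_diff smooth_on_component smooth_on_const open_UNIV)

lemma pd_w: "pd j (w k) y = (if k = j then 1 else 0)"
  unfolding w_def[abs_def]
  by (simp add: pd_diff[OF smooth_on_component[OF open_UNIV] smooth_on_const[OF open_UNIV] UNIV_I] pd_component)

lemma w_0 [simp]: "w k y0 = 0"
  by (simp add: w_def)

lemma smooth_ww: "smooth_on UNIV (\<lambda>y. w k y * w l y)"
  by (intro smooth_on_mult smooth_w open_UNIV)

lemma quadratic_form:
  fixes a :: "'n \<Rightarrow> 'n \<Rightarrow> real"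
  defines "f \<equiv> (\<lambda>y. \<Sum>k\<in>UNIV. \<Sum>l\<in>UNIV. a k l * (w k y * w l y))"
  shows "smooth_on UNIV f" "f y0 = 0" "pd b f y = (\<Sum>k\<in>UNIV. (a b k + a k b) * w k y)"
    "pd d (pd b f) y = a b d + a d b" "vord 2 f y0"
proof -
  note cww = smooth_on_cmult[OF open_UNIV smooth_ww]
  show sm: "smooth_on UNIV f"
    unfolding f_def by (intro smooth_on_sum cww open_UNIV)
  show "f y0 = 0" by (simp add: f_def)
  have pd1: "pd b f y = (\<Sum>k\<in>UNIV. (a b k + a k b) * w k y)" for b y
  proof -
    have "pd b f y = (\<Sum>k\<in>UNIV. \<Sum>l\<in>UNIV. a k l * (w k y * (if l = b then 1 else 0) + (if k = b then 1 else 0) * w l y))"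
      unfolding f_def
      by (simp only: pd_sum[OF smooth_on_sum[OF open_UNIV cww] UNIV_I] pd_sum[OF cww UNIV_I]
          pd_cmult[OF smooth_ww UNIV_I] pd_mult[OF smooth_w smooth_w UNIV_I] pd_w)
    also have "\<dots> = (\<Sum>k\<in>UNIV. a k b * w k y) + (\<Sum>k\<in>UNIV. if k = b then (\<Sum>l\<in>UNIV. a k l * w l y) else 0)"
      unfolding sum.distrib[symmetric]
      by (rule sum.cong) (auto simp: distrib_left sum.distrib if_distrib[of "\<lambda>x. _ * x"] if_distrib[of "\<lambda>x. x * _"] cong: if_cong)
    finally show ?thesis by (simp add: sum.distrib[symmetric] distrib_right add.commute)
  qed
  then show "pd b f y = (\<Sum>k\<in>UNIV. (a b k + a k b) * w k y)" .
  have pd2: "pd d (pd b f) y = a b d + a d b" for d b y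
  proof -
    have "pd b f = (\<lambda>y. \<Sum>k\<in>UNIV. (a b k + a k b) * w k y)" using pd1 by blast
    then have "pd d (pd b f) y = (\<Sum>k\<in>UNIV. (a b k + a k b) * (if k = d then 1 else 0))"
      by (simp only: pd_sum[OF smooth_on_cmult[OF open_UNIV smooth_w] UNIV_I] pd_cmult[OF smooth_w UNIV_I] pd_w)
    then show ?thesis by (simp add: if_distrib[of "\<lambda>x. _ * x"] cong: if_cong)
  qed
  then show "pd d (pd b f) y = a b d + a d b" .
  show "vord 2 f y0"
    by (simp add: numeral_2_eq_2 \<open>f y0 = 0\<close> pd1)
qed

definition quad_field :: "'n quad \<Rightarrow> real^'n \<Rightarrow> real^'n^'n" where
  "quad_field u y = (\<chi> i j. \<Sum>k\<in>UNIV. \<Sum>l\<in>UNIV. u $ k $ l $ i $ j * (w k y * w l y))"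

lemma quad_field_entry:
  "smooth_on UNIV (\<lambda>y. quad_field u y $ i $ j)" "quad_field u y0 = 0" "vord 2 (\<lambda>y. quad_field u y $ i $ j) y0"
  "pd b (\<lambda>y. quad_field u y $ i $ j) y0 = 0"
  "pd d (pd b (\<lambda>y. quad_field u y $ i $ j)) y = u $ b $ d $ i $ j + u $ d $ b $ i $ j"
  using quadratic_form[where a = "\<lambda>k l. u $ k $ l $ i $ j"]
  by (simp_all add: quad_field_def vec_eq_iff)

lemma smooth_quad_field: "smooth_on UNIV (quad_field u)"
  unfolding smooth_on_matrix[OF open_UNIV] using quad_field_entry(1) by blast

text \<open>Being congruent to \<open>E\<close>, the model metric has the right signature near \<open>y0\<close>.\<close>

definition frame :: "'n quad \<Rightarrow> real^'n \<Rightarrow> real^'n^'n" where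
  "frame u y = mat 1 + (1/4) *\<^sub>R (E ** quad_field u y)"

definition model :: "'n quad \<Rightarrow> real^'n \<Rightarrow> real^'n^'n" where
  "model u y = transpose (frame u y) ** E ** frame u y"

lemma smooth_frame: "smooth_on UNIV (frame u)"
  unfolding frame_def[abs_def]
  by (intro smooth_on_add smooth_on_const smooth_on_compose_linear[OF _ bounded_linear_scaleR_right]
      smooth_on_matrix_mult smooth_quad_field open_UNIV)

lemma frame_0: "frame u y0 = mat 1"
  by (simp add: frame_def quad_field_entry(2) matrix_matrix_mult_def vec_eq_iff)

lemma smooth_model: "smooth_on UNIV (model u)"
  unfolding model_def[abs_def]
  by (intro smooth_on_matrix_mult smooth_on_transpose smooth_frame smooth_on_const open_UNIV)

lemma near_metric_model: "near_metric (model u)"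
  unfolding model_def[abs_def]
  by (rule near_metric_congruence[OF near_metric_E open_UNIV UNIV_I smooth_frame]) (simp add: frame_0)

lemma model_expand:
  "model u y = E + (1/4) *\<^sub>R (quad_field u y + transpose (quad_field u y))
    + (1/16) *\<^sub>R (transpose (quad_field u y) ** E ** quad_field u y)"
  unfolding model_def frame_def
  by (simp add: matrix_algebra transpose_E matrix_mul_assoc E_involution)
    (simp add: matrix_mul_assoc[symmetric] E_involution algebra_simps)

lemma model_0: "model u y0 = E"
  by (simp add: model_def frame_0 transpose_mat)

text \<open>The last term of \<open>model_expand\<close> contains two factors of order 2, so it is
  invisible in the 2-jet.\<close>

lemma model_quadratic:
  "vord 3 (\<lambda>y. model u y $ i $ j - (E $ i $ j + (quad_field u y $ i $ j + quad_field u y $ j $ i) / 4)) y0"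
proof -
  note sm = smooth_on_transpose[OF open_UNIV smooth_quad_field[of u]] smooth_on_const[OF open_UNIV, of E]
  have vt: "vord 2 (\<lambda>y. transpose (quad_field u y) $ i $ j) y0" for i j
    using quad_field_entry(3) by (simp add: transpose_def)
  have vE: "vord 2 (\<lambda>y. (transpose (quad_field u y) ** E) $ i $ j) y0" for i j
    by (rule vord_matrix_mult[OF open_UNIV UNIV_I sm vt, where b = 0]) simp_all
  note smE = smooth_on_matrix_mult[OF open_UNIV sm]
  have v: "vord 3 (\<lambda>y. (transpose (quad_field u y) ** E ** quad_field u y) $ i $ j) y0"
    by (rule vord_matrix_mult[OF open_UNIV UNIV_I smE smooth_quad_field vE quad_field_entry(3)]) simp
  have "smooth_on UNIV (\<lambda>y. (transpose (quad_field u y) ** E ** quad_field u y) $ i $ j)"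
    using smooth_on_matrix_mult[OF open_UNIV smE smooth_quad_field[of u]]
    unfolding smooth_on_matrix[OF open_UNIV] by blast
  from vord_cmult[OF open_UNIV UNIV_I this v, of "1/16"] show ?thesis
    unfolding model_expand by (simp add: transpose_def field_simps)
qed

lemma smooth_remainder:
  "smooth_on UNIV (\<lambda>y. model u y $ i $ j - (E $ i $ j + (quad_field u y $ i $ j + quad_field u y $ j $ i) / 4))"
proof -
  have "smooth_on UNIV (\<lambda>y. model u y $ i $ j)"
    using smooth_model unfolding smooth_on_matrix[OF open_UNIV] by blast
  then show ?thesis
    unfolding divide_inverse mult.commute[of _ "inverse 4"]
    by (intro smooth_on_diff smooth_on_add smooth_on_const smooth_on_cmult quad_field_entry(1) open_UNIV)
qed

lemma jet_of_vord:
  assumes "smooth_on N H" "smooth_on N H'" "open N" "y0 \<in> N" "\<And>i j. vord 3 (\<lambda>y. H y $ i $ j - H' y $ i $ j) y0"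
  shows "jet_at H y0 = jet_at H' y0"
  using jet_at_eq_iff[OF assms(3,4,1,2)] assms(5) by blast

text \<open>The factor 1/4 in \<open>frame\<close> is made for this: \<open>quad_field\<close> has
  no factor 1/2, so its second derivatives are sums of two entries of \<open>u\<close>, and the
  congruence adds the transpose; \<open>quad_sym\<close> averages exactly these four terms.\<close>

lemma jet_model: "jet_at (model u) y0 = (E, 0, quad_sym u)"
proof -
  define K where "K y = E + (1/4) *\<^sub>R (quad_field u y + transpose (quad_field u y))" for y
  have K: "smooth_on UNIV K"
    unfolding K_def[abs_def]
    by (intro smooth_on_add smooth_on_const smooth_on_compose_linear[OF _ bounded_linear_scaleR_right]
        smooth_on_transpose smooth_quad_field open_UNIV)
  have Kij: "K y $ i $ j = E $ i $ j + (1/4) * (quad_field u y $ i $ j + quad_field u y $ j $ i)" for y i j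
    by (simp add: K_def transpose_def)
  have "jet_at (model u) y0 = jet_at K y0"
    by (rule jet_of_vord[OF smooth_model K open_UNIV UNIV_I]) (use model_quadratic in \<open>simp add: Kij\<close>)
  also have "\<dots> = (E, 0, quad_sym u)"
  proof -
    note q = quad_field_entry[where u = u]
    note sq = smooth_on_add[OF open_UNIV q(1) q(1)]
    note sq4 = smooth_on_cmult[OF open_UNIV sq]
    have pd1: "pd k (\<lambda>y. K y $ i $ j) = (\<lambda>y. (1/4) * (pd k (\<lambda>y. quad_field u y $ i $ j) y + pd k (\<lambda>y. quad_field u y $ j $ i) y))" for k i j
      unfolding Kij
      by (rule ext) (simp only: pd_add[OF smooth_on_const[OF open_UNIV] sq4 UNIV_I] pd_const
          pd_cmult[OF sq UNIV_I] pd_add[OF q(1) q(1) UNIV_I] add_0)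
    have pd2: "pd d (pd k (\<lambda>y. K y $ i $ j)) y0 = quad_sym u $ d $ k $ i $ j" for d k i j
      unfolding pd1
      by (simp only: pd_cmult[OF smooth_on_add[OF open_UNIV smooth_on_pd[OF q(1)] smooth_on_pd[OF q(1)]] UNIV_I]
          pd_add[OF smooth_on_pd[OF q(1)] smooth_on_pd[OF q(1)] UNIV_I] q(5))
        (simp add: quad_sym_def field_simps)
    have pd1_0: "pd k (\<lambda>y. K y $ i $ j) y0 = 0" for k i j
      by (simp only: pd1 q(4)) simp
    show ?thesis
      unfolding jet_at_def pd2 pd1_0 by (simp add: vec_eq_iff Kij q(2))
  qed
  finally show ?thesis .
qed

lemma component_model_cong: "quad_sym u = quad_sym v \<Longrightarrow> component (model u) I = component (model v) I"
  by (rule component_cong[OF near_metric_model near_metric_model]) (simp add: jet_model)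

text \<open>The reflection matrix commutes with \<open>E\<close>, so pulling \<open>model u\<close>
  back along the reflection about \<open>y0\<close> gives \<open>model (quad_flip m u)\<close>
  exactly, not merely up to its 2-jet. This is where a map reversing orientation enters.\<close>

lemma component_model_flip:
  assumes "length I = p"
  shows "component (model (quad_flip m u)) I = (\<Prod>i<p. flip_sign m (I ! i)) * component (model u) I"
proof -
  define R :: "real^'n^'n" where "R = (\<chi> i j. if i = j then flip_sign m i else 0)"
  define T where "T y = y0 + R *v (y - y0)" for y
  have Rmult: "(R ** X) $ i $ j = flip_sign m i * X $ i $ j" for X :: "real^'n^'n" and i j
  proof -
    have "(R ** X) $ i $ j = (\<Sum>k\<in>UNIV. if k = i then flip_sign m i * X $ i $ j else 0)"
      unfolding matrix_matrix_mult_def vec_lambda_beta by (rule sum.cong) (auto simp: R_def)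
    then show ?thesis by simp
  qed
  have Rmult': "(X ** R) $ i $ j = X $ i $ j * flip_sign m j" for X :: "real^'n^'n" and i j
  proof -
    have "(X ** R) $ i $ j = (\<Sum>k\<in>UNIV. if k = j then X $ i $ j * flip_sign m j else 0)"
      unfolding matrix_matrix_mult_def vec_lambda_beta by (rule sum.cong) (auto simp: R_def)
    then show ?thesis by simp
  qed
  have ff: "flip_sign m i * flip_sign m i = 1" for i by (simp add: flip_sign_def)
  have RR: "R ** R = mat 1"
  proof -
    have "(R ** R) $ i $ j = mat 1 $ i $ j" for i j
      unfolding Rmult by (simp add: R_def mat_def ff)
    then show ?thesis by (simp add: vec_eq_iff)
  qed
  have RE: "R ** E = E ** R"
  proof -
    have "(R ** E) $ i $ j = (E ** R) $ i $ j" for i j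
      unfolding Rmult Rmult' by (simp add: E_nth[of i j])
    then show ?thesis by (simp add: vec_eq_iff)
  qed
  have tR: "transpose R = R" by (auto simp: R_def transpose_def vec_eq_iff)
  have wT: "w k (T y) = flip_sign m k * w k y" for k y
    by (simp add: w_def T_def R_def matrix_vector_mult_def if_distrib[of "\<lambda>x. x * _"] cong: if_cong)
  have QT: "quad_field (quad_flip m u) y = R ** quad_field u (T y) ** R" for y
  proof -
    have "quad_field (quad_flip m u) y $ i $ j = (R ** quad_field u (T y) ** R) $ i $ j" for i j
      unfolding Rmult Rmult'
      by (simp add: quad_field_def quad_flip_def wT sum_distrib_left sum_distrib_right mult_ac)
    then show ?thesis by (simp add: vec_eq_iff)
  qed
  have "frame (quad_flip m u) y = R ** frame u (T y) ** R" for y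
    unfolding frame_def QT
    by (simp add: matrix_algebra RR) (simp add: matrix_mul_assoc RE)
  then have G: "(\<lambda>y. transpose R ** model u (y0 + R *v (y - y0)) ** R) = model (quad_flip m u)"
    unfolding model_def T_def[symmetric]
    by (simp add: fun_eq_iff matrix_transpose_mul tR matrix_mul_assoc)
      (metis RE RR matrix_mul_assoc matrix_mul_rid)
  have R: "invertible R" unfolding invertible_def using RR by blast
  have "component (model u) I
      = (\<Sum>I' | length I' = p. (\<Prod>i<p. R $ (I ! i) $ (I' ! i)) * component (model (quad_flip m u)) I')"
    using component_linear(2)[OF near_metric_model R assms, of u] unfolding G .
  also have "\<dots> = (\<Prod>i<p. R $ (I ! i) $ (I ! i)) * component (model (quad_flip m u)) I"
    by (rule sum_diagonal_components[OF assms]) (simp add: R_def)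
  also have "(\<Prod>i<p. R $ (I ! i) $ (I ! i)) = (\<Prod>i<p. flip_sign m (I ! i))"
    by (simp add: R_def)
  finally have "component (model u) I = (\<Prod>i<p. flip_sign m (I ! i)) * component (model (quad_flip m u)) I" .
  moreover have "(\<Prod>i<p. flip_sign m (I ! i)) * (\<Prod>i<p. flip_sign m (I ! i)) = 1"
    by (simp add: prod.distrib[symmetric] ff)
  ultimately show ?thesis by (metis mult.assoc mult_1)
qed

text \<open>
  For quadratic forms \<open>a\<close> and \<open>b\<close>, the shift of coordinates by a multiple of \<open>E (b \<nabla>a - a \<nabla>b)\<close> adds a
  multiple of \<open>b Hess a - a Hess b\<close> to the metric, as the terms \<open>\<nabla>a \<otimes> \<nabla>b\<close> cancel by symmetry.
\<close>

lemma component_model_swap: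
  assumes "length I = p"
  shows "component (model (u + quad_unit (k, l, i, j, e))) I = component (model (u + quad_unit (i, j, k, l, e))) I"
proof -
  define a where "a y = w k y * w l y" for y
  define b where "b y = w i y * w j y" for y
  define da where "da m y = (if k = m then w l y else 0) + (if l = m then w k y else 0)" for m y
  define db where "db m y = (if i = m then w j y else 0) + (if j = m then w i y else 0)" for m y
  \<comment> \<open>Symmetrising the derivative of \<open>sh\<close> doubles the constant to e/4,
    and e/4 is the weight with which \<open>frame\<close> lets the two unit arrays enter the models,
    as a Hess b and b Hess a.\<close>
  define sh where "sh m y = e / 8 * (b y * da m y - a y * db m y)" for m y
  define ha where "ha m m' = (if k = m \<and> l = m' then 1 else 0) + (if l = m \<and> k = m' then 1 else (0::real))" for m m'
  define hb where "hb m m' = (if i = m \<and> j = m' then 1 else 0) + (if j = m \<and> i = m' then 1 else (0::real))" for m m'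
  have sab: "smooth_on UNIV a" "smooth_on UNIV b"
    unfolding a_def[abs_def] b_def[abs_def] by (rule smooth_ww)+
  have w0: "smooth_on UNIV (\<lambda>y. if P then w q y else 0)" for P q
    by (cases P) (simp_all add: smooth_w smooth_on_const)
  have sd: "smooth_on UNIV (da m)" "smooth_on UNIV (db m)" for m
    unfolding da_def[abs_def] db_def[abs_def] by (intro smooth_on_add open_UNIV w0)+
  have pdw0: "pd n (\<lambda>y. if P then w q y else 0) y = (if P \<and> q = n then 1 else 0)" for P q n y
    by (cases P) (simp_all add: pd_w)
  have pda: "pd n a y = da n y" for n y
    unfolding a_def[abs_def] using pd_mult[OF smooth_w smooth_w UNIV_I, of n k l y]
    by (auto simp: pd_w da_def)
  have pdb: "pd n b y = db n y" for n y
    unfolding b_def[abs_def] using pd_mult[OF smooth_w smooth_w UNIV_I, of n i j y]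
    by (auto simp: pd_w db_def)
  have pdda: "pd n (da m) y = ha m n" for n m y
    unfolding da_def[abs_def] using pd_add[OF w0 w0 UNIV_I] by (simp add: pdw0 ha_def)
  have pddb: "pd n (db m) y = hb m n" for n m y
    unfolding db_def[abs_def] using pd_add[OF w0 w0 UNIV_I] by (simp add: pdw0 hb_def)
  have ssh: "smooth_on UNIV (sh m)" for m
    unfolding sh_def[abs_def]
    by (intro smooth_on_cmult smooth_on_diff smooth_on_mult sab sd open_UNIV)
  have vab: "vord 2 a y0" "vord 2 b y0"
    using pda pdb by (simp_all add: numeral_2_eq_2 a_def b_def da_def db_def)
  have vd: "vord 1 (da m) y0" "vord 1 (db m) y0" for m
    by (simp_all add: da_def db_def)
  have vsh: "vord (Suc 2) (sh m) y0" for m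
    unfolding sh_def[abs_def]
    by (intro vord_cmult[OF open_UNIV UNIV_I] vord_diff[OF open_UNIV UNIV_I] smooth_on_diff smooth_on_mult
        sab sd open_UNIV vord_mult[OF open_UNIV UNIV_I _ _ vab(1) vd(2)] vord_mult[OF open_UNIV UNIV_I _ _ vab(2) vd(1)]) simp_all
  have pdsh: "pd n (sh m) y = e / 8 * ((b y * ha m n + db n y * da m y) - (a y * hb m n + da n y * db m y))" for n m y
    unfolding sh_def[abs_def]
    by (simp only: pd_cmult[OF smooth_on_diff[OF open_UNIV smooth_on_mult[OF open_UNIV sab(2) sd(1)] smooth_on_mult[OF open_UNIV sab(1) sd(2)]] UNIV_I]
        pd_diff[OF smooth_on_mult[OF open_UNIV sab(2) sd(1)] smooth_on_mult[OF open_UNIV sab(1) sd(2)] UNIV_I]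
        pd_mult[OF sab(2) sd(1) UNIV_I] pd_mult[OF sab(1) sd(2) UNIV_I] pda pdb pdda pddb)
  have hsym: "ha m n = ha n m" "hb m n = hb n m" for m n
    by (simp_all add: ha_def hb_def conj_commute add.commute)
  have hab: "ha m n = (if m = k \<and> n = l then 1 else 0) + (if n = k \<and> m = l then 1 else 0)"
    "hb m n = (if m = i \<and> n = j then 1 else 0) + (if n = i \<and> m = j then 1 else 0)" for m n
    unfolding ha_def hb_def by (intro arg_cong2[of _ _ _ _ "(+)"] if_cong refl; blast)+
  have if_sum: "(if P then e * z else 0) + (if Q then e * z else 0)
      = e * (z * ((if P then 1 else 0) + (if Q then 1 else 0)))" for P Q z
    by (cases P; cases Q; simp)
  define K where "K = model (u + quad_unit (k, l, i, j, e))"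
  define K' where "K' = model (u + quad_unit (i, j, k, l, e))"
  obtain G where G: "near_metric G" "\<And>J. length J = p \<Longrightarrow> component K J = component G J"
    "\<And>m n. vord 3 (\<lambda>y. G y $ m $ n - (K y $ m $ n + pd n (sh m) y + pd m (sh n) y)) y0"
    using pullback_near_identity[of K sh 2] near_metric_model model_0 ssh vsh
    unfolding K_def by (auto simp: eval_nat_numeral)
  have unit: "quad_field (u + quad_unit (k, l, i, j, e)) y $ m $ n
      = quad_field u y $ m $ n + (if m = i \<and> n = j then e * (w k y * w l y) else 0)" for k l i j m n y
  proof -
    have "(\<Sum>k'\<in>UNIV. \<Sum>l'\<in>UNIV. quad_unit (k, l, i, j, e) $ k' $ l' $ m $ n * (w k' y * w l' y))
        = (\<Sum>k'\<in>UNIV. if k' = k then (\<Sum>l'\<in>UNIV. if l' = l then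
            (if m = i \<and> n = j then e * (w k y * w l y) else 0) else 0) else 0)"
      by (intro sum.cong refl) (auto simp: quad_unit_def if_distrib[of "\<lambda>x. x * _"] cong: if_cong)
    then show ?thesis
      by (simp add: quad_field_def distrib_right sum.distrib)
  qed

  define Q where "Q = quad_field (u + quad_unit (k, l, i, j, e))"
  define Q' where "Q' = quad_field (u + quad_unit (i, j, k, l, e))"
  have "vord 3 (\<lambda>y. K y $ m $ n + pd n (sh m) y + pd m (sh n) y - K' y $ m $ n) y0" for m n
  proof -
    \<comment> \<open>The quadratic parts cancel, and only the remainders of the two models are
      left, of order 3 by \<open>model_quadratic\<close>.\<close>
    have "K y $ m $ n + pd n (sh m) y + pd m (sh n) y - K' y $ m $ n
      = (K y $ m $ n - (E $ m $ n + (Q y $ m $ n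
          + Q y $ n $ m) / 4))
        - (K' y $ m $ n - (E $ m $ n + (Q' y $ m $ n
          + Q' y $ n $ m) / 4))" for y
    proof -
      have "e / 4 * (a y * hb m n) + pd n (sh m) y + pd m (sh n) y = e / 4 * (b y * ha m n)"
        unfolding pdsh hsym[of n m] by (simp add: field_simps)
      moreover have "(if m = i \<and> n = j then e * (w k y * w l y) else 0) + (if n = i \<and> m = j then e * (w k y * w l y) else 0)
          = e * (a y * hb m n)"
        unfolding hab(2)[of m n] a_def
        by (rule if_sum)
      moreover have "(if m = k \<and> n = l then e * (w i y * w j y) else 0) + (if n = k \<and> m = l then e * (w i y * w j y) else 0)
          = e * (b y * ha m n)"
        unfolding hab(1)[of m n] b_def
        by (rule if_sum)
      ultimately show ?thesis unfolding Q_def Q'_def unit by argo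
    qed
    moreover have "vord 3 (\<lambda>y. (K y $ m $ n - (E $ m $ n + (Q y $ m $ n
          + Q y $ n $ m) / 4))
        - (K' y $ m $ n - (E $ m $ n + (Q' y $ m $ n
          + Q' y $ n $ m) / 4))) y0"
      unfolding K_def K'_def Q_def Q'_def
      by (intro vord_diff[OF open_UNIV UNIV_I smooth_remainder smooth_remainder] model_quadratic)
    ultimately show ?thesis by (simp only:)
  qed
  then have KK': "vord 3 (\<lambda>y. K y $ m $ n + pd n (sh m) y + pd m (sh n) y - K' y $ m $ n) y0" for m n .
  obtain N where N: "open N" "y0 \<in> N" "smooth_on N G" using near_metricE[OF G(1)] by blast
  have smK: "smooth_on N (\<lambda>y. K y $ m $ n)" "smooth_on N (\<lambda>y. K' y $ m $ n)" for m n
    unfolding K_def K'_def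
    using smooth_on_subset[OF smooth_model, of N] unfolding smooth_on_matrix[OF N(1)] by auto
  have smKsh: "smooth_on N (\<lambda>y. K y $ m $ n + pd n (sh m) y + pd m (sh n) y)" for m n
    by (intro smooth_on_add N(1) smK smooth_on_subset[OF smooth_on_pd[OF ssh]]) auto
  have smG: "smooth_on N (\<lambda>y. G y $ m $ n)" for m n
    using N(3) unfolding smooth_on_matrix[OF N(1)] by blast
  have "vord 3 (\<lambda>y. G y $ m $ n - K' y $ m $ n) y0" for m n
    using vord_add[OF N(1,2) smooth_on_diff[OF N(1) smG smKsh] smooth_on_diff[OF N(1) smKsh smK(2)]
        G(3)[of m n] KK'[of m n]] by simp
  then have "component G I = component K' I"
    by (intro component_cong[OF G(1)] vord_jet_eq[OF G(1)]) (simp_all add: K'_def near_metric_model)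
  then show ?thesis using G(2)[OF assms] by (simp add: K_def K'_def)
qed

end

section \<open>Differentiating jets and components along a metric\<close>

lemma frechet_derivative_nth:
  assumes "smooth_on N f" "y \<in> N"
  shows "frechet_derivative f (at y) v $ i = frechet_derivative (\<lambda>y. f y $ i) (at y) v"
  using frechet_derivative_at[OF bounded_linear.has_derivative[OF bounded_linear_vec_nth smooth_on_has_derivative[OF assms]]]
  by metis

definition jet_derivative :: "(real^'n \<Rightarrow> real^'n^'n) \<Rightarrow> real^'n::finite \<Rightarrow> 'n \<Rightarrow>
    (real^'n^'n) \<times> (real^'n^'n^'n) \<times> (real^'n^'n^'n^'n)" where
  "jet_derivative H y m = (\<chi> i j. pd m (\<lambda>y. H y $ i $ j) y, \<chi> k i j. pd m (pd k (\<lambda>y. H y $ i $ j)) y,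
    \<chi> k l i j. pd m (pd k (pd l (\<lambda>y. H y $ i $ j))) y)"

lemma jet_at_derivative:
  assumes N: "open N" "y \<in> N" and H: "smooth_on N H"
  obtains D where "(jet_at H has_derivative D) (at y)"
    "\<And>m. D (axis m 1) = jet_derivative H y m"
proof -
  have Hij: "smooth_on N (\<lambda>y. H y $ i $ j)" for i j
    using H unfolding smooth_on_matrix[OF N(1)] by blast
  define H1 where "H1 y = (\<chi> k i j. pd k (\<lambda>y. H y $ i $ j) y)" for y
  define H2 where "H2 y = (\<chi> k l i j. pd k (pd l (\<lambda>y. H y $ i $ j)) y)" for y
  have H1: "smooth_on N H1" and H1n: "smooth_on N (\<lambda>y. H1 y $ k)" "smooth_on N (\<lambda>y. H1 y $ k $ i)" for k i
    unfolding H1_def smooth_on_vec[OF N(1)] by (simp_all add: smooth_on_vec[OF N(1)] smooth_on_pd Hij)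
  have H2: "smooth_on N H2" and H2n: "smooth_on N (\<lambda>y. H2 y $ k)" "smooth_on N (\<lambda>y. H2 y $ k $ l)"
    "smooth_on N (\<lambda>y. H2 y $ k $ l $ i)" for k l i
    unfolding H2_def smooth_on_vec[OF N(1)] by (simp_all add: smooth_on_vec[OF N(1)] smooth_on_pd Hij)
  have Hn: "smooth_on N (\<lambda>y. H y $ i)" for i
    using H smooth_on_vec[OF N(1)] by blast
  have eq: "jet_at H = (\<lambda>y. (H y, H1 y, H2 y))"
    by (simp add: fun_eq_iff jet_at_def H1_def H2_def)
  show thesis
  proof (rule that)
    show "(jet_at H has_derivative (\<lambda>v. (frechet_derivative H (at y) v, frechet_derivative H1 (at y) v,
        frechet_derivative H2 (at y) v))) (at y)"
      unfolding eq by (intro has_derivative_Pair smooth_on_has_derivative[OF H N(2)]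
          smooth_on_has_derivative[OF H1 N(2)] smooth_on_has_derivative[OF H2 N(2)])
    show "(frechet_derivative H (at y) (axis m 1), frechet_derivative H1 (at y) (axis m 1), frechet_derivative H2 (at y) (axis m 1))
      = jet_derivative H y m" for m
      by (simp add: jet_derivative_def vec_eq_iff frechet_derivative_nth[OF H N(2)] frechet_derivative_nth[OF Hn N(2)]
          frechet_derivative_nth[OF H1 N(2)] frechet_derivative_nth[OF H1n(1) N(2)] frechet_derivative_nth[OF H1n(2) N(2)]
          frechet_derivative_nth[OF H2 N(2)] frechet_derivative_nth[OF H2n(1) N(2)] frechet_derivative_nth[OF H2n(2) N(2)]
          frechet_derivative_nth[OF H2n(3) N(2)])
        (simp add: H1_def H2_def pd_def[abs_def])
  qed
qed

lemma christoffel_cong: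
  assumes "jet2_of A g x = jet2_of A g' x" "c \<in> charts_at A x"
  shows "christoffel c g x i k l = christoffel c g' x i k l"
proof -
  have "snd (jet2_of A g x) c = snd (jet2_of A g' x) c" using assms(1) by simp
  then have "g x c = g' x c" "\<And>k i j. pdiff c k (\<lambda>z. g z c $ i $ j) x = pdiff c k (\<lambda>z. g' z c $ i $ j) x"
    using assms(2) by (auto simp: jet2_of_def vec_eq_iff)
  then show ?thesis by (simp add: christoffel_def)
qed

context natural_tensor
begin

lemma component_extension_eq:
  assumes "near_metric H" "extends I W F" "(y0, jet_at H y0) \<in> W"
  shows "component H I = F (y0, jet_at H y0)"
proof -
  obtain N where N: "y0 \<in> N" "N \<subseteq> Oc" "local_metric r s N H"
    using assms(1) by (auto simp: near_metric_def)
  show ?thesis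
    using assms(2,3) jet_lift_over[OF N(2,3,1)] by (simp add: extends_def component_def base(2))
qed

text \<open>Chain rule through the extension \<open>F\<close>: third derivatives of the metric enter
  through \<open>D\<close> alone, hence linearly.\<close>

lemma component_derivative:
  assumes H: "near_metric H" and ext: "extends I W F" "(y0, jet_at H y0) \<in> W"
    and D: "(jet_at H has_derivative D) (at y0)"
  shows "pd m (\<lambda>y. \<omega> (jet2_of A (lift c H) (chart_inv c y)) c I) y0
    = frechet_derivative F (at (y0, jet_at H y0)) (axis m 1, D (axis m 1))"
proof -
  have W: "open W" "smooth_on W F" using ext(1) by (auto simp: extends_def)
  obtain N where N: "open N" "y0 \<in> N" "N \<subseteq> Oc" "local_metric r s N H" "smooth_on N H"
    using near_metricE[OF H] by blast
  have "continuous_on N (\<lambda>y. (y, jet_at H y))"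
  proof (intro continuous_at_imp_continuous_on ballI continuous_Pair continuous_ident)
    fix y assume "y \<in> N"
    then obtain D' where "(jet_at H has_derivative D') (at y)" using jet_at_derivative[OF N(1) _ N(5)] by blast
    then show "isCont (jet_at H) y" by (rule has_derivative_continuous)
  qed
  then have op: "open (N \<inter> (\<lambda>y. (y, jet_at H y)) -` W)"
    by (rule continuous_open_preimage[OF _ N(1) W(1)])
  have "pd m (\<lambda>y. \<omega> (jet2_of A (lift c H) (chart_inv c y)) c I) y0 = pd m (\<lambda>y. F (y, jet_at H y)) y0"
  proof (rule pd_cong[OF op])
    fix y assume "y \<in> N \<inter> (\<lambda>y. (y, jet_at H y)) -` W"
    then show "\<omega> (jet2_of A (lift c H) (chart_inv c y)) c I = F (y, jet_at H y)"
      using ext(1) jet_lift_over[OF N(3,4)] by (auto simp: extends_def)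
  qed (use N ext(2) in auto)
  also have "\<dots> = frechet_derivative F (at (y0, jet_at H y0)) (axis m 1, D (axis m 1))"
    by (rule pd_eqI[OF has_derivative_compose[OF has_derivative_Pair[OF has_derivative_ident D]
            smooth_on_has_derivative[OF W(2) ext(2)]]])
  finally show ?thesis .
qed

text \<open>The Christoffel terms depend on the 2-jet only and so form the same sum \<open>R\<close>
  for both metrics; subtracting the two divergences leaves the partial derivatives.\<close>

lemma divergence_cong:
  assumes "near_metric H" "near_metric H'" and eq: "jet2_of A (lift c H) x = jet2_of A (lift c H') x"
    and div: "divergence c (lift c H) (\<lambda>z. \<omega> (jet2_of A (lift c H) z)) x J = 0"
      "divergence c (lift c H') (\<lambda>z. \<omega> (jet2_of A (lift c H') z)) x J = 0"
  shows "(\<Sum>k\<in>UNIV. pd k (\<lambda>y. \<omega> (jet2_of A (lift c H) (chart_inv c y)) c (J @ [k])) y0)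
    = (\<Sum>k\<in>UNIV. pd k (\<lambda>y. \<omega> (jet2_of A (lift c H') (chart_inv c y)) c (J @ [k])) y0)"
proof -
  define R where "R = (\<Sum>k\<in>UNIV. \<Sum>m<length (J @ [k]). \<Sum>l\<in>UNIV.
    christoffel c (lift c H) x ((J @ [k]) ! m) k l * \<omega> (jet2_of A (lift c H) x) c ((J @ [k])[m := l]))"
  have "(\<Sum>k\<in>UNIV. pd k (\<lambda>y. \<omega> (jet2_of A (lift c H) (chart_inv c y)) c (J @ [k])) y0) + R = 0"
    using div(1) unfolding divergence_def cov_deriv_def pdiff_def R_def pd_def y0_def sum.distrib .
  moreover have "(\<Sum>k\<in>UNIV. pd k (\<lambda>y. \<omega> (jet2_of A (lift c H') (chart_inv c y)) c (J @ [k])) y0) + R = 0"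
    using div(2) unfolding divergence_def cov_deriv_def pdiff_def R_def pd_def y0_def sum.distrib
      christoffel_cong[OF eq chart_at] eq .
  ultimately show ?thesis by simp
qed

end

context natural_tensor_normal
begin

text \<open>As \<open>q\<close> has constant derivatives, each derivative trades one factor
  \<open>q\<close> for a coordinate of \<open>\<xi>\<close>; only after three derivatives does a
  term survive at \<open>y0\<close>, with coefficient 3! = 6.\<close>

lemma cube_derivatives:
  fixes \<xi> :: "real^'n" and \<kappa> :: "real^'n \<Rightarrow> real"
  defines "q \<equiv> (\<lambda>y. \<Sum>k\<in>UNIV. \<xi> $ k * w k y)"
  assumes \<kappa>: "smooth_on UNIV \<kappa>"
  defines "f \<equiv> (\<lambda>y. q y * (q y * (q y * \<kappa> y)))"
  shows "f y0 = 0" "pd l f y0 = 0" "pd k (pd l f) y0 = 0"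
    "pd m (pd k (pd l f)) y0 = 6 * (\<xi> $ m * (\<xi> $ k * \<xi> $ l)) * \<kappa> y0"
    "smooth_on UNIV q" "smooth_on UNIV f"
proof -
  have cw: "smooth_on UNIV (\<lambda>y. \<xi> $ k * w k y)" for k
    by (intro smooth_on_cmult smooth_w open_UNIV)
  show q: "smooth_on UNIV q" unfolding q_def by (intro smooth_on_sum cw open_UNIV)
  have q0: "q y0 = 0" by (simp add: q_def)
  have pdq: "pd k q y = \<xi> $ k" for k y
    unfolding q_def
    by (simp add: pd_sum[OF cw UNIV_I] pd_cmult[OF smooth_w UNIV_I] pd_w if_distrib[of "\<lambda>x. _ * x"] cong: if_cong)
  have step: "pd k (\<lambda>y. q y * g y) y = \<xi> $ k * g y + q y * pd k g y" if "smooth_on UNIV g" for k g y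
    using pd_mult[OF q that UNIV_I] by (simp add: pdq)
  note mult = smooth_on_mult[OF open_UNIV] and add = smooth_on_add[OF open_UNIV]
    and cmult = smooth_on_cmult[OF open_UNIV]
  define \<kappa>1 where "\<kappa>1 l y = 3 * \<xi> $ l * \<kappa> y + q y * pd l \<kappa> y" for l y
  define \<kappa>2 where "\<kappa>2 k l y = 2 * \<xi> $ k * \<kappa>1 l y + q y * pd k (\<kappa>1 l) y" for k l y
  have \<kappa>1: "smooth_on UNIV (\<kappa>1 l)" for l
    unfolding \<kappa>1_def[abs_def] by (intro add cmult mult q \<kappa> smooth_on_pd)
  have \<kappa>2: "smooth_on UNIV (\<kappa>2 k l)" for k l
    unfolding \<kappa>2_def[abs_def] by (intro add cmult mult q \<kappa>1 smooth_on_pd)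
  show "smooth_on UNIV f" unfolding f_def by (intro mult q \<kappa>)
  have 1: "pd l f = (\<lambda>y. q y * (q y * \<kappa>1 l y))" for l
    unfolding f_def
    by (rule ext) (simp only: step[OF mult[OF q mult[OF q \<kappa>]]] step[OF mult[OF q \<kappa>]] step[OF \<kappa>],
        simp add: \<kappa>1_def algebra_simps)
  have 2: "pd k (\<lambda>y. q y * (q y * \<kappa>1 l y)) = (\<lambda>y. q y * \<kappa>2 k l y)" for k l
    by (rule ext) (simp only: step[OF mult[OF q \<kappa>1]] step[OF \<kappa>1], simp add: \<kappa>2_def algebra_simps)
  show "f y0 = 0" "pd l f y0 = 0" "pd k (pd l f) y0 = 0"
    by (simp_all add: 1 2 q0) (simp add: f_def q0)
  show "pd m (pd k (pd l f)) y0 = 6 * (\<xi> $ m * (\<xi> $ k * \<xi> $ l)) * \<kappa> y0"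
    unfolding 1 2 step[OF \<kappa>2] by (simp add: q0 \<kappa>2_def \<kappa>1_def)
qed

text \<open>A congruence by \<open>mat 1 + \<psi> y *\<^sub>R X\<close> respects the signature, and
  it preserves the 2-jet because \<open>\<psi>\<close> is a cube vanishing at \<open>y0\<close>. The
  1/6 in \<open>\<psi>\<close> cancels the 6 of \<open>cube_derivatives\<close>, and the 1/2 in
  \<open>X\<close> makes \<open>transpose X ** E + E ** X\<close> equal to \<open>h\<close>.\<close>

lemma cubic_perturbation:
  fixes h :: "real^'n^'n" and \<xi> :: "real^'n"
  assumes h: "transpose h = h"
  obtains H where "near_metric H" "smooth_on UNIV H" "jet_at H y0 = jet_at (model u) y0"
    "\<And>m. jet_derivative H y0 m = jet_derivative (model u) y0 m + \<xi> $ m *\<^sub>R (0, 0, quad_square \<xi> h)"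
proof -
  define q where "q y = (\<Sum>k\<in>UNIV. \<xi> $ k * w k y)" for y
  define X where "X = (1/2) *\<^sub>R (E ** h)"
  define \<psi> where "\<psi> y = (1/6) * (q y * (q y * q y))" for y
  define M where "M y = mat 1 + \<psi> y *\<^sub>R X" for y
  define H where "H y = transpose (M y) ** model u y ** M y" for y
  define \<kappa> where "\<kappa> y = transpose X ** model u y + model u y ** X + \<psi> y *\<^sub>R (transpose X ** model u y ** X)" for y
  define \<kappa>' where "\<kappa>' i j y = (1/6) * \<kappa> y $ i $ j" for i j y
  have q: "smooth_on UNIV q" unfolding q_def[abs_def] by (rule cube_derivatives(5)[OF smooth_on_const[OF open_UNIV, of 0]])
  have \<psi>: "smooth_on UNIV \<psi>" unfolding \<psi>_def[abs_def] by (intro smooth_on_cmult smooth_on_mult q open_UNIV)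
  have scale: "smooth_on UNIV (\<lambda>y. \<psi> y *\<^sub>R Y y)" if "smooth_on UNIV Y" for Y :: "real^'n \<Rightarrow> real^'n^'n"
    using that unfolding smooth_on_matrix[OF open_UNIV] by (simp add: smooth_on_mult[OF open_UNIV \<psi>])
  have M: "smooth_on UNIV M"
    unfolding M_def[abs_def] by (intro smooth_on_add smooth_on_const scale open_UNIV)
  have H: "smooth_on UNIV H"
    unfolding H_def[abs_def] by (intro smooth_on_matrix_mult smooth_on_transpose smooth_model M open_UNIV)
  have \<kappa>: "smooth_on UNIV \<kappa>"
    unfolding \<kappa>_def[abs_def] by (intro smooth_on_add scale smooth_on_matrix_mult smooth_on_const smooth_model open_UNIV)
  have \<kappa>': "smooth_on UNIV (\<kappa>' i j)" for i j
    unfolding \<kappa>'_def[abs_def] using \<kappa> unfolding smooth_on_matrix[OF open_UNIV] by (intro smooth_on_cmult open_UNIV) blast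
  have q0: "q y0 = 0" by (simp add: q_def)
  have M0: "M y0 = mat 1" by (simp add: M_def \<psi>_def q0)
  have near: "near_metric H"
    unfolding H_def[abs_def]
    by (rule near_metric_congruence[OF near_metric_model open_UNIV UNIV_I M]) (simp add: M0)
  have "H y = model u y + \<psi> y *\<^sub>R \<kappa> y" for y
    unfolding H_def M_def \<kappa>_def
    by (simp add: matrix_algebra matrix_mul_assoc scaleR_add_right)
  then have Hij: "(\<lambda>y. H y $ i $ j) = (\<lambda>y. model u y $ i $ j + q y * (q y * (q y * \<kappa>' i j y)))" for i j
    by (simp add: fun_eq_iff \<psi>_def \<kappa>'_def)
  have \<kappa>0: "\<kappa>' i j y0 = h $ i $ j / 6" for i j
  proof -
    have "transpose (E ** h) ** E = h" "E ** (E ** h) = h"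
      by (simp_all add: matrix_transpose_mul transpose_E h E_involution)
    then have "\<kappa> y0 = h"
      unfolding \<kappa>_def X_def by (simp add: model_0 \<psi>_def q0 matrix_algebra)
    then show ?thesis by (simp add: \<kappa>'_def)
  qed
  note cube = cube_derivatives[where \<xi> = \<xi>, OF \<kappa>', folded q_def]
  have smm: "smooth_on UNIV (\<lambda>y. model u y $ i $ j)" for i j
    using smooth_model unfolding smooth_on_matrix[OF open_UNIV] by blast
  have pd1: "pd l (\<lambda>y. H y $ i $ j) = (\<lambda>y. pd l (\<lambda>y. model u y $ i $ j) y + pd l (\<lambda>y. q y * (q y * (q y * \<kappa>' i j y))) y)" for l i j
    unfolding Hij by (rule ext) (rule pd_add[OF smm cube(6) UNIV_I])
  have pd2: "pd k (pd l (\<lambda>y. H y $ i $ j)) = (\<lambda>y. pd k (pd l (\<lambda>y. model u y $ i $ j)) y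
      + pd k (pd l (\<lambda>y. q y * (q y * (q y * \<kappa>' i j y)))) y)" for k l i j
    unfolding pd1 by (rule ext) (rule pd_add[OF smooth_on_pd[OF smm] smooth_on_pd[OF cube(6)] UNIV_I])
  have pd3: "pd m (pd k (pd l (\<lambda>y. H y $ i $ j))) y = pd m (pd k (pd l (\<lambda>y. model u y $ i $ j))) y
      + pd m (pd k (pd l (\<lambda>y. q y * (q y * (q y * \<kappa>' i j y))))) y" for m k l i j y
    unfolding pd2 by (rule pd_add[OF smooth_on_pd[OF smooth_on_pd[OF smm]] smooth_on_pd[OF smooth_on_pd[OF cube(6)]] UNIV_I])
  have a1: "pd m (\<lambda>y. H y $ i $ j) y0 = pd m (\<lambda>y. model u y $ i $ j) y0" for m i j
    unfolding pd1 by (simp add: cube(2))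
  have a2: "pd m (pd k (\<lambda>y. H y $ i $ j)) y0 = pd m (pd k (\<lambda>y. model u y $ i $ j)) y0" for m k i j
    unfolding pd2 by (simp add: cube(3))
  show thesis
  proof (rule that[OF near H])
    have "H y0 $ i $ j = model u y0 $ i $ j" for i j by (simp add: fun_cong[OF Hij] q0)
    then have "H y0 = model u y0" by (simp add: vec_eq_iff)
    then show "jet_at H y0 = jet_at (model u) y0"
      unfolding jet_at_def a1 a2 by simp
    show "jet_derivative H y0 m = jet_derivative (model u) y0 m + \<xi> $ m *\<^sub>R (0, 0, quad_square \<xi> h)" for m
      unfolding jet_derivative_def a1 a2 pd3 cube(4) \<kappa>0 by (simp add: quad_prod_def vec_eq_iff)
  qed
qed

lemma continuous_quad_sym: "continuous_on UNIV quad_sym"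
  unfolding quad_sym_def[abs_def] by (intro continuous_intros) simp

lemma continuous_component_model:
  assumes "length I = p"
  shows "continuous_on UNIV (\<lambda>u. component (model u) I)"
proof (intro continuous_at_imp_continuous_on ballI)
  fix u
  obtain W F where ext: "extends I W F" "(y0, jet_at (model u) y0) \<in> W"
    using extension_at[OF near_metric_model assms] by blast
  then have W: "open W" "smooth_on W F" by (auto simp: extends_def)
  define v where "v u = (y0, E, (0 :: real^'n^'n^'n), quad_sym u)" for u :: "'n quad"
  have v: "(y0, jet_at (model u) y0) = v u" for u by (simp add: v_def jet_model)
  have cv: "continuous_on UNIV v"
    unfolding v_def[abs_def] by (intro continuous_on_Pair continuous_on_const continuous_quad_sym)
  have op: "open (v -` W)" using cv W(1) by (simp add: open_vimage)
  have "continuous_on (v -` W) (\<lambda>u. F (v u))"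
    by (rule continuous_on_compose2[OF smooth_on_imp_continuous[OF W(2)] continuous_on_subset[OF cv]]) auto
  then have "continuous_on (v -` W) (\<lambda>u. component (model u) I)"
    by (rule continuous_on_eq) (use component_extension_eq[OF near_metric_model ext(1)] in \<open>auto simp: v\<close>)
  then show "isCont (\<lambda>u. component (model u) I) u"
    using op ext(2) v continuous_on_eq_continuous_at by fastforce
qed

section \<open>Consequences of vanishing divergence\<close>

context
  assumes div: "divergence_free A r s p \<omega>" and p: "p \<ge> 1"
begin

lemma divergence_zero:
  assumes "near_metric H" "Suc (length J) = p"
  shows "divergence c (lift c H) (\<lambda>z. \<omega> (jet2_of A (lift c H) z)) x J = 0"
proof -
  obtain N where "open (chart_inv c ` N)" "x \<in> chart_inv c ` N" "lift c H \<in> metrics_on A r s (chart_inv c ` N)"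
    using near_metricE[OF assms(1)] by blast
  then show ?thesis
    using div[unfolded divergence_free_def, rule_format, of "chart_inv c ` N" "lift c H" x c J]
      chart_at assms(2) by auto
qed

text \<open>\<open>model u'\<close> and its cubic perturbation have the same 2-jet, but the k-th
  derivatives of their jets differ by \<open>\<xi> $ k\<close> times
  \<open>quad_square \<xi> h\<close>. Comparing their divergences shows that the contracted
  components have derivative zero along the line \<open>u + t *\<^sub>R sq\<close>; as this holds at
  every t, they are constant on it.\<close>

lemma component_contraction:
  fixes \<xi> :: "real^'n"
  assumes J: "Suc (length J) = p" and h: "transpose h = h"
  shows "(\<Sum>k\<in>UNIV. \<xi> $ k * component (model (u + quad_square \<xi> h)) (J @ [k]))
    = (\<Sum>k\<in>UNIV. \<xi> $ k * component (model u) (J @ [k]))"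
proof -
  define sq where "sq = quad_square \<xi> h"
  have hij: "h $ j $ i = h $ i $ j" for i j using arg_cong[OF h, of "\<lambda>h. h $ i $ j"] by (simp add: transpose_def)
  have sq_sym: "quad_sym (u + t *\<^sub>R sq) = quad_sym u + t *\<^sub>R sq" for u t
    by (rule quad_eqI) (simp add: quad_sym_def sq_def quad_prod_def hij field_simps)
  define g where "g t = (\<Sum>k\<in>UNIV. \<xi> $ k * component (model (u + t *\<^sub>R sq)) (J @ [k]))" for t
  have "(g has_real_derivative 0) (at t)" for t
  proof -
    define u' where "u' = u + t *\<^sub>R sq"
    obtain H where H: "near_metric H" "smooth_on UNIV H" "jet_at H y0 = jet_at (model u') y0"
      "\<And>m. jet_derivative H y0 m = jet_derivative (model u') y0 m + \<xi> $ m *\<^sub>R (0, 0, sq)"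
      using cubic_perturbation[OF h, of u' \<xi>] unfolding sq_def by blast
    obtain D where D: "(jet_at (model u') has_derivative D) (at y0)"
      "\<And>m. D (axis m 1) = jet_derivative (model u') y0 m"
      using jet_at_derivative[OF open_UNIV UNIV_I smooth_model] by blast
    obtain D' where D': "(jet_at H has_derivative D') (at y0)"
      "\<And>m. D' (axis m 1) = jet_derivative H y0 m"
      using jet_at_derivative[OF open_UNIV UNIV_I H(2)] by blast
    have DD': "(axis m 1, D' (axis m 1)) = (axis m 1, D (axis m 1)) + \<xi> $ m *\<^sub>R (0, 0, 0, sq)" for m :: 'n
      unfolding D(2) D'(2) H(4) by simp
    have "\<exists>W F. extends (J @ [k]) W F \<and> (y0, jet_at (model u') y0) \<in> W" for k
      using extension_at[OF near_metric_model, of "J @ [k]"] J by simp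
    then obtain W F where ext: "\<And>k. extends (J @ [k]) (W k) (F k)" "\<And>k. (y0, jet_at (model u') y0) \<in> W k"
      by metis
    then have W: "open (W k)" "smooth_on (W k) (F k)" for k by (simp_all add: extends_def)
    define F' where "F' k = frechet_derivative (F k) (at (y0, jet_at (model u') y0))" for k
    have F': "(F k has_derivative F' k) (at (y0, jet_at (model u') y0))" for k
      unfolding F'_def by (rule smooth_on_has_derivative[OF W(2) ext(2)])
    have linF': "linear (F' k)" for k by (rule has_derivative_linear[OF F'])
    have "(\<Sum>k\<in>UNIV. F' k (axis k 1, D' (axis k 1))) = (\<Sum>k\<in>UNIV. F' k (axis k 1, D (axis k 1)))"
      using divergence_cong[OF H(1) near_metric_model jet_cong[OF H(1) near_metric_model H(3)]
          divergence_zero[OF H(1) J] divergence_zero[OF near_metric_model J]]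
        component_derivative[OF near_metric_model ext D(1)]
        component_derivative[OF H(1) ext(1) ext(2)[folded H(3)] D'(1)]
      by (simp add: F'_def H(3))
    then have zero: "(\<Sum>k\<in>UNIV. \<xi> $ k * F' k (0, 0, 0, sq)) = 0"
      unfolding DD' linear_add[OF linF'] linear_scale[OF linF'] by (simp add: sum.distrib)
    have comp: "((\<lambda>t. component (model (u + t *\<^sub>R sq)) (J @ [k])) has_real_derivative F' k (0, 0, 0, sq)) (at t)" for k
    proof -
      define v where "v t = (y0, E, (0 :: real^'n^'n^'n), quad_sym u + t *\<^sub>R sq)" for t
      have v: "(y0, jet_at (model (u + t *\<^sub>R sq)) y0) = v t" for t by (simp add: v_def jet_model sq_sym)
      have dv: "(v has_derivative (\<lambda>h. (0, 0, 0, h *\<^sub>R sq))) (at t)"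
        unfolding v_def[abs_def] by (auto intro!: derivative_eq_intros has_derivative_Pair)
      have Fv: "(F k has_derivative F' k) (at (v t))" using F'[of k] by (simp add: u'_def v)
      have "((\<lambda>t. F k (v t)) has_derivative (\<lambda>h. F' k (0, 0, 0, h *\<^sub>R sq))) (at t)"
        by (rule has_derivative_compose[OF dv Fv])
      moreover have "F' k (0, 0, 0, h *\<^sub>R sq) = F' k (0, 0, 0, sq) * h" for h
        using linear_scale[OF linF', of k h "(0, 0, 0, sq)"] by simp
      ultimately have der: "((\<lambda>t. F k (v t)) has_real_derivative F' k (0, 0, 0, sq)) (at t)"
        by (simp add: has_field_derivative_def)
      have "continuous_on UNIV v"
        unfolding v_def[abs_def] by (intro continuous_intros)
      then have op: "open (v -` W k)" using W(1) by (simp add: open_vimage)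
      show ?thesis
      proof (rule has_field_derivative_transform_within_open[OF der op])
        show "t \<in> v -` W k" using ext(2)[of k] by (simp add: u'_def v)
        show "F k (v t') = component (model (u + t' *\<^sub>R sq)) (J @ [k])" if "t' \<in> v -` W k" for t'
        proof -
          have "component (model (u + t' *\<^sub>R sq)) (J @ [k]) = F k (y0, jet_at (model (u + t' *\<^sub>R sq)) y0)"
            by (rule component_extension_eq[OF near_metric_model ext(1)]) (use that in \<open>simp add: v\<close>)
          then show ?thesis by (simp add: v)
        qed
      qed
    qed
    have "(g has_real_derivative (\<Sum>k\<in>UNIV. \<xi> $ k * F' k (0, 0, 0, sq))) (at t)"
      unfolding g_def[abs_def] by (intro DERIV_sum DERIV_cmult comp)
    then show ?thesis by (simp only: zero)
  qed
  then have "g 1 = g 0" by (intro DERIV_isconst_all) blast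
  then show ?thesis by (simp add: g_def sq_def)
qed

theorem component_model_zero:
  assumes "length I = p"
  shows "component (model u) I = 0"
proof -
  \<comment> \<open>By \<open>p \<ge> 1\<close> there is a last index, the one that the divergence
    contracts.\<close>
  obtain J k where I: "I = J @ [k]" using assms p by (cases I rule: rev_cases) auto
  then have J: "Suc (length J) = p" using assms by simp
  then have pJ: "p = Suc (length J)" by simp
  have Jk: "length (J @ [k]) = p" for k using J by simp
  interpret curvature_family "\<lambda>k u. component (model u) (J @ [k])" "\<lambda>m. \<Prod>i<length J. flip_sign m (J ! i)"
  proof
    show "component (model u) (J @ [k]) = component (model v) (J @ [k])" if "quad_sym u = quad_sym v" for u v k
      by (rule component_model_cong[OF that])
    show "component (model (u + quad_unit (k, l, i, j, e))) (J @ [k'])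
        = component (model (u + quad_unit (i, j, k, l, e))) (J @ [k'])" for k' u k l i j e
      by (rule component_model_swap[OF Jk])
    show "(\<Sum>k\<in>UNIV. \<xi> $ k * component (model (u + quad_square \<xi> h)) (J @ [k]))
        = (\<Sum>k\<in>UNIV. \<xi> $ k * component (model u) (J @ [k]))" if "transpose h = h" for h \<xi> u
      by (rule component_contraction[OF J that])
    \<comment> \<open>Either \<open>k\<close> occurs in \<open>J\<close> and the component vanishes
      by skew symmetry, or the reflection of the k-th coordinate leaves all of \<open>J\<close>
      alone.\<close>
    show "component (model u) (J @ [k]) = 0 \<or> (\<Prod>i<length J. flip_sign k (J ! i)) = 1" for k u
    proof (cases "k \<in> set J")
      case True
      then show ?thesis using component_repeated[OF near_metric_model J] by blast
    next
      case False
      then have "flip_sign k (J ! i) = 1" if "i < length J" for i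
        using that by (auto simp: flip_sign_def)
      then show ?thesis by simp
    qed
    show "component (model (quad_flip m u)) (J @ [k])
        = (\<Prod>i<length J. flip_sign m (J ! i)) * flip_sign m k * component (model u) (J @ [k])" for m u k
      unfolding component_model_flip[OF Jk] unfolding pJ by (simp add: nth_append)
    show "continuous_on UNIV (\<lambda>u. component (model u) (J @ [k]))" for k
      by (rule continuous_component_model[OF Jk])
  qed
  show ?thesis unfolding I by (rule vanishes)
qed


section \<open>Normal coordinates and conclusion\<close>

text \<open>Symmetry of the metric and of second derivatives makes the array \<open>u\<close> a
  fixed point of \<open>quad_sym\<close>, so \<open>model u\<close> has the same 2-jet as
  \<open>G\<close>.\<close>

lemma component_normalized_zero:
  assumes G: "near_metric G" "G y0 = E" "\<And>k i j. pd k (\<lambda>y. G y $ i $ j) y0 = 0" and I: "length I = p"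
  shows "component G I = 0"
proof -
  obtain N where N: "open N" "y0 \<in> N" "local_metric r s N G" "smooth_on N G" using near_metricE[OF G(1)] by blast
  have Gij: "smooth_on N (\<lambda>y. G y $ i $ j)" for i j
    using N(4) unfolding smooth_on_matrix[OF N(1)] by blast
  have sym: "G y $ i $ j = G y $ j $ i" if "y \<in> N" for y i j
  proof -
    have "transpose (G y) = G y" using N(3) that by (simp add: local_metric_def)
    from arg_cong[OF this, of "\<lambda>h. h $ j $ i"] show ?thesis by (simp add: transpose_def)
  qed
  define u :: "'n quad" where "u = (\<chi> k l i j. pd k (pd l (\<lambda>y. G y $ i $ j)) y0)"
  have "pd k (pd l (\<lambda>y. G y $ i $ j)) y0 = pd k (pd l (\<lambda>y. G y $ j $ i)) y0" for k l i j
    by (intro pd_cong[OF N(1)] sym N(2))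
  moreover have "pd k (pd l (\<lambda>y. G y $ i $ j)) y0 = pd l (pd k (\<lambda>y. G y $ i $ j)) y0" for k l i j
    by (rule pd_commute[OF N(1,2) Gij])
  ultimately have "u $ l $ k $ i $ j = u $ k $ l $ i $ j" "u $ k $ l $ j $ i = u $ k $ l $ i $ j" for k l i j
    unfolding u_def vec_lambda_beta by blast+
  then have "quad_sym u = u"
    by (intro quad_eqI) (simp add: quad_sym_def)
  then have "jet_at G y0 = jet_at (model u) y0"
    unfolding jet_model by (simp add: jet_at_def G(2,3) u_def vec_eq_iff)
  then have "component G I = component (model u) I"
    by (rule component_cong[OF G(1) near_metric_model])
  then show ?thesis using component_model_zero[OF I] by simp
qed

text \<open>
  Up to sign the coefficients \<open>cs\<close> are the Christoffel symbols of the first kind: the quadratic change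
  of coordinates with these coefficients kills the first derivatives of the metric.
\<close>

lemma component_zero_at_E:
  assumes K: "near_metric K" "K y0 = E" and I: "length I = p"
  shows "component K I = 0"
proof -
  obtain N where N: "open N" "y0 \<in> N" "local_metric r s N K" "smooth_on N K" using near_metricE[OF K(1)] by blast
  have Kij: "smooth_on N (\<lambda>y. K y $ i $ j)" for i j
    using N(4) unfolding smooth_on_matrix[OF N(1)] by blast
  define L where "L k i j = pd k (\<lambda>y. K y $ i $ j) y0" for k i j
  have Lsym: "L k i j = L k j i" for k i j
    unfolding L_def
  proof (rule pd_cong[OF N(1,2)])
    fix y assume "y \<in> N"
    then have "transpose (K y) = K y" using N(3) by (simp add: local_metric_def)
    from arg_cong[OF this, of "\<lambda>h. h $ j $ i"] show "K y $ i $ j = K y $ j $ i" by (simp add: transpose_def)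
  qed
  define cs where "cs i j k = - (L k i j + L j i k - L i j k) / 2" for i j k
  have cs_sym: "cs i j k = cs i k j" for i j k
    unfolding cs_def using Lsym[of i j k] by simp
  \<comment> \<open>Half of \<open>cs\<close>, because a symmetric quadratic form has twice its
    coefficients as second derivatives.\<close>
  define sh where "sh i y = (\<Sum>j\<in>UNIV. \<Sum>k\<in>UNIV. cs i j k / 2 * (w j y * w k y))" for i y
  have sh: "smooth_on UNIV (sh l)" "vord (Suc 1) (sh l) y0" for l
    using quadratic_form(1,5)[where a = "\<lambda>j k. cs l j k / 2"] unfolding sh_def[abs_def] numeral_2_eq_2 One_nat_def by blast+
  have pdsh0: "pd j (sh i) y0 = 0" for i j
    using sh(2)[of i] by simp
  have pdsh: "pd k (pd j (sh i)) y = cs i j k" for i j k y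
    using quadratic_form(4)[where a = "\<lambda>j k. cs i j k / 2"] unfolding sh_def[abs_def]
    by (simp add: cs_sym[of i k j])
  obtain G where G: "near_metric G" "\<And>J. length J = p \<Longrightarrow> component K J = component G J"
    "\<And>i j. vord (Suc 1) (\<lambda>y. G y $ i $ j - (K y $ i $ j + pd j (sh i) y + pd i (sh j) y)) y0"
    using pullback_near_identity[where sh = sh, OF K sh order_refl] by blast
  obtain N' where N': "open N'" "y0 \<in> N'" "smooth_on N' G" using near_metricE[OF G(1)] by blast
  define V where "V = N \<inter> N'"
  have V: "open V" "y0 \<in> V" using N N' by (auto simp: V_def)
  have smG: "smooth_on V (\<lambda>y. G y $ i $ j)" for i j
    using smooth_on_subset[OF N'(3), of V] unfolding smooth_on_matrix[OF V(1)] by (simp add: V_def)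
  have smK: "smooth_on V (\<lambda>y. K y $ i $ j)" for i j
    by (rule smooth_on_subset[OF Kij]) (simp add: V_def)
  have smsh: "smooth_on V (pd j (sh i))" for i j
    by (rule smooth_on_subset[OF smooth_on_pd[OF sh(1)]]) simp
  note add = smooth_on_add[OF V(1)]
  have G0: "G y0 $ i $ j = E $ i $ j" for i j
    using G(3)[of i j] by (simp add: K(2) pdsh0)
  have "pd k (\<lambda>y. G y $ i $ j) y0 = 0" for k i j
  proof -
    have "pd k (\<lambda>y. G y $ i $ j - (K y $ i $ j + pd j (sh i) y + pd i (sh j) y)) y0 = 0"
      using G(3)[of i j] by simp
    \<comment> \<open>Since \<open>cs\<close> is symmetric in its last two indices, requiring this
      sum to vanish is the linear system that also determines the Levi-Civita connection.\<close>
    then have "pd k (\<lambda>y. G y $ i $ j) y0 = L k i j + cs i j k + cs j i k"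
      by (simp add: pd_diff[OF smG add[OF add[OF smK smsh] smsh] V(2)] pd_add[OF add[OF smK smsh] smsh V(2)]
          pd_add[OF smK smsh V(2)] pdsh L_def)
    also have "\<dots> = 0"
      unfolding cs_def Lsym[of k j i] by (simp add: field_simps)
    finally show ?thesis .
  qed
  moreover have "G y0 = E" using G0 by (simp add: vec_eq_iff)
  ultimately show ?thesis
    using component_normalized_zero[OF G(1) _ _ I] G(2)[OF I] by simp
qed

text \<open>The linear change of coordinates by \<open>P\<close> brings the value at
  \<open>y0\<close> to \<open>E\<close>; components transform linearly, so their vanishing carries
  over.\<close>

lemma component_zero_congruent:
  assumes H: "near_metric H" and P: "invertible P" "transpose P ** H y0 ** P = E" and I: "length I = p"
  shows "component H I = 0"
proof -
  have "component (\<lambda>y. transpose P ** H (y0 + P *v (y - y0)) ** P) J = 0" if "length J = p" for J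
    by (rule component_zero_at_E[OF component_linear(1)[OF H P(1)] _ that]) (simp add: P(2))
  then show ?thesis unfolding component_linear(2)[OF H P(1) I] by simp
qed

end

end

text \<open>The signature at \<open>y0\<close> supplies the diagonalising \<open>P\<close> and the
  set \<open>S\<close> of positive directions; the normal form \<open>E\<close> is thus chosen for
  each metric separately.\<close>

lemma (in natural_tensor) component_zero:
  assumes "divergence_free A r s p \<omega>" "p \<ge> 1" "near_metric H" "length I = p"
  shows "component H I = 0"
proof -
  have "has_signature r s (H y0)"
    using assms(3) by (auto simp: near_metric_def local_metric_def)
  then obtain P :: "real^'n^'n" and S where P: "invertible P" "card S = r" "card (- S) = s"
    "transpose P ** H y0 ** P = (\<chi> i j. if i \<noteq> j then 0 else if i \<in> S then 1 else - 1)"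
    unfolding has_signature_def by blast
  interpret normal: natural_tensor_normal A r s p \<omega> c x S
    by unfold_locales (use P in auto)
  show ?thesis
    by (rule normal.component_zero_congruent[OF assms(1-3) P(1) _ assms(4)]) (simp add: P(4) normal.E_def)
qed

theorem theorem6p4:
  fixes A :: "('a::{t2_space,second_countable_topology}, 'n::finite) chart set"
    and \<omega> :: "('a, 'n) jet2 \<Rightarrow> ('a, 'n) tensor"
    and r s p :: nat
  assumes "smooth_atlas A"
    and "r + s = CARD('n)"
    and "p \<ge> 1"
    and "tensor_morphism A r s p \<omega>"
    and "natural A r s p \<omega>"
    and "divergence_free A r s p \<omega>"
  shows "\<forall>z \<in> jet2_bundle A r s. \<omega> z = (\<lambda>c I. 0)"
proof (intro ballI ext)
  fix z c I
  assume z: "z \<in> jet2_bundle A r s"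
  then obtain g x U where g: "z = jet2_of A g x" "open U" "x \<in> U" "g \<in> metrics_on A r s U"
    by (auto simp: jet2_bundle_def)
  have zx: "fst z = x" by (simp add: g(1) jet2_of_def)
  have "\<omega> z \<in> contravariant_tensors A p x"
    using assms(4) z zx by (auto simp: tensor_morphism_def p_vectors_def)
  \<comment> \<open>By convention, components in charts not around \<open>x\<close> or with a
    multi-index of another length are 0.\<close>
  then have outside: "c \<notin> charts_at A x \<or> length I \<noteq> p \<Longrightarrow> \<omega> z c I = 0"
    unfolding contravariant_tensors_def by blast
  show "\<omega> z c I = 0"
  proof (cases "c \<in> charts_at A x \<and> length I = p")
    case True
    then interpret natural_tensor A r s p \<omega> c x
      using assms by unfold_locales auto
    define H where "H y = g (chart_inv c y) c" for y
    have "local_metric r s (snd c ` (fst c \<inter> U)) H"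
      unfolding H_def[abs_def] by (rule metric_in_chart[OF c(1) g(2,4)])
    then have H: "near_metric H"
      unfolding near_metric_def using c(2) g(3) by (intro exI[of _ "snd c ` (fst c \<inter> U)"]) (auto simp: y0_def)
    obtain N where N: "open (chart_inv c ` N)" "x \<in> chart_inv c ` N" "lift c H \<in> metrics_on A r s (chart_inv c ` N)"
      using near_metricE[OF H] by blast
    \<comment> \<open>The abstract metric \<open>g\<close> is replaced by the lift of its own matrix
      field in \<open>c\<close>: the two jets agree in the chart \<open>c\<close>, hence in all
      charts.\<close>
    have "jet2_of A g x = jet2_of A (lift c H) x"
      by (rule jet2_determined[OF g(2,4) N(1,3) g(3) N(2) chart_at])
        (simp only: jet2_of_lift[OF c], simp only: jet2_of_chart[OF c] H_def[abs_def])
    then have "\<omega> z c I = component H I"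
      by (simp add: component_def g(1))
    then show ?thesis
      using component_zero[OF assms(6,3) H] True by simp
  qed (use outside in blast)
qed

end
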